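(* Let $m,n,p,q\ge3$ be odd and $k\ge 3$. Suppose $\mathcal{F}_i$, $\mathcal{G}_i$, $\mathcal{H}_i$, $\mathcal{K}_i$ ($1\le i\le k$) are families of pairwise almost orthogonal symmetric chain decompositions of $Q_m$, $Q_n$, $Q_p$, $Q_q$ respectively, and two of these four families are good. Then there exist $k$ pairwise almost orthogonal symmetric chain decompositions $\mathcal{D}_1,\dots,\mathcal{D}_k$ of $Q_{m+n+p+q}=Q_m\times Q_n\times Q_p\times Q_q$ such that for each $i$ every chain of $\mathcal{D}_i$ is contained in a cuboid $A\times B\times C\times D$ with $A\in\mathcal{F}_i$, $B\in\mathcal{G}_i$, $C\in\mathcal{H}_i$, $D\in\mathcal{K}_i$.
   Context: $Q_n$ denotes the Boolean lattice of subsets of $[n]=\{1,\dots,n\}$ under inclusion; products of hypercubes (product order) are identified with the hypercube of the summed dimension. A symmetric chain in $Q_n$ consists of exactly one subset of each size $j,\dots,n-j$ for some $j$; a symmetric chain decomposition (SCD) is a partition into symmetric chains. Two SCDs $\mathcal{F},\mathcal{G}$ of $Q_n$ are almost orthogonal if for all chains $A\in\mathcal{F}$, $B\in\mathcal{G}$, $|A\cap B|\le1$, except when $A$ and $B$ both contain $\varnothing$ and $[n]$, in which case $|A\cap B|=2$. For $n$ odd, a collection $\{\mathcal{F}^j\}$ of pairwise almost orthogonal SCDs of $Q_n$ is good if the graph whose vertex set is the union of all $2$-element chains of all $\mathcal{F}^j$ and whose edges are these $2$-element chains admits an orientation in which every vertex has out-degree at most $1$. *)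

theory Defs
  imports Main "HOL-Library.Disjoint_Sets"
begin

(* The Boolean lattice Q_n is "Pow {1..n}" ordered by inclusion. *)

definition symmetric_chain :: "nat \<Rightarrow> nat set set \<Rightarrow> bool" where
  "symmetric_chain n C \<longleftrightarrow>
     subset.chain (Pow {1..n}) C \<and> (\<exists>j. 2 * j \<le> n \<and> bij_betw card C {j..n - j})"

definition scd :: "nat \<Rightarrow> nat set set set \<Rightarrow> bool" where
  "scd n \<F> \<longleftrightarrow> partition_on (Pow {1..n}) \<F> \<and> (\<forall>C\<in>\<F>. symmetric_chain n C)"

definition almost_orthogonal :: "nat \<Rightarrow> nat set set set \<Rightarrow> nat set set set \<Rightarrow> bool" where
  "almost_orthogonal n \<F> \<G> \<longleftrightarrow>
     (\<forall>A\<in>\<F>. \<forall>B\<in>\<G>.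
        if {{}, {1..n}} \<subseteq> A \<and> {{}, {1..n}} \<subseteq> B then card (A \<inter> B) = 2
        else card (A \<inter> B) \<le> 1)"

definition ao_scds :: "nat \<Rightarrow> nat \<Rightarrow> (nat \<Rightarrow> nat set set set) \<Rightarrow> bool" where
  "ao_scds n k \<F> \<longleftrightarrow>
     (\<forall>i\<in>{1..k}. scd n (\<F> i)) \<and>
     pairwise (\<lambda>i j. almost_orthogonal n (\<F> i) (\<F> j)) {1..k}"

(* E is the edge set of a simple graph (a set of 2-element sets); an orientation is a set of
   arcs containing exactly one of the two directions of every edge, and nothing else. *)
definition orientation :: "'v set set \<Rightarrow> ('v \<times> 'v) set \<Rightarrow> bool" where
  "orientation E R \<longleftrightarrow>
     (\<forall>(u, v)\<in>R. {u, v} \<in> E) \<and>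
     (\<forall>u v. {u, v} \<in> E \<longrightarrow> ((u, v) \<in> R) \<noteq> ((v, u) \<in> R))"

definition two_chains :: "nat \<Rightarrow> (nat \<Rightarrow> nat set set set) \<Rightarrow> nat set set set" where
  "two_chains k \<F> = {C. card C = 2 \<and> (\<exists>i\<in>{1..k}. C \<in> \<F> i)}"

definition good :: "nat \<Rightarrow> nat \<Rightarrow> (nat \<Rightarrow> nat set set set) \<Rightarrow> bool" where
  "good n k \<F> \<longleftrightarrow>
     odd n \<and> ao_scds n k \<F> \<and>
     (\<exists>R. orientation (two_chains k \<F>) R \<and>
          (\<forall>u\<in>\<Union>(two_chains k \<F>). card {v. (u, v) \<in> R} \<le> 1))"

(* The identification of Q_m x Q_n with Q_(m+n): the second factor is shifted to {m+1..m+n}. *)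
definition cube_pair :: "nat \<Rightarrow> nat set \<Rightarrow> nat set \<Rightarrow> nat set" where
  "cube_pair m X Y = X \<union> (\<lambda>i. m + i) ` Y"

lemma cube_pair_subset_iff:
  assumes "X \<subseteq> {1..m}" "Y \<subseteq> {1..n}" "X' \<subseteq> {1..m}" "Y' \<subseteq> {1..n}"
  shows "cube_pair m X Y \<subseteq> cube_pair m X' Y' \<longleftrightarrow> X \<subseteq> X' \<and> Y \<subseteq> Y'"
proof -
  have XX: "x \<in> cube_pair m X Y \<longleftrightarrow> (if x \<le> m then x \<in> X else x - m \<in> Y)"
    if "X \<subseteq> {1..m}" "Y \<subseteq> {1..n}" for x X Y
    using that unfolding cube_pair_def by (force simp: image_iff subset_iff)
  show ?thesis
  proof
    assume s: "cube_pair m X Y \<subseteq> cube_pair m X' Y'"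
    show "X \<subseteq> X' \<and> Y \<subseteq> Y'"
    proof (intro conjI subsetI)
      fix x assume "x \<in> X" then show "x \<in> X'"
        using s assms XX[of X Y x] XX[of X' Y' x] by (auto split: if_splits)
    next
      fix y assume y: "y \<in> Y"
      then have "1 \<le> y" using assms by auto
      then show "y \<in> Y'"
        using y s assms XX[of X Y "m + y"] XX[of X' Y' "m + y"] by auto
    qed
  qed (auto simp: cube_pair_def)
qed

lemma cube_pair_bij_betw:
  "bij_betw (\<lambda>(X, Y). cube_pair m X Y) (Pow {1..m} \<times> Pow {1..n}) (Pow {1..m + n})"
proof -
  have inj: "inj_on (\<lambda>(X, Y). cube_pair m X Y) (Pow {1..m} \<times> Pow {1..n})"
  proof (rule inj_onI, clarify)
    fix X Y X' Y'
    assume a: "X \<subseteq> {1..m}" "Y \<subseteq> {1..n}" "X' \<subseteq> {1..m}" "Y' \<subseteq> {1..n}"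
      and eq: "cube_pair m X Y = cube_pair m X' Y'"
    show "X = X' \<and> Y = Y'"
      using cube_pair_subset_iff[OF a] cube_pair_subset_iff[OF a(3,4,1,2)] eq by blast
  qed
  have img: "(\<lambda>(X, Y). cube_pair m X Y) ` (Pow {1..m} \<times> Pow {1..n}) \<subseteq> Pow {1..m + n}"
  proof (clarify)
    fix X Y x assume "X \<subseteq> {1..m}" "Y \<subseteq> {1..n}" "x \<in> cube_pair m X Y"
    then show "x \<in> {1..m + n}" unfolding cube_pair_def by fastforce
  qed
  have "card ((\<lambda>(X, Y). cube_pair m X Y) ` (Pow {1..m} \<times> Pow {1..n})) = card (Pow {1..m + n})"
    unfolding card_image[OF inj] by (simp add: card_Pow power_add)
  with img have "(\<lambda>(X, Y). cube_pair m X Y) ` (Pow {1..m} \<times> Pow {1..n}) = Pow {1..m + n}"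
    by (intro card_subset_eq) auto
  with inj show ?thesis by (simp add: bij_betw_def)
qed

definition cuboid ::
  "nat \<Rightarrow> nat \<Rightarrow> nat \<Rightarrow> nat set set \<Rightarrow> nat set set \<Rightarrow> nat set set \<Rightarrow> nat set set \<Rightarrow> nat set set" where
  "cuboid m n p A B C D =
     {cube_pair m a (cube_pair n b (cube_pair p c d)) | a b c d. a \<in> A \<and> b \<in> B \<and> c \<in> C \<and> d \<in> D}"

end

theory Submission
  imports Defs
begin

text \<open>
  Choose for an index \<open>i\<close> a chain from each of the four decompositions; the products of such chains are cuboids
  that partition the large cube. If \<open>u \<subset> v\<close> lie in cuboids of two different indices, then by almost
  orthogonality \<open>u\<close> and \<open>v\<close> agree in each factor or are its empty and its full set there, so \<open>v - u\<close> is a union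
  of ground sets of factors. It is therefore enough to split each cuboid into symmetric chains without
  such bad pairs, \<open>\<emptyset>\<close> and the full set excepted. A factor chain contains a bad pair only if it is maximal,
  and then only its two ends are bad. With a case distinction on the number of maximal factor chains, explicit
  lattice paths do this for all cuboids except the products of one maximal chain and three two-element chains.
  There one bad pair remains, but it can be placed over either element of any one of the two-element
  chains. Choose this chain in a good family (the maximal chain uses up at most one of the two) and place the
  pair over its source in the orientation: out-degree at most one means that different indices have
  different sources, so this bad pair is not shared either.
\<close>

section \<open>Partitions into chains and products\<close>

text \<open>The obstacle is the length of the partner of a maximal chain. In a grid with one row,
  that row itself joins the two ends of the maximal chain. In a grid with two rows, the path from
  bottom to top has to change rows at one of the two ends, since otherwise the remaining cells do
  not form a chain; so some row keeps both its ends on one path. From three rows on this can be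
  avoided. Hence every tame chain that still has to meet a maximal one is kept at length at least
  three, which is what the length bounds record. Odd ground sets give chains of even length, so the
  grid of two maximal chains is square or its sides differ by at least two. Only a square ends in a
  single cell, and the stars exist to absorb that cell. A two-element chain may meet a product of
  two maximal chains, because that product supplies a second long path through which a detour is
  possible. With a single maximal chain and three two-element chains that second path is missing,
  and the bad pairs are steered instead of removed.\<close>

definition splits :: "('b list \<Rightarrow> bool) \<Rightarrow> 'b set \<Rightarrow> bool" where
  "splits \<Phi> P \<longleftrightarrow> (\<exists>\<C>. P = (\<Union>c\<in>\<C>. set c) \<and> (\<forall>c\<in>\<C>. \<Phi> c) \<and>
     (\<forall>c\<in>\<C>. \<forall>d\<in>\<C>. set c \<inter> set d \<noteq> {} \<longrightarrow> c = d))"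

lemma splits_empty: "splits \<Phi> {}"
  unfolding splits_def by (rule exI[of _ "{}"]) auto

lemma splits_single: "\<Phi> c \<Longrightarrow> splits \<Phi> (set c)"
  unfolding splits_def by (rule exI[of _ "{c}"]) auto

text \<open>The premise offers \<open>set c \<subseteq> P\<close>, so that a property of chains may
  follow merely from the region in which they lie.\<close>

lemma splits_mono:
  assumes "splits \<Phi> P" "\<And>c. \<Phi> c \<Longrightarrow> set c \<subseteq> P \<Longrightarrow> \<Psi> c"
  shows "splits \<Psi> P"
proof -
  obtain \<C> where C: "P = (\<Union>c\<in>\<C>. set c)" "\<forall>c\<in>\<C>. \<Phi> c" "\<forall>c\<in>\<C>. \<forall>d\<in>\<C>. set c \<inter> set d \<noteq> {} \<longrightarrow> c = d"
    using assms(1) unfolding splits_def by blast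
  have "\<forall>c\<in>\<C>. \<Psi> c" using C assms(2) by blast
  then show ?thesis using C unfolding splits_def by blast
qed

lemma splits_Union:
  assumes "\<And>Q. Q \<in> \<Q> \<Longrightarrow> splits \<Phi> Q"
    and "\<And>Q Q'. Q \<in> \<Q> \<Longrightarrow> Q' \<in> \<Q> \<Longrightarrow> Q \<inter> Q' \<noteq> {} \<Longrightarrow> Q = Q'"
  shows "splits \<Phi> (\<Union>\<Q>)"
proof -
  have "\<exists>f. \<forall>Q\<in>\<Q>. Q = (\<Union>c\<in>f Q. set c) \<and> (\<forall>c\<in>f Q. \<Phi> c) \<and>
     (\<forall>c\<in>f Q. \<forall>d\<in>f Q. set c \<inter> set d \<noteq> {} \<longrightarrow> c = d)"
    using assms(1) unfolding splits_def by (intro bchoice) blast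
  then obtain f where f1: "\<And>Q. Q \<in> \<Q> \<Longrightarrow> Q = (\<Union>c\<in>f Q. set c)" and f2: "\<And>Q c. Q \<in> \<Q> \<Longrightarrow> c \<in> f Q \<Longrightarrow> \<Phi> c"
    and f3: "\<And>Q c d. Q \<in> \<Q> \<Longrightarrow> c \<in> f Q \<Longrightarrow> d \<in> f Q \<Longrightarrow> set c \<inter> set d \<noteq> {} \<Longrightarrow> c = d"
    by metis
  have sub: "set c \<subseteq> Q" if "Q \<in> \<Q>" "c \<in> f Q" for c Q using f1[OF that(1)] that(2) by blast
  show ?thesis unfolding splits_def
  proof (intro exI[of _ "\<Union>Q\<in>\<Q>. f Q"] conjI ballI impI)
    show "\<Union>\<Q> = (\<Union>c\<in>\<Union>Q\<in>\<Q>. f Q. set c)" using f1 by (simp add: UN_UN_flatten)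
  next
    fix c d assume "c \<in> (\<Union>Q\<in>\<Q>. f Q)" "d \<in> (\<Union>Q\<in>\<Q>. f Q)" and ne: "set c \<inter> set d \<noteq> {}"
    then obtain Q Q' where Q: "Q \<in> \<Q>" "c \<in> f Q" "Q' \<in> \<Q>" "d \<in> f Q'" by blast
    have "Q = Q'" using assms(2)[OF Q(1,3)] sub[OF Q(1,2)] sub[OF Q(3,4)] ne by blast
    then show "c = d" using f3 Q ne by blast
  qed (use f2 in blast)
qed

lemma splits_Un:
  assumes "splits \<Phi> P" "splits \<Phi> Q" "P \<inter> Q = {}"
  shows "splits \<Phi> (P \<union> Q)"
proof -
  have "splits \<Phi> (\<Union>{P, Q})"
  proof (rule splits_Union)
    fix A B assume "A \<in> {P, Q}" "B \<in> {P, Q}" "A \<inter> B \<noteq> {}"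
    then show "A = B" using assms(3) by blast
  qed (use assms(1,2) in blast)
  then show ?thesis by simp
qed

lemma splits_image:
  assumes "splits \<Phi> P" "inj_on f P" "\<And>c. \<Phi> c \<Longrightarrow> set c \<subseteq> P \<Longrightarrow> \<Psi> (map f c)"
  shows "splits \<Psi> (f ` P)"
proof -
  obtain \<C> where C: "P = (\<Union>c\<in>\<C>. set c)" "\<forall>c\<in>\<C>. \<Phi> c" "\<forall>c\<in>\<C>. \<forall>d\<in>\<C>. set c \<inter> set d \<noteq> {} \<longrightarrow> c = d"
    using assms(1) unfolding splits_def by blast
  have sub: "set c \<subseteq> P" if "c \<in> \<C>" for c using C(1) that by blast
  show ?thesis unfolding splits_def
  proof (intro exI[of _ "map f ` \<C>"] conjI)
    show "f ` P = (\<Union>c\<in>map f ` \<C>. set c)" using C(1) by auto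
    show "\<forall>c\<in>map f ` \<C>. \<Psi> c" using C(2) assms(3) sub by blast
    show "\<forall>c\<in>map f ` \<C>. \<forall>d\<in>map f ` \<C>. set c \<inter> set d \<noteq> {} \<longrightarrow> c = d"
    proof (clarify)
      fix c d assume cd: "c \<in> \<C>" "d \<in> \<C>" and ne: "set (map f c) \<inter> set (map f d) \<noteq> {}"
      have "set c \<inter> set d \<noteq> {}"
        using ne inj_on_image_Int[OF assms(2) sub[OF cd(1)] sub[OF cd(2)]] by auto
      then show "map f c = map f d" using C(3) cd by blast
    qed
  qed
qed

section \<open>Products of set families over disjoint ground sets\<close>

definition prd :: "'a set set \<Rightarrow> 'a set set \<Rightarrow> 'a set set" (infixl \<open>\<otimes>\<close> 70) where
  "P \<otimes> Q = (\<lambda>(x, y). x \<union> y) ` (P \<times> Q)"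

lemma prd_iff: "z \<in> P \<otimes> Q \<longleftrightarrow> (\<exists>x\<in>P. \<exists>y\<in>Q. z = x \<union> y)"
  by (auto simp: prd_def)

lemma prd_comm: "P \<otimes> Q = Q \<otimes> P"
  unfolding prd_def by (auto simp: image_iff Un_commute)

lemma prdI: "x \<in> P \<Longrightarrow> y \<in> Q \<Longrightarrow> x \<union> y \<in> P \<otimes> Q"
  by (auto simp: prd_iff)

lemma prdE:
  assumes "z \<in> P \<otimes> Q"
  obtains x y where "x \<in> P" "y \<in> Q" "z = x \<union> y"
  using assms by (auto simp: prd_iff)

lemma prd_assoc: "(P \<otimes> Q) \<otimes> R = P \<otimes> (Q \<otimes> R)"
proof (intro set_eqI iffI)
  fix z assume "z \<in> (P \<otimes> Q) \<otimes> R"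
  then obtain x y w where "x \<in> P" "y \<in> Q" "w \<in> R" "z = x \<union> (y \<union> w)"
    by (elim prdE) (simp add: Un_assoc)
  then show "z \<in> P \<otimes> (Q \<otimes> R)" by (simp add: prdI)
next
  fix z assume "z \<in> P \<otimes> (Q \<otimes> R)"
  then obtain x y w where "x \<in> P" "y \<in> Q" "w \<in> R" "z = (x \<union> y) \<union> w"
    by (elim prdE) (simp add: Un_assoc)
  then show "z \<in> (P \<otimes> Q) \<otimes> R" by (simp only: prdI)
qed

lemma prd_left_comm: "P \<otimes> (Q \<otimes> R) = Q \<otimes> (P \<otimes> R)"
  by (metis prd_assoc prd_comm)

text \<open>Elements of a product are unions, not tuples, so regrouping and permuting factors are
  equalities. This is what allows the four factors to be sorted later.\<close>

lemmas prd_ac = prd_assoc prd_comm prd_left_comm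

lemma prd_Un: "(P \<union> P') \<otimes> Q = P \<otimes> Q \<union> P' \<otimes> Q"
  by (simp add: prd_def Sigma_Un_distrib1 image_Un)

lemma prd_sub: "P \<subseteq> Pow V \<Longrightarrow> Q \<subseteq> Pow W \<Longrightarrow> P \<otimes> Q \<subseteq> Pow (V \<union> W)"
  unfolding prd_iff subset_iff by auto

lemma prd_restrict:
  assumes "P \<subseteq> Pow V" "Q \<subseteq> Pow W" "V \<inter> W = {}" "z \<in> P \<otimes> Q"
  shows "z \<inter> V \<in> P" "z \<inter> W \<in> Q"
proof -
  obtain x y where xy: "x \<in> P" "y \<in> Q" "z = x \<union> y" using assms(4) unfolding prd_iff by blast
  then have "z \<inter> V = x" "z \<inter> W = y" using assms by blast+
  then show "z \<inter> V \<in> P" "z \<inter> W \<in> Q" using xy by auto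
qed

lemma prd_disjoint:
  assumes "P \<subseteq> Pow V" "P' \<subseteq> Pow V" "Q \<subseteq> Pow W" "V \<inter> W = {}" "P \<inter> P' = {}"
  shows "(P \<otimes> Q) \<inter> (P' \<otimes> Q) = {}"
  using prd_restrict(1)[OF assms(1,3,4)] prd_restrict(1)[OF assms(2,3,4)] assms(5) by blast

text \<open>Splitting one factor splits the product into blocks \<open>set c \<otimes> Q\<close>.
  They stay disjoint because intersecting with \<open>V\<close> recovers the first component. Each
  block may then be treated by its own method.\<close>

lemma splits_prd:
  assumes "splits \<Phi> P" "P \<subseteq> Pow V" "Q \<subseteq> Pow W" "V \<inter> W = {}"
    and "\<And>c. \<Phi> c \<Longrightarrow> set c \<subseteq> P \<Longrightarrow> splits \<Psi> (set c \<otimes> Q)"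
  shows "splits \<Psi> (P \<otimes> Q)"
proof -
  obtain \<C> where C: "P = (\<Union>c\<in>\<C>. set c)" "\<forall>c\<in>\<C>. \<Phi> c" "\<forall>c\<in>\<C>. \<forall>d\<in>\<C>. set c \<inter> set d \<noteq> {} \<longrightarrow> c = d"
    using assms(1) unfolding splits_def by blast
  have sub: "set c \<subseteq> P" if "c \<in> \<C>" for c using C(1) that by blast
  have eq: "P \<otimes> Q = \<Union>((\<lambda>c. set c \<otimes> Q) ` \<C>)"
    using C(1) by (force simp: prd_iff set_eq_iff)
  show ?thesis unfolding eq
  proof (rule splits_Union)
    fix A B assume "A \<in> (\<lambda>c. set c \<otimes> Q) ` \<C>" "B \<in> (\<lambda>c. set c \<otimes> Q) ` \<C>" and ne: "A \<inter> B \<noteq> {}"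
    then obtain c d where cd: "c \<in> \<C>" "d \<in> \<C>" "A = set c \<otimes> Q" "B = set d \<otimes> Q" by blast
    have "set c \<inter> set d \<noteq> {}"
      using prd_disjoint[of "set c" V "set d" Q W] sub cd assms(2-4) ne by blast
    then show "A = B" using C(3) cd by blast
  qed (use C(2) sub assms(5) in blast)
qed

section \<open>Paths in a grid\<close>

definition grid_step :: "nat \<times> nat \<Rightarrow> nat \<times> nat \<Rightarrow> bool" where
  "grid_step c d \<longleftrightarrow> d = (Suc (fst c), snd c) \<or> d = (fst c, Suc (snd c))"

lemma grid_step_Pair [simp]: "grid_step (x, y) (x', y') \<longleftrightarrow> x' = Suc x \<and> y' = y \<or> x' = x \<and> y' = Suc y"
  by (auto simp: grid_step_def)

text \<open>The last condition is symmetry: if the rows and columns of the grid are two symmetric chains, then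
  \<open>x + y\<close> is the rank of the cell \<open>(x, y)\<close> above the bottom of the grid.\<close>

definition grid_chain :: "nat \<Rightarrow> nat \<Rightarrow> (nat \<times> nat) list \<Rightarrow> bool" where
  "grid_chain a b g \<longleftrightarrow> g \<noteq> [] \<and> successively grid_step g \<and> set g \<subseteq> {..a} \<times> {..b} \<and>
     fst (hd g) + snd (hd g) + fst (last g) + snd (last g) = a + b"

definition hseg :: "nat \<Rightarrow> nat \<Rightarrow> nat \<Rightarrow> (nat \<times> nat) list" where
  "hseg y i j = map (\<lambda>x. (x, y)) [i..<j]"

definition vseg :: "nat \<Rightarrow> nat \<Rightarrow> nat \<Rightarrow> (nat \<times> nat) list" where
  "vseg x i j = map (\<lambda>y. (x, y)) [i..<j]"

lemma successively_upt: "successively (\<lambda>x y. y = Suc x) [i..<j]"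
  by (induction j) (auto simp: successively_append_iff le_less)

lemma seg_simps [simp]:
  "successively grid_step (hseg y i j)" "successively grid_step (vseg x i j)"
  "hseg y i j = [] \<longleftrightarrow> j \<le> i" "vseg x i j = [] \<longleftrightarrow> j \<le> i"
  "i < j \<Longrightarrow> hd (hseg y i j) = (i, y)" "i < j \<Longrightarrow> hd (vseg x i j) = (x, i)"
  "i < j \<Longrightarrow> last (hseg y i j) = (j - 1, y)" "i < j \<Longrightarrow> last (vseg x i j) = (x, j - 1)"
  "c \<in> set (hseg y i j) \<longleftrightarrow> snd c = y \<and> i \<le> fst c \<and> fst c < j"
  "c \<in> set (vseg x i j) \<longleftrightarrow> fst c = x \<and> i \<le> snd c \<and> snd c < j"
  "length (hseg y i j) = j - i" "length (vseg x i j) = j - i"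
proof -
  show "successively grid_step (hseg y i j)" "successively grid_step (vseg x i j)"
    unfolding hseg_def vseg_def successively_map
    using successively_upt[of i j] by (auto simp: grid_step_def elim: successively_mono)
qed (cases c; auto simp: hseg_def vseg_def hd_map last_map image_iff)+

text \<open>What is left of the grid \<open>{..a} \<times> {..b}\<close> when \<open>i\<close> nested hooks along its left and upper sides are removed.\<close>

definition hook_rect :: "nat \<Rightarrow> nat \<Rightarrow> nat \<Rightarrow> (nat \<times> nat) set" where
  "hook_rect a b i = {c. i \<le> fst c \<and> fst c \<le> a \<and> snd c + i \<le> b}"

text \<open>The path climbs column \<open>i\<close> to row \<open>b - i\<close> and then runs right
  to column \<open>a\<close>. Its ranks go from \<open>i\<close> to \<open>a + b - i\<close>, which
  makes it symmetric.\<close>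

definition hook :: "nat \<Rightarrow> nat \<Rightarrow> nat \<Rightarrow> (nat \<times> nat) list" where
  "hook a b i = vseg i 0 (b - i) @ hseg (b - i) i (Suc a)"

lemma hook:
  assumes "i \<le> a" "i \<le> b"
  shows "grid_chain a b (hook a b i)"
    and "length (hook a b i) = Suc (a + b) - 2 * i"
    and "hook_rect a b i = set (hook a b i) \<union> hook_rect a b (Suc i)" "set (hook a b i) \<inter> hook_rect a b (Suc i) = {}"
proof -
  show "grid_chain a b (hook a b i)"
    unfolding grid_chain_def successively_append_iff hook_def using assms
    by (auto simp: hd_append)
  show "length (hook a b i) = Suc (a + b) - 2 * i" using assms by (simp add: hook_def)
  show "hook_rect a b i = set (hook a b i) \<union> hook_rect a b (Suc i)" "set (hook a b i) \<inter> hook_rect a b (Suc i) = {}"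
    using assms by (auto simp: hook_rect_def hook_def)
qed

text \<open>Peeling hooks stops at \<open>i = min a b\<close>, where the hook has
  \<open>|a - b| + 1\<close> cells. This is at least three exactly under the stated difference of
  the sides; in a square the last hook is one cell.\<close>

lemma splits_hook_rect:
  "splits (\<lambda>g. grid_chain a b g \<and> (a \<ge> b + 2 \<or> b \<ge> a + 2 \<longrightarrow> length g \<ge> 3)) (hook_rect a b i)"
proof (induction "Suc a - i" arbitrary: i)
  case 0
  then have "hook_rect a b i = {}" by (auto simp: hook_rect_def)
  then show ?case by (simp add: splits_empty)
next
  case (Suc n)
  show ?case
  proof (cases "i \<le> b")
    case False
    then have "hook_rect a b i = {}" by (auto simp: hook_rect_def)
    then show ?thesis by (simp add: splits_empty)
  next
    case True
    have "i \<le> a" using Suc by simp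
    note H = hook[OF this True]
    show ?thesis unfolding H(3)
    proof (rule splits_Un[OF splits_single _ H(4)])
      show "splits (\<lambda>g. grid_chain a b g \<and> (a \<ge> b + 2 \<or> b \<ge> a + 2 \<longrightarrow> length g \<ge> 3)) (hook_rect a b (Suc i))"
        using Suc by simp
    qed (use H(1,2) True \<open>i \<le> a\<close> in auto)
  qed
qed

section \<open>Symmetric chains and bad differences\<close>

definition covers :: "'a set \<Rightarrow> 'a set \<Rightarrow> bool" where
  "covers x y \<longleftrightarrow> (\<exists>e. e \<notin> x \<and> y = insert e x)"

lemma covers_psubset: "covers x y \<Longrightarrow> x \<subset> y"
  by (auto simp: covers_def)

lemma covers_card: "covers x y \<Longrightarrow> finite x \<Longrightarrow> card y = Suc (card x)"
  by (auto simp: covers_def)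

lemma covers_Un_left: "covers x x' \<Longrightarrow> x' \<subseteq> V \<Longrightarrow> y \<subseteq> W \<Longrightarrow> V \<inter> W = {} \<Longrightarrow> covers (x \<union> y) (x' \<union> y)"
  unfolding covers_def by blast

lemma covers_Un_right: "covers y y' \<Longrightarrow> x \<subseteq> V \<Longrightarrow> y' \<subseteq> W \<Longrightarrow> V \<inter> W = {} \<Longrightarrow> covers (x \<union> y) (x \<union> y')"
  unfolding covers_def by blast

text \<open>The list form of a symmetric chain, over an arbitrary ground set. Lists give positions,
  which become the grid coordinates, and direct access to both ends.\<close>

definition sym_chain :: "'a set \<Rightarrow> 'a set list \<Rightarrow> bool" where
  "sym_chain W xs \<longleftrightarrow> finite W \<and> xs \<noteq> [] \<and> successively covers xs \<and> set xs \<subseteq> Pow W \<and>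
     card (hd xs) + card (last xs) = card W"

lemma sym_chain_covers: "sym_chain W xs \<Longrightarrow> Suc i < length xs \<Longrightarrow> covers (xs ! i) (xs ! Suc i)"
  by (auto simp: sym_chain_def successively_conv_nth)

lemma sym_chain_nth: "sym_chain W xs \<Longrightarrow> i < length xs \<Longrightarrow> xs ! i \<subseteq> W \<and> finite (xs ! i)"
  unfolding sym_chain_def by (meson PowD finite_subset nth_mem subsetD)

lemma sym_chain_mono:
  assumes "sym_chain W xs" "i \<le> j" "j < length xs"
  shows "xs ! i \<subseteq> xs ! j \<and> card (xs ! j) = card (xs ! i) + (j - i)"
  using assms(2,3)
proof (induction j rule: dec_induct)
  case (step n)
  have "covers (xs ! n) (xs ! Suc n)" using sym_chain_covers[OF assms(1)] step by simp
  moreover have "finite (xs ! n)" using sym_chain_nth[OF assms(1), of n] step by simp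
  ultimately show ?case using step covers_psubset covers_card by fastforce
qed simp

lemma sym_chain_subset_iff:
  assumes "sym_chain W xs" "i < length xs" "j < length xs"
  shows "xs ! i \<subseteq> xs ! j \<longleftrightarrow> i \<le> j"
proof
  assume s: "xs ! i \<subseteq> xs ! j"
  show "i \<le> j"
  proof (rule ccontr)
    assume "\<not> i \<le> j"
    then have "xs ! j \<subseteq> xs ! i \<and> card (xs ! i) = card (xs ! j) + (i - j)"
      using sym_chain_mono[OF assms(1), of j i] assms by simp
    then show False using s \<open>\<not> i \<le> j\<close> by (metis add_eq_self_zero diff_is_0_eq subset_antisym)
  qed
qed (use sym_chain_mono assms in blast)

lemma sym_chain_nth_eq_iff:
  "sym_chain W xs \<Longrightarrow> i < length xs \<Longrightarrow> j < length xs \<Longrightarrow> xs ! i = xs ! j \<longleftrightarrow> i = j"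
  using sym_chain_subset_iff[of W xs i j] sym_chain_subset_iff[of W xs j i] by auto

lemma sym_chain_card_first:
  assumes "sym_chain W xs" "length xs = Suc a"
  shows "2 * card (xs ! 0) + a = card W"
proof -
  have "xs \<noteq> []" using assms(2) by auto
  then have "card (hd xs) = card (xs ! 0)" "card (last xs) = card (xs ! 0) + a"
    using sym_chain_mono[OF assms(1), of 0 a] assms(2) by (auto simp: hd_conv_nth last_conv_nth)
  then show ?thesis using assms(1) by (simp add: sym_chain_def)
qed

definition cell :: "'a set list \<Rightarrow> 'a set list \<Rightarrow> nat \<times> nat \<Rightarrow> 'a set" where
  "cell xs ys c = xs ! fst c \<union> ys ! snd c"

lemma cell_image:
  assumes "length xs = Suc a" "length ys = Suc b"
  shows "cell xs ys ` ({..a} \<times> {..b}) = set xs \<otimes> set ys"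
proof -
  have "set xs = (!) xs ` {..a}" "set ys = (!) ys ` {..b}"
    using assms by (auto simp: set_conv_nth less_Suc_eq_le image_iff)
  then have "set xs \<times> set ys = map_prod ((!) xs) ((!) ys) ` ({..a} \<times> {..b})"
    by (simp add: map_prod_surj_on[OF refl refl])
  moreover have "cell xs ys = (\<lambda>(x, y). x \<union> y) \<circ> map_prod ((!) xs) ((!) ys)"
    by (auto simp: fun_eq_iff cell_def)
  ultimately show ?thesis by (simp add: prd_def image_comp)
qed

text \<open>The flag \<open>l\<close> records that the chain with positions \<open>0, \<dots>, a\<close> may be maximal, so that its two ends may
  differ by a set of \<open>U\<close> (see below).\<close>

definition ends :: "bool \<Rightarrow> nat \<Rightarrow> nat \<Rightarrow> nat \<Rightarrow> bool" where
  "ends l a x x' \<longleftrightarrow> x = x' \<or> l \<and> x = 0 \<and> x' = a"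

text \<open>The grid form of tameness: by \<open>f_bad\<close>, cells that violate this are the only
  candidates for a bad pair in a product of two chains.\<close>

definition avoids :: "bool \<Rightarrow> bool \<Rightarrow> nat \<Rightarrow> nat \<Rightarrow> (nat \<times> nat) set \<Rightarrow> bool" where
  "avoids l k a b G \<longleftrightarrow> (\<forall>(x, y)\<in>G. \<forall>(x', y')\<in>G. ends l a x x' \<longrightarrow> ends k b y y' \<longrightarrow> x = x' \<and> y = y')"

text \<open>In the application, \<open>U\<close> consists of the unions of the four ground sets.\<close>

locale bad_differences =
  fixes U :: "'a set set"
  assumes inter: "d \<in> U \<Longrightarrow> d' \<in> U \<Longrightarrow> d \<inter> d' \<in> U"
    and union: "d \<in> U \<Longrightarrow> d' \<in> U \<Longrightarrow> d \<union> d' \<in> U"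
begin

definition tame_but_ends :: "bool \<Rightarrow> 'a set list \<Rightarrow> bool" where
  "tame_but_ends l xs \<longleftrightarrow> (\<forall>i j. i \<le> j \<and> j < length xs \<and> xs ! j - xs ! i \<in> U \<longrightarrow> ends l (length xs - 1) i j)"

definition tame :: "'a set set \<Rightarrow> bool" where
  "tame P \<longleftrightarrow> (\<forall>u\<in>P. \<forall>v\<in>P. u \<subset> v \<longrightarrow> v - u \<notin> U)"

definition tame_chain :: "'a set \<Rightarrow> 'a set list \<Rightarrow> bool" where
  "tame_chain W xs \<longleftrightarrow> sym_chain W xs \<and> tame (set xs)"

text \<open>The abstract form of a maximal chain: it starts at \<open>{}\<close>, hence by symmetry
  ends at \<open>W\<close>, and these two ends are its only possible bad pair. Some chains of
  products have this form too, so that they can be multiplied further.\<close>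

definition loose_chain :: "'a set \<Rightarrow> 'a set list \<Rightarrow> bool" where
  "loose_chain W xs \<longleftrightarrow> sym_chain W xs \<and> tame_but_ends True xs \<and> hd xs = {}"

lemma tame_mono: "tame P \<Longrightarrow> Q \<subseteq> P \<Longrightarrow> tame Q"
  unfolding tame_def by blast

lemma tame_iff_tame_but_ends: "sym_chain W xs \<Longrightarrow> tame (set xs) \<longleftrightarrow> tame_but_ends False xs"
proof
  assume s: "sym_chain W xs" and t: "tame (set xs)"
  show "tame_but_ends False xs" unfolding tame_but_ends_def ends_def
  proof (intro allI impI)
    fix i j assume h: "i \<le> j \<and> j < length xs \<and> xs ! j - xs ! i \<in> U"
    then have "\<not> xs ! i \<subset> xs ! j" using t unfolding tame_def by (meson le_less_trans nth_mem)
    then have "xs ! i = xs ! j" using sym_chain_mono[OF s] h by blast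
    then show "i = j \<or> False \<and> i = 0 \<and> j = length xs - 1"
      using sym_chain_nth_eq_iff[OF s, of i j] h by simp
  qed
next
  assume s: "sym_chain W xs" and t: "tame_but_ends False xs"
  show "tame (set xs)" unfolding tame_def
  proof (intro ballI impI)
    fix u v assume "u \<in> set xs" "v \<in> set xs" and uv: "u \<subset> v"
    then obtain i j where ij: "i < length xs" "j < length xs" "u = xs ! i" "v = xs ! j"
      by (metis in_set_conv_nth)
    then have "i \<le> j" "i \<noteq> j" using uv sym_chain_subset_iff[OF s, of i j] by auto
    then show "v - u \<notin> U" using t ij unfolding tame_but_ends_def ends_def by blast
  qed
qed

lemma tame_chain_tame_but_ends: "tame_chain W xs \<Longrightarrow> tame_but_ends False xs"
  using tame_iff_tame_but_ends tame_chain_def by blast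

end

text \<open>Coordinates for a product of two chains: cell \<open>(x, y)\<close> stands for
  \<open>xs ! x \<union> ys ! y\<close>, and \<open>a\<close>, \<open>b\<close> are the last
  positions, not the lengths. The flags tell which factor may have a bad pair at its ends.\<close>

locale chain_pair = bad_differences +
  fixes V W :: "'a set" and xs ys :: "'a set list" and l k :: bool and a b :: nat
  assumes VU: "V \<in> U" and WU: "W \<in> U" and disj: "V \<inter> W = {}"
    and xs: "sym_chain V xs" "tame_but_ends l xs" "length xs = Suc a"
    and ys: "sym_chain W ys" "tame_but_ends k ys" "length ys = Suc b"
begin

abbreviation "f \<equiv> cell xs ys"

lemma xs_sub: "x \<le> a \<Longrightarrow> xs ! x \<subseteq> V" and ys_sub: "y \<le> b \<Longrightarrow> ys ! y \<subseteq> W"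
  using sym_chain_nth[OF xs(1)] sym_chain_nth[OF ys(1)] xs(3) ys(3) by auto

lemma f_restrict: "x \<le> a \<Longrightarrow> y \<le> b \<Longrightarrow> f (x, y) \<inter> V = xs ! x"
  "x \<le> a \<Longrightarrow> y \<le> b \<Longrightarrow> f (x, y) \<inter> W = ys ! y"
  using xs_sub ys_sub disj unfolding cell_def by fastforce+

lemma inj_f: "inj_on f ({..a} \<times> {..b})"
proof (rule inj_onI)
  fix c d assume "c \<in> {..a} \<times> {..b}" "d \<in> {..a} \<times> {..b}" "f c = f d"
  moreover obtain x y x' y' where "c = (x, y)" "d = (x', y')" by fastforce
  ultimately show "c = d"
    using f_restrict[of x y] f_restrict[of x' y'] sym_chain_nth_eq_iff[OF xs(1), of x x']
      sym_chain_nth_eq_iff[OF ys(1), of y y'] xs(3) ys(3) by auto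
qed

lemma f_image: "f ` ({..a} \<times> {..b}) = set xs \<otimes> set ys"
  using cell_image xs(3) ys(3) .

text \<open>Intersecting a bad difference with \<open>V\<close> or \<open>W\<close> gives the
  difference in that factor, and it is bad again because \<open>U\<close> is closed under
  intersection. So badness can be read off coordinate by coordinate.\<close>

lemma f_bad:
  assumes "x \<le> a" "y \<le> b" "x' \<le> a" "y' \<le> b" "f (x, y) \<subseteq> f (x', y')" "f (x', y') - f (x, y) \<in> U"
  shows "ends l a x x' \<and> ends k b y y'"
proof -
  note r = f_restrict[OF assms(1,2)] f_restrict[OF assms(3,4)]
  have "xs ! x \<subseteq> xs ! x'" "ys ! y \<subseteq> ys ! y'" using r assms(5) by blast+
  then have le: "x \<le> x'" "y \<le> y'"
    using sym_chain_subset_iff[OF xs(1)] sym_chain_subset_iff[OF ys(1)] assms xs(3) ys(3) by auto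
  have "xs ! x' - xs ! x = (f (x', y') - f (x, y)) \<inter> V" "ys ! y' - ys ! y = (f (x', y') - f (x, y)) \<inter> W"
    using r by blast+
  then have "xs ! x' - xs ! x \<in> U" "ys ! y' - ys ! y \<in> U" using inter assms(6) VU WU by auto
  then show ?thesis using xs ys assms le unfolding tame_but_ends_def by fastforce
qed

lemma f_tame:
  assumes "G \<subseteq> {..a} \<times> {..b}" "avoids l k a b G"
  shows "tame (f ` G)"
  unfolding tame_def
proof (intro ballI impI notI)
  fix u v assume "u \<in> f ` G" "v \<in> f ` G" "u \<subset> v" "v - u \<in> U"
  then obtain x y x' y' where c: "(x, y) \<in> G" "(x', y') \<in> G" "u = f (x, y)" "v = f (x', y')" by auto
  then have "ends l a x x' \<and> ends k b y y'"
    using f_bad[of x y x' y'] assms(1) \<open>u \<subset> v\<close> \<open>v - u \<in> U\<close> by auto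
  then have "x = x' \<and> y = y'" using assms(2) c(1,2) unfolding avoids_def by blast
  then show False using c \<open>u \<subset> v\<close> by simp
qed

lemma f_covers:
  assumes "grid_step (x, y) (x', y')" "x' \<le> a" "y' \<le> b"
  shows "covers (f (x, y)) (f (x', y'))"
  using assms(1) unfolding grid_step_Pair
proof
  assume h: "x' = Suc x \<and> y' = y"
  then have "covers (xs ! x) (xs ! x')" using sym_chain_covers[OF xs(1), of x] xs(3) assms by simp
  then show ?thesis using h covers_Un_left[OF _ xs_sub[OF assms(2)] ys_sub[OF assms(3)] disj]
    by (simp add: cell_def)
next
  assume h: "x' = x \<and> y' = Suc y"
  then have "covers (ys ! y) (ys ! y')" using sym_chain_covers[OF ys(1), of y] ys(3) assms by simp
  then show ?thesis using h covers_Un_right[OF _ xs_sub[OF assms(2)] ys_sub[OF assms(3)] disj]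
    by (simp add: cell_def)
qed

lemma f_card:
  assumes "x \<le> a" "y \<le> b"
  shows "card (f (x, y)) = card (xs ! 0) + card (ys ! 0) + (x + y)"
proof -
  have "card (f (x, y)) = card (xs ! x) + card (ys ! y)" unfolding cell_def fst_conv snd_conv
    using sym_chain_nth[OF xs(1), of x] sym_chain_nth[OF ys(1), of y] assms disj xs(3) ys(3)
    by (intro card_Un_disjoint) auto
  then show ?thesis
    using sym_chain_mono[OF xs(1), of 0 x] sym_chain_mono[OF ys(1), of 0 y] assms xs(3) ys(3) by simp
qed

lemma f_sym_chain:
  assumes "grid_chain a b g"
  shows "sym_chain (V \<union> W) (map f g)"
proof -
  have g: "g \<noteq> []" "successively grid_step g" "set g \<subseteq> {..a} \<times> {..b}"
    "fst (hd g) + snd (hd g) + fst (last g) + snd (last g) = a + b"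
    using assms by (auto simp: grid_chain_def)
  have fin: "finite V" "finite W" using xs ys by (auto simp: sym_chain_def)
  have "successively covers (map f g)" unfolding successively_map
    using g(2)
  proof (rule successively_mono)
    fix c d assume cd: "c \<in> set g" "d \<in> set g" "grid_step c d"
    moreover obtain x y x' y' where "c = (x, y)" "d = (x', y')" by (metis surj_pair)
    ultimately show "covers (f c) (f d)" using f_covers[of x y x' y'] g(3) by auto
  qed
  moreover have "f c \<subseteq> V \<union> W" if "c \<in> set g" for c
    using that g(3) xs_sub[of "fst c"] ys_sub[of "snd c"] unfolding cell_def by fastforce
  moreover have "card (hd (map f g)) + card (last (map f g)) = card (V \<union> W)"
  proof -
    obtain x y x' y' where e: "hd g = (x, y)" "last g = (x', y')" by fastforce
    then have "(x, y) \<in> set g" "(x', y') \<in> set g" using g(1) by (metis hd_in_set last_in_set)+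
    then have "card (f (x, y)) = card (xs ! 0) + card (ys ! 0) + (x + y)"
       "card (f (x', y')) = card (xs ! 0) + card (ys ! 0) + (x' + y')"
      using f_card g(3) by auto
    moreover have "card (V \<union> W) = card V + card W" using fin disj by (simp add: card_Un_disjoint)
    ultimately show ?thesis
      using sym_chain_card_first[OF xs(1,3)] sym_chain_card_first[OF ys(1,3)] g(1,4) e
      by (simp add: hd_map last_map)
  qed
  ultimately show ?thesis using g(1) fin unfolding sym_chain_def by auto
qed

lemma f_tame_chain: "grid_chain a b g \<Longrightarrow> avoids l k a b (set g) \<Longrightarrow> tame_chain (V \<union> W) (map f g)"
  using f_sym_chain f_tame[of "set g"] unfolding tame_chain_def grid_chain_def by simp

lemma splits_f:
  assumes "splits \<Phi> G" "G \<subseteq> {..a} \<times> {..b}"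
    and "\<And>g. \<Phi> g \<Longrightarrow> set g \<subseteq> G \<Longrightarrow> grid_chain a b g \<and> avoids l k a b (set g) \<and> r \<le> length g"
  shows "splits (\<lambda>c. tame_chain (V \<union> W) c \<and> r \<le> length c) (f ` G)"
  using assms(1) inj_on_subset[OF inj_f assms(2)]
  by (rule splits_image) (use assms(3) f_tame_chain in force)

end

section \<open>Decompositions of grids\<close>

text \<open>With \<open>i >= 1\<close> the region misses the left column and the top row, while the
  two ends of a row need the former and the two ends of a column need the latter.\<close>

lemma hook_rect_avoids: "1 \<le> i \<Longrightarrow> G \<subseteq> hook_rect a b i \<Longrightarrow> avoids l k a b G"
  unfolding avoids_def ends_def hook_rect_def by fastforce

lemma hook_rect_sub: "hook_rect a b i \<subseteq> {..a} \<times> {..b}"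
  by (auto simp: hook_rect_def)

lemma splits_hook_rect_avoids:
  assumes "1 \<le> i"
  shows "splits (\<lambda>g. grid_chain a b g \<and> avoids l k a b (set g) \<and>
    (a \<ge> b + 2 \<or> b \<ge> a + 2 \<longrightarrow> length g \<ge> 3)) (hook_rect a b i)"
  using splits_hook_rect by (rule splits_mono) (use hook_rect_avoids[OF assms] in blast)

lemma splits_rectangle: "splits (grid_chain a b) ({..a} \<times> {..b})"
proof -
  have "hook_rect a b 0 = {..a} \<times> {..b}" by (auto simp: hook_rect_def)
  then show ?thesis using splits_mono[OF splits_hook_rect[of a b 0], of "grid_chain a b"] by simp
qed

lemma rectangle_eqI:
  assumes "G \<subseteq> {..a} \<times> {..b}" "\<And>x y. x \<le> a \<Longrightarrow> y \<le> b \<Longrightarrow> (x, y) \<in> G"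
  shows "{..a} \<times> {..b} = G"
  using assms by (fastforce simp: set_eq_iff)

text \<open>Here a path is bad if it holds both ends of one row. \<open>Z\<close> meets the left
  column only in row 0 and the right column only in rows \<open>b - 1\<close> and \<open>b\<close>,
  which are not row 0 since \<open>b >= 2\<close>. \<open>W\<close> never reaches the right column,
  and the remaining hooks never touch the left one.\<close>

lemma splits_avoiding_left_right:
  assumes "a \<ge> 2" "b \<ge> 2"
  shows "splits (\<lambda>g. grid_chain a b g \<and> avoids True False a b (set g)) ({..a} \<times> {..b})"
proof -
  define Z where "Z = (0, 0) # vseg 1 0 b @ hseg (b - 1) 2 (Suc a) @ [(a, b)]"
  define W where "W = vseg 0 1 (Suc b) @ hseg b 1 a"
  have gZ: "grid_chain a b Z" unfolding Z_def grid_chain_def using assms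
    by (auto simp: successively_append_iff successively_Cons hd_append)
  have gW: "grid_chain a b W" unfolding W_def grid_chain_def using assms
    by (auto simp: successively_append_iff successively_Cons hd_append)
  have aZ: "avoids True False a b (set Z)" and aW: "avoids True False a b (set W)"
    using assms by (auto simp: avoids_def ends_def Z_def W_def)
  have eq: "{..a} \<times> {..b} = set Z \<union> (set W \<union> hook_rect a b (2))"
  proof (rule rectangle_eqI)
    show "set Z \<union> (set W \<union> hook_rect a b (2)) \<subseteq> {..a} \<times> {..b}"
      using gZ gW hook_rect_sub by (auto simp: grid_chain_def)
    fix x y assume xy: "x \<le> a" "y \<le> b"
    consider "x = 0" | "x = 1" | "x \<ge> 2" by linarith
    then show "(x, y) \<in> set Z \<union> (set W \<union> hook_rect a b (2))"
      by cases (use xy assms in \<open>auto simp: Z_def W_def hook_rect_def\<close>)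
  qed
  have d: "set W \<inter> hook_rect a b (2) = {}" "set Z \<inter> (set W \<union> hook_rect a b (2)) = {}"
    using assms by (auto simp: Z_def W_def hook_rect_def)
  show ?thesis unfolding eq
    by (intro splits_Un splits_single d conjI gZ gW aZ aW
        splits_mono[OF splits_hook_rect_avoids[of 2 a b True False]]) auto
qed

section \<open>Grid paths for two maximal chains\<close>

definition corner_chain :: "nat \<Rightarrow> nat \<Rightarrow> (nat \<times> nat) list \<Rightarrow> bool" where
  "corner_chain a b Z \<longleftrightarrow> grid_chain a b Z \<and> hd Z = (0, 0) \<and>
     (\<forall>(x, y)\<in>set Z. \<forall>(x', y')\<in>set Z. ends True a x x' \<longrightarrow> ends True b y y' \<longrightarrow>
        x = x' \<and> y = y' \<or> x = 0 \<and> y = 0 \<and> x' = a \<and> y' = b)"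

text \<open>Only the first path meets two corners, \<open>(0, 0)\<close> and \<open>(a, b)\<close>. The second one starts and ends next to
  these two and avoids all corners, so that the first can be rerouted along it (\<open>splits_two_layers\<close>).\<close>

definition bottom_top_path :: "nat \<Rightarrow> nat \<Rightarrow> (nat \<times> nat) list" where
  "bottom_top_path a b = [(0, 0), (1, 0)] @ vseg 2 0 (b - 1) @ hseg (b - 2) 3 (Suc a) @ [(a, b - 1), (a, b)]"

definition middle_path :: "nat \<Rightarrow> nat \<Rightarrow> (nat \<times> nat) list" where
  "middle_path a b = (0, 1) # vseg 1 1 b @ hseg (b - 1) 2 a @ [(a - 1, b)]"

definition upper_path :: "nat \<Rightarrow> nat \<Rightarrow> (nat \<times> nat) list" where
  "upper_path a b = vseg 0 2 (Suc b) @ hseg b 1 (a - 1)"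

text \<open>Bad pairs of cells are the two ends of a row, the two ends of a column, and the corners
  \<open>(0, 0)\<close> and \<open>(a, b)\<close>. The middle and the upper path miss the right
  column and the bottom row altogether. The first path meets the bottom row only in columns 0 to 2
  and the top row only in column \<open>a\<close>; it meets the left column only in row 0 and the
  right one only from row \<open>b - 2\<close> on. With \<open>a, b >= 3\<close> only its two
  extreme cells are bad.\<close>

lemma grid_paths:
  assumes "a \<ge> 3" "b \<ge> 3"
  shows "corner_chain a b (bottom_top_path a b)" "grid_chain a b (middle_path a b)" "avoids True True a b (set (middle_path a b))"
    "grid_chain a b (upper_path a b)" "avoids True True a b (set (upper_path a b))" "length (upper_path a b) \<ge> 3"
    "last (bottom_top_path a b) = (a, b)" "hd (middle_path a b) = (0, 1)" "last (middle_path a b) = (a - 1, b)"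
    "length (bottom_top_path a b) \<ge> 4" "length (middle_path a b) \<ge> 4"
    "{..a} \<times> {..b} = set (bottom_top_path a b) \<union> (set (middle_path a b) \<union> (set (upper_path a b) \<union> hook_rect a b 3))"
    "set (bottom_top_path a b) \<inter> (set (middle_path a b) \<union> (set (upper_path a b) \<union> hook_rect a b 3)) = {}"
    "set (middle_path a b) \<inter> (set (upper_path a b) \<union> hook_rect a b 3) = {}"
    "set (upper_path a b) \<inter> hook_rect a b 3 = {}"
proof -
  have gZ: "grid_chain a b (bottom_top_path a b)" unfolding bottom_top_path_def grid_chain_def using assms
    by (auto simp: successively_append_iff successively_Cons hd_append)
  then show "corner_chain a b (bottom_top_path a b)"
    using assms by (auto simp: corner_chain_def ends_def bottom_top_path_def)
  show gWT: "grid_chain a b (middle_path a b)" "grid_chain a b (upper_path a b)" unfolding middle_path_def upper_path_def grid_chain_def using assms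
    by (auto simp: successively_append_iff successively_Cons hd_append)
  show "avoids True True a b (set (middle_path a b))" "avoids True True a b (set (upper_path a b))"
    using assms by (auto simp: avoids_def ends_def middle_path_def upper_path_def)
  show "length (upper_path a b) \<ge> 3" "length (bottom_top_path a b) \<ge> 4" "length (middle_path a b) \<ge> 4"
    "last (bottom_top_path a b) = (a, b)" "hd (middle_path a b) = (0, 1)" "last (middle_path a b) = (a - 1, b)"
    using assms by (auto simp: upper_path_def bottom_top_path_def middle_path_def)
  show "{..a} \<times> {..b} = set (bottom_top_path a b) \<union> (set (middle_path a b) \<union> (set (upper_path a b) \<union> hook_rect a b 3))"
  proof (rule rectangle_eqI)
    show "set (bottom_top_path a b) \<union> (set (middle_path a b) \<union> (set (upper_path a b) \<union> hook_rect a b 3)) \<subseteq> {..a} \<times> {..b}"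
      using gZ gWT hook_rect_sub by (simp add: grid_chain_def)
    fix x y assume xy: "x \<le> a" "y \<le> b"
    consider "x = 0" | "x = 1" | "x = 2" | "x \<ge> 3" by linarith
    then show "(x, y) \<in> set (bottom_top_path a b) \<union> (set (middle_path a b) \<union> (set (upper_path a b) \<union> hook_rect a b 3))"
      by cases (use xy assms in \<open>auto simp: upper_path_def bottom_top_path_def middle_path_def hook_rect_def\<close>)
  qed
  show "set (bottom_top_path a b) \<inter> (set (middle_path a b) \<union> (set (upper_path a b) \<union> hook_rect a b 3)) = {}"
    "set (middle_path a b) \<inter> (set (upper_path a b) \<union> hook_rect a b 3) = {}"
    "set (upper_path a b) \<inter> hook_rect a b 3 = {}"
    using assms by (auto simp: upper_path_def bottom_top_path_def middle_path_def hook_rect_def)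
qed

text \<open>On a square grid some path of the decomposition is a single cell, which is too short for
  \<open>splits_avoiding_left_right\<close>. It is kept together with a path of length five that can be rerouted through it.\<close>

definition grid_star :: "nat \<Rightarrow> (nat \<times> nat) set \<Rightarrow> bool" where
  "grid_star a E \<longleftrightarrow> (\<exists>e1 e2 e3 e4 e5 s. E = {e1, e2, e3, e4, e5, s} \<and> distinct [e1, e2, e3, e4, e5, s] \<and>
     grid_chain a a [e1, e2, e3, e4, e5] \<and> grid_chain a a [s] \<and> grid_step e2 s \<and> grid_step s e4)"

text \<open>Hooks are peeled off until a block of three by three cells is left; all peeled hooks
  have more than three cells. The star is found inside that block.\<close>

lemma grid_star_hook_rect:
  assumes "i + 2 \<le> a"
  shows "\<exists>E G. hook_rect a a i = E \<union> G \<and> E \<inter> G = {} \<and> grid_star a E \<and> splits (\<lambda>g. grid_chain a a g \<and> length g \<ge> 3) G"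
  using assms
proof (induction "a - (i + 2)" arbitrary: i)
  case 0
  then have a: "a = i + 2" by simp
  \<comment> \<open>The last block splits into paths of five, three and one cells. The single cell
    \<open>(i, 2)\<close> lies between the second and the fourth cell of the five, so it can replace
    the third.\<close>
  let ?E = "{(i, 0), (i, 1), (i + 1, 1), (i + 1, 2), (i + 2, 2), (i, 2)} :: (nat \<times> nat) set"
  let ?g = "[(i + 1, 0), (i + 2, 0), (i + 2, 1)] :: (nat \<times> nat) list"
  have "grid_star a ?E" unfolding grid_star_def
    by (rule exI[of _ "(i, 0)"], rule exI[of _ "(i, 1)"], rule exI[of _ "(i + 1, 1)"],
        rule exI[of _ "(i + 1, 2)"], rule exI[of _ "(i + 2, 2)"], rule exI[of _ "(i, 2)"])
       (auto simp: grid_chain_def a)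
  moreover have "grid_chain a a ?g" by (auto simp: grid_chain_def a)
  then have "splits (\<lambda>g. grid_chain a a g \<and> length g \<ge> 3) (set ?g)" by (intro splits_single) simp
  moreover have "hook_rect a a i = ?E \<union> set ?g"
  proof (intro set_eqI iffI)
    fix c :: "nat \<times> nat" assume "c \<in> hook_rect a a i"
    moreover obtain x y where c: "c = (x, y)" by fastforce
    ultimately have "x = i \<or> x = i + 1 \<or> x = i + 2" "y = 0 \<or> y = 1 \<or> y = 2"
      by (auto simp: hook_rect_def a)
    then show "c \<in> ?E \<union> set ?g" unfolding c by (elim disjE) simp_all
  next
    fix c :: "nat \<times> nat" assume "c \<in> ?E \<union> set ?g"
    then show "c \<in> hook_rect a a i" by (auto simp: hook_rect_def a)
  qed
  moreover have "?E \<inter> set ?g = {}" by simp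
  ultimately show ?case by blast
next
  case (Suc n)
  then have "i \<le> a" by simp
  note H = hook[OF this this]
  have n: "n = a - (Suc i + 2)" "Suc i + 2 \<le> a" using Suc(2,3) by arith+
  obtain E G where EG: "hook_rect a a (Suc i) = E \<union> G" "E \<inter> G = {}" "grid_star a E"
    "splits (\<lambda>g. grid_chain a a g \<and> length g \<ge> 3) G"
    using Suc(1)[of "Suc i", OF n] by blast
  have "splits (\<lambda>g. grid_chain a a g \<and> length g \<ge> 3) (set (hook a a i) \<union> G)"
    by (intro splits_Un splits_single) (use H EG Suc in auto)
  moreover have "hook_rect a a i = E \<union> (set (hook a a i) \<union> G)" "E \<inter> (set (hook a a i) \<union> G) = {}"
    using H(3,4) EG(1,2) by blast+
  ultimately show ?case using EG(3) by blast
qed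

lemma square_star:
  assumes "a \<ge> 3" "odd a"
  shows "\<exists>Z E G. {..a} \<times> {..a} = set Z \<union> (E \<union> G) \<and> set Z \<inter> (E \<union> G) = {} \<and> E \<inter> G = {} \<and>
     corner_chain a a Z \<and> length Z \<ge> 4 \<and> grid_star a E \<and> avoids True True a a E \<and>
     splits (\<lambda>g. grid_chain a a g \<and> avoids True True a a (set g) \<and> 3 \<le> length g) G"
\<comment> \<open>For \<open>a = 3\<close> the three paths leave only one cell, so a different
  decomposition is written out. For other odd \<open>a\<close> the square that is left has side
  \<open>a - 2 >= 3\<close> and contains the block needed for a star.\<close>
proof (cases "a = 3")
  case True
  let ?Z = "[(0, 0), (1, 0), (1, 1), (2, 1), (2, 2), (3, 2), (3, 3)] :: (nat \<times> nat) list"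
  let ?E = "{(0, 1), (0, 2), (1, 2), (1, 3), (2, 3), (0, 3)} :: (nat \<times> nat) set"
  let ?g = "[(2, 0), (3, 0), (3, 1)] :: (nat \<times> nat) list"
  have "grid_star a ?E" unfolding grid_star_def
    by (rule exI[of _ "(0, 1)"], rule exI[of _ "(0, 2)"], rule exI[of _ "(1, 2)"],
        rule exI[of _ "(1, 3)"], rule exI[of _ "(2, 3)"], rule exI[of _ "(0, 3)"])
       (auto simp: grid_chain_def True)
  moreover have "grid_chain a a ?g" "avoids True True a a (set ?g)"
    by (auto simp: grid_chain_def True avoids_def ends_def)
  then have "splits (\<lambda>g. grid_chain a a g \<and> avoids True True a a (set g) \<and> 3 \<le> length g) (set ?g)"
    by (intro splits_single) simp
  moreover have "corner_chain a a ?Z" by (auto simp: corner_chain_def grid_chain_def ends_def True)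
  moreover have "avoids True True a a ?E" by (auto simp: True avoids_def ends_def)
  moreover have "{..a} \<times> {..a} = set ?Z \<union> (?E \<union> set ?g)"
  proof (rule rectangle_eqI)
    fix x y assume "x \<le> a" "y \<le> a"
    then have "x = 0 \<or> x = 1 \<or> x = 2 \<or> x = 3" "y = 0 \<or> y = 1 \<or> y = 2 \<or> y = 3"
      using True by auto
    then show "(x, y) \<in> set ?Z \<union> (?E \<union> set ?g)" by (elim disjE) simp_all
  qed (simp add: True)
  moreover have "set ?Z \<inter> (?E \<union> set ?g) = {}" "?E \<inter> set ?g = {}" by auto
  moreover have "length ?Z \<ge> 4" by simp
  ultimately show ?thesis by blast
next
  case False
  then have a: "3 + 2 \<le> a" using assms by presburger
  note A = grid_paths[OF assms(1,1)]
  obtain E G where EG: "hook_rect a a 3 = E \<union> G" "E \<inter> G = {}" "grid_star a E"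
    "splits (\<lambda>g. grid_chain a a g \<and> length g \<ge> 3) G"
    using grid_star_hook_rect[OF a] by blast
  have av: "avoids True True a a H" if "H \<subseteq> hook_rect a a 3" for H
    using that hook_rect_avoids[of 3 H a a] by simp
  let ?\<Phi> = "\<lambda>g. grid_chain a a g \<and> avoids True True a a (set g) \<and> 3 \<le> length g"
  have "splits ?\<Phi> G" using EG(4) by (rule splits_mono) (use EG(1) av in blast)
  moreover have "splits ?\<Phi> (set (middle_path a a))" "splits ?\<Phi> (set (upper_path a a))"
    by (intro splits_single; use A in force)+
  ultimately have "splits ?\<Phi> (set (middle_path a a) \<union> (set (upper_path a a) \<union> G))"
    by (intro splits_Un) (use A EG(1) in auto)
  moreover have "avoids True True a a E" using av EG(1) by blast
  moreover have "{..a} \<times> {..a} = set (bottom_top_path a a) \<union> (E \<union> (set (middle_path a a) \<union> (set (upper_path a a) \<union> G)))"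
    using A(12) EG(1) by blast
  moreover have "set (bottom_top_path a a) \<inter> (E \<union> (set (middle_path a a) \<union> (set (upper_path a a) \<union> G))) = {}"
    "E \<inter> (set (middle_path a a) \<union> (set (upper_path a a) \<union> G)) = {}"
    using A(13-15) EG(1,2) by blast+
  ultimately show ?thesis using A(1,10) EG(3) by blast
qed

text \<open>Without equal sides no path is shorter than three cells, hence no star is
  required.\<close>

lemma nonsquare_corner_chain:
  assumes "a \<ge> 3" "b \<ge> 3" "a \<ge> b + 2 \<or> b \<ge> a + 2"
  shows "\<exists>Z G. {..a} \<times> {..b} = set Z \<union> G \<and> set Z \<inter> G = {} \<and> corner_chain a b Z \<and> length Z \<ge> 4 \<and>
     splits (\<lambda>g. grid_chain a b g \<and> avoids True True a b (set g) \<and> 3 \<le> length g) G"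
proof -
  note A = grid_paths[OF assms(1,2)]
  let ?\<Phi> = "\<lambda>g. grid_chain a b g \<and> avoids True True a b (set g) \<and> 3 \<le> length g"
  have "splits ?\<Phi> (hook_rect a b 3)"
    by (rule splits_mono[OF splits_hook_rect_avoids[of 3 a b True True]]) (use assms(3) in auto)
  moreover have "splits ?\<Phi> (set (middle_path a b))" "splits ?\<Phi> (set (upper_path a b))"
    by (intro splits_single; use A in force)+
  ultimately have "splits ?\<Phi> (set (middle_path a b) \<union> (set (upper_path a b) \<union> hook_rect a b 3))"
    by (intro splits_Un) (use A in auto)
  then show ?thesis using A(1,10,12,13) by blast
qed

section \<open>Products of two chains\<close>

context chain_pair
begin

text \<open>This is what lets the construction iterate: the path from corner to corner behaves in
  \<open>V \<union> W\<close> as the two maximal chains do in \<open>V\<close> and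
  \<open>W\<close>.\<close>

lemma corner_chain_loose_chain:
  assumes "corner_chain a b Z" "hd xs = {}" "hd ys = {}"
  shows "loose_chain (V \<union> W) (map f Z)"
proof -
  have g: "grid_chain a b Z" "hd Z = (0, 0)" "Z \<noteq> []" "set Z \<subseteq> {..a} \<times> {..b}"
    using assms by (auto simp: corner_chain_def grid_chain_def)
  have s: "sym_chain (V \<union> W) (map f Z)" using f_sym_chain g by blast
  \<comment> \<open>A symmetric path that starts at rank 0 ends at rank \<open>a + b\<close>, and
    only one cell has this rank.\<close>
  have "last Z = (a, b)"
  proof -
    have "last Z \<in> {..a} \<times> {..b}" using g(3,4) last_in_set by blast
    moreover have "fst (last Z) + snd (last Z) = a + b" using g(1,2) by (simp add: grid_chain_def)
    ultimately show ?thesis by (cases "last Z") auto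
  qed
  have xy: "xs ! 0 = {}" "ys ! 0 = {}" using assms xs ys
    by (metis Nat.nat.distinct(1) hd_conv_nth list.size(3))+
  have "hd (map f Z) = {}" using g xy by (simp add: hd_map cell_def)
  moreover have "tame_but_ends True (map f Z)" unfolding tame_but_ends_def
  proof (intro allI impI)
    fix i j assume h: "i \<le> j \<and> j < length (map f Z) \<and> map f Z ! j - map f Z ! i \<in> U"
    obtain x y x' y' where c: "Z ! i = (x, y)" "Z ! j = (x', y')" by fastforce
    have m: "(x, y) \<in> set Z" "(x', y') \<in> set Z" using c h
      by (metis le_less_trans length_map nth_mem)+
    have ij: "i < length Z" "j < length Z" using h by auto
    have "map f Z ! i \<subseteq> map f Z ! j" using sym_chain_mono[OF s] h by blast
    moreover have "x \<le> a" "y \<le> b" "x' \<le> a" "y' \<le> b" using m g(4) by auto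
    ultimately have "ends l a x x' \<and> ends k b y y'" using f_bad[of x y x' y'] c h ij by simp
    then have "ends True a x x'" "ends True b y y'" unfolding ends_def by blast+
    then have "x = x' \<and> y = y' \<or> x = 0 \<and> y = 0 \<and> x' = a \<and> y' = b"
      using assms(1) m unfolding corner_chain_def by blast
    then show "ends True (length (map f Z) - 1) i j"
    proof
      assume "x = x' \<and> y = y'"
      then have "map f Z ! i = map f Z ! j" using c h by simp
      then show ?thesis using sym_chain_nth_eq_iff[OF s, of i j] h by (simp add: ends_def)
    next
      assume *: "x = 0 \<and> y = 0 \<and> x' = a \<and> y' = b"
      have "map f Z ! i = map f Z ! 0" "map f Z ! j = map f Z ! (length Z - 1)"
        using * c h g(2,3) \<open>last Z = (a, b)\<close> by (auto simp: hd_conv_nth last_conv_nth)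
      then have "i = 0" "j = length Z - 1"
        using sym_chain_nth_eq_iff[OF s, of i 0] sym_chain_nth_eq_iff[OF s, of j "length Z - 1"] h g(3)
        by auto
      then show ?thesis by (simp add: ends_def)
    qed
  qed
  ultimately show ?thesis using s by (simp add: loose_chain_def)
qed

lemma f_disjoint:
  "G \<subseteq> {..a} \<times> {..b} \<Longrightarrow> H \<subseteq> {..a} \<times> {..b} \<Longrightarrow> G \<inter> H = {} \<Longrightarrow> f ` G \<inter> f ` H = {}"
  using inj_on_image_Int[OF inj_f, of G H] by simp

end

context bad_differences
begin

text \<open>The image of a \<open>grid_star\<close>. The set as a whole is tame, so the five-element
  chain stays tame when \<open>s\<close> replaces \<open>e3\<close>.\<close>

definition star :: "'a set \<Rightarrow> 'a set set \<Rightarrow> bool" where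
  "star W E \<longleftrightarrow> (\<exists>e1 e2 e3 e4 e5 s. E = {e1, e2, e3, e4, e5, s} \<and> distinct [e1, e2, e3, e4, e5, s] \<and>
     sym_chain W [e1, e2, e3, e4, e5] \<and> sym_chain W [s] \<and> covers e2 s \<and> covers s e4 \<and> tame E)"

end

lemma (in chain_pair) grid_star_star:
  assumes "grid_star a E" "E \<subseteq> {..a} \<times> {..a}" "avoids l k a b E" "a = b"
  shows "star (V \<union> W) (f ` E)"
proof -
  obtain e1 e2 e3 e4 e5 s where e: "E = {e1, e2, e3, e4, e5, s}" "distinct [e1, e2, e3, e4, e5, s]"
     "grid_chain a a [e1, e2, e3, e4, e5]" "grid_chain a a [s]" "grid_step e2 s" "grid_step s e4"
    using assms(1) unfolding grid_star_def by blast
  have "distinct (map f [e1, e2, e3, e4, e5, s])"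
    using e(1,2) assms(2,4) inj_on_subset[OF inj_f, of E] unfolding distinct_map by auto
  moreover have "sym_chain (V \<union> W) (map f [e1, e2, e3, e4, e5])" "sym_chain (V \<union> W) (map f [s])"
    using f_sym_chain e(3,4) assms(4) by blast+
  moreover have "covers (f e2) (f s)" "covers (f s) (f e4)"
    using f_covers[of "fst e2" "snd e2" "fst s" "snd s"] f_covers[of "fst s" "snd s" "fst e4" "snd e4"]
      e(1,5,6) assms(2,4) by auto
  moreover have "tame (f ` E)" using f_tame assms(2,3,4) by blast
  moreover have "f ` E = {f e1, f e2, f e3, f e4, f e5, f s}" using e(1) by simp
  ultimately show ?thesis unfolding star_def list.map by blast
qed

context bad_differences
begin

lemma chain_pairI:
  assumes "V \<in> U" "W \<in> U" "V \<inter> W = {}" "sym_chain V xs" "tame_but_ends l xs" "sym_chain W ys" "tame_but_ends k ys"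
  shows "chain_pair U V W xs ys l k (length xs - 1) (length ys - 1)"
proof unfold_locales
  show "length xs = Suc (length xs - 1)" "length ys = Suc (length ys - 1)"
    using assms(4,6) by (auto simp: sym_chain_def)
qed (use assms in auto)

lemma splits_tame_chain_tame_chain:
  assumes "V \<in> U" "W \<in> U" "V \<inter> W = {}" "tame_chain V xs" "tame_chain W ys"
  shows "splits (tame_chain (V \<union> W)) (set xs \<otimes> set ys)"
proof -
  interpret chain_pair U V W xs ys False False "length xs - 1" "length ys - 1"
    using assms by (intro chain_pairI) (auto simp: tame_chain_tame_but_ends, auto simp: tame_chain_def)
  have "splits (\<lambda>c. tame_chain (V \<union> W) c \<and> 0 \<le> length c) (f ` ({..length xs - 1} \<times> {..length ys - 1}))"
    by (rule splits_f[OF splits_rectangle]) (auto simp: avoids_def ends_def)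
  then show ?thesis unfolding f_image by simp
qed

lemma splits_loose_chain_tame_chain:
  assumes "V \<in> U" "W \<in> U" "V \<inter> W = {}" "loose_chain V xs" "tame_chain W ys" "3 \<le> length xs" "3 \<le> length ys"
  shows "splits (tame_chain (V \<union> W)) (set xs \<otimes> set ys)"
proof -
  interpret chain_pair U V W xs ys True False "length xs - 1" "length ys - 1"
    using assms by (intro chain_pairI) (auto simp: tame_chain_tame_but_ends loose_chain_def, auto simp: tame_chain_def)
  have "splits (\<lambda>c. tame_chain (V \<union> W) c \<and> 0 \<le> length c) (f ` ({..length xs - 1} \<times> {..length ys - 1}))"
    by (rule splits_f[OF splits_avoiding_left_right]) (use assms in auto)
  then show ?thesis unfolding f_image by simp
qed

text \<open>Besides the new loose chain \<open>Z\<close> the path \<open>Y\<close> is kept apart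
  from the rest. The cover relations and the last two tameness statements are exactly what the
  detour of \<open>splits_two_layers\<close> requires.\<close>

lemma loose_chain_loose_chain:
  assumes "V \<in> U" "W \<in> U" "V \<inter> W = {}" "loose_chain V xs" "loose_chain W ys" "4 \<le> length xs" "4 \<le> length ys"
  shows "\<exists>Z Y R. set xs \<otimes> set ys = set Z \<union> (set Y \<union> R) \<and> set Z \<inter> (set Y \<union> R) = {} \<and> set Y \<inter> R = {} \<and>
    loose_chain (V \<union> W) Z \<and> 4 \<le> length Z \<and> tame_chain (V \<union> W) Y \<and> 4 \<le> length Y \<and> splits (tame_chain (V \<union> W)) R \<and>
    covers (hd Z) (hd Y) \<and> covers (last Y) (last Z) \<and> tame {hd Z, hd Y} \<and> tame (insert (last Z) (set Y))"
proof -
  define a b where "a = length xs - 1" and "b = length ys - 1"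
  interpret chain_pair U V W xs ys True True a b unfolding a_def b_def
    using assms by (intro chain_pairI) (auto simp: loose_chain_def)
  have ab: "3 \<le> a" "3 \<le> b" using assms by (auto simp: a_def b_def)
  note A = grid_paths[OF ab]
  let ?Z = "bottom_top_path a b" and ?Y = "middle_path a b" and ?R = "set (upper_path a b) \<union> hook_rect a b 3"
  have "splits (\<lambda>g. grid_chain a b g \<and> avoids True True a b (set g)) (hook_rect a b 3)"
    by (rule splits_mono[OF splits_hook_rect_avoids[of 3 a b True True]]) auto
  then have "splits (\<lambda>g. grid_chain a b g \<and> avoids True True a b (set g)) ?R"
    by (intro splits_Un splits_single) (use A in auto)
  moreover have sub: "?R \<subseteq> {..a} \<times> {..b}" "set ?Y \<subseteq> {..a} \<times> {..b}" "set ?Z \<subseteq> {..a} \<times> {..b}"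
    using A(12) by auto
  ultimately have R: "splits (\<lambda>c. tame_chain (V \<union> W) c \<and> 0 \<le> length c) (f ` ?R)"
    by (intro splits_f) auto
  have ne: "?Z \<noteq> []" "?Y \<noteq> []" using A(10,11) by auto
  have Z: "hd ?Z = (0, 0)" using A(1) by (simp add: corner_chain_def)
  have "loose_chain (V \<union> W) (map f ?Z)" using corner_chain_loose_chain[OF A(1)] assms by (simp add: loose_chain_def)
  moreover have "tame_chain (V \<union> W) (map f ?Y)" using f_tame_chain A(2,3) by blast
  moreover have "set xs \<otimes> set ys = set (map f ?Z) \<union> (set (map f ?Y) \<union> f ` ?R)"
    unfolding f_image[symmetric] set_map image_Un[symmetric] using A(12) by simp
  moreover have "set (map f ?Z) \<inter> (set (map f ?Y) \<union> f ` ?R) = {}"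
    unfolding set_map image_Un[symmetric] using A(13) sub by (intro f_disjoint) auto
  moreover have "set (map f ?Y) \<inter> f ` ?R = {}"
    unfolding set_map using A(14) sub by (intro f_disjoint) auto
  moreover have "covers (hd (map f ?Z)) (hd (map f ?Y))" "covers (last (map f ?Y)) (last (map f ?Z))"
    using ne Z A(7-9) ab by (auto simp: hd_map last_map intro!: f_covers)
  moreover have "tame {hd (map f ?Z), hd (map f ?Y)}"
  proof -
    have "tame (f ` {(0, 0), (0, 1)})"
      by (rule f_tame) (use ab in \<open>auto simp: avoids_def ends_def\<close>)
    then show ?thesis using ne Z A(7-9) by (simp add: hd_map)
  qed
  moreover have "tame (insert (last (map f ?Z)) (set (map f ?Y)))"
  proof -
    have "tame (f ` (insert (a, b) (set ?Y)))"
      by (rule f_tame) (use ab sub in \<open>auto simp: avoids_def ends_def middle_path_def\<close>)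
    then show ?thesis using ne A(7-9) by (simp add: last_map)
  qed
  moreover have "4 \<le> length (map f ?Z)" "4 \<le> length (map f ?Y)" using A(10,11) by auto
  ultimately show ?thesis using R by (intro exI[of _ "map f ?Z"] exI[of _ "map f ?Y"] exI[of _ "f ` ?R"]) simp
qed

text \<open>The variant for multiplication by a further maximal chain: every remaining chain has at
  least three elements, except for what is packed into a star.\<close>

lemma loose_chain_loose_chain_star:
  assumes "V \<in> U" "W \<in> U" "V \<inter> W = {}" "loose_chain V xs" "loose_chain W ys" "4 \<le> length xs" "4 \<le> length ys"
    and "even (length xs)" "even (length ys)"
  shows "\<exists>Z E R. set xs \<otimes> set ys = set Z \<union> (E \<union> R) \<and> set Z \<inter> (E \<union> R) = {} \<and> E \<inter> R = {} \<and>
    loose_chain (V \<union> W) Z \<and> 4 \<le> length Z \<and> (E = {} \<or> star (V \<union> W) E) \<and>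
    splits (\<lambda>c. tame_chain (V \<union> W) c \<and> 3 \<le> length c) R"
proof -
  define a b where "a = length xs - 1" and "b = length ys - 1"
  interpret chain_pair U V W xs ys True True a b unfolding a_def b_def
    using assms by (intro chain_pairI) (auto simp: loose_chain_def)
  have ab: "3 \<le> a" "3 \<le> b" "odd a" "odd b" using assms by (auto simp: a_def b_def)
  have "\<exists>Z E G. {..a} \<times> {..b} = set Z \<union> (E \<union> G) \<and> set Z \<inter> (E \<union> G) = {} \<and> E \<inter> G = {} \<and>
     corner_chain a b Z \<and> length Z \<ge> 4 \<and> (E = {} \<or> a = b \<and> grid_star a E \<and> avoids True True a b E) \<and>
     splits (\<lambda>g. grid_chain a b g \<and> avoids True True a b (set g) \<and> 3 \<le> length g) G"
  proof (cases "a = b")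
    case True
    then show ?thesis using square_star[OF ab(1,3)] by blast
  next
    case False
    \<comment> \<open>Both numbers are odd, so distinct ones differ by at least two.\<close>
    then have "a \<ge> b + 2 \<or> b \<ge> a + 2" using ab by presburger
    from nonsquare_corner_chain[OF ab(1,2) this] obtain Z G where
      "{..a} \<times> {..b} = set Z \<union> G \<and> set Z \<inter> G = {} \<and> corner_chain a b Z \<and> length Z \<ge> 4 \<and>
     splits (\<lambda>g. grid_chain a b g \<and> avoids True True a b (set g) \<and> 3 \<le> length g) G" by blast
    then show ?thesis by (intro exI[of _ Z] exI[of _ "{}"] exI[of _ G]) simp
  qed
  then obtain Z E G where ZEG: "{..a} \<times> {..b} = set Z \<union> (E \<union> G)" "set Z \<inter> (E \<union> G) = {}" "E \<inter> G = {}"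
     "corner_chain a b Z" "length Z \<ge> 4" "E = {} \<or> a = b \<and> grid_star a E \<and> avoids True True a b E"
     "splits (\<lambda>g. grid_chain a b g \<and> avoids True True a b (set g) \<and> 3 \<le> length g) G"
    by blast
  have sub: "set Z \<subseteq> {..a} \<times> {..b}" "E \<subseteq> {..a} \<times> {..b}" "G \<subseteq> {..a} \<times> {..b}" using ZEG(1) by auto
  have "loose_chain (V \<union> W) (map f Z)" using corner_chain_loose_chain[OF ZEG(4)] assms by (simp add: loose_chain_def)
  moreover have "f ` E = {} \<or> star (V \<union> W) (f ` E)" using ZEG(6) grid_star_star sub by auto
  moreover have "splits (\<lambda>c. tame_chain (V \<union> W) c \<and> 3 \<le> length c) (f ` G)"
    by (rule splits_f[OF ZEG(7) sub(3)]) auto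
  moreover have "set xs \<otimes> set ys = set (map f Z) \<union> (f ` E \<union> f ` G)"
    unfolding f_image[symmetric] set_map image_Un[symmetric] using ZEG(1) by simp
  moreover have "set (map f Z) \<inter> (f ` E \<union> f ` G) = {}"
    unfolding set_map image_Un[symmetric] using ZEG(2) sub by (intro f_disjoint) auto
  moreover have "f ` E \<inter> f ` G = {}" using ZEG(3) sub by (intro f_disjoint) auto
  moreover have "4 \<le> length (map f Z)" using ZEG(5) by simp
  ultimately show ?thesis
    by (intro exI[of _ "map f Z"] exI[of _ "f ` E"] exI[of _ "f ` G"]) (simp only: simp_thms)
qed

lemma Un_restrict:
  assumes "A \<subseteq> V" "B \<subseteq> W" "V \<inter> W = {}"
  shows "(A \<union> B) \<inter> V = A" "(A \<union> B) \<inter> W = B"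
  using assms by blast+

lemma splits_star:
  assumes "star W E"
  shows "splits (tame_chain W) E"
proof -
  obtain e1 e2 e3 e4 e5 s where e: "E = {e1, e2, e3, e4, e5, s}" "distinct [e1, e2, e3, e4, e5, s]"
     "sym_chain W [e1, e2, e3, e4, e5]" "sym_chain W [s]" "tame E"
    using assms unfolding star_def by blast
  have "splits (tame_chain W) (set [e1, e2, e3, e4, e5] \<union> set [s])"
    by (intro splits_Un splits_single) (use e(2-4) tame_mono[OF e(5)] in \<open>auto simp: tame_chain_def e(1)\<close>)
  then show ?thesis unfolding e(1) by (simp add: insert_commute)
qed

lemma star_sub: "star W E \<Longrightarrow> E \<subseteq> Pow W"
proof -
  assume "star W E"
  then obtain e1 e2 e3 e4 e5 s where "E = {e1, e2, e3, e4, e5, s}"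
     "sym_chain W [e1, e2, e3, e4, e5]" "sym_chain W [s]"
    unfolding star_def by blast
  then show "E \<subseteq> Pow W" by (simp add: sym_chain_def)
qed

text \<open>The paths \<open>B1\<close> and \<open>B2\<close> run through the extra element \<open>s\<close> (row 5) instead of \<open>e3\<close> (row 2), the other
  four use the five-element chain; \<open>\<rho>\<close> translates the former to the rows of the chain through \<open>s\<close>.\<close>

lemma splits_star_loose_chain:
  assumes "V \<in> U" "W \<in> U" "V \<inter> W = {}" "star V E" "loose_chain W ys" "4 \<le> length ys"
  shows "splits (tame_chain (V \<union> W)) (E \<otimes> set ys)"
proof -
  obtain e1 e2 e3 e4 e5 s where e: "E = {e1, e2, e3, e4, e5, s}" "distinct [e1, e2, e3, e4, e5, s]"
     "sym_chain V [e1, e2, e3, e4, e5]" "sym_chain V [s]" "covers e2 s" "covers s e4" "tame E"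
    using assms(4) unfolding star_def by blast
  let ?p = "[e1, e2, e3, e4, e5]" and ?q = "[e1, e2, s, e4, e5]" and ?r = "[e1, e2, e3, e4, e5, s]"
  have q: "sym_chain V ?q" using e(3-6) by (auto simp: sym_chain_def)
  have t: "tame_but_ends False ?p" "tame_but_ends False ?q"
    using tame_iff_tame_but_ends[OF e(3)] tame_iff_tame_but_ends[OF q] tame_mono[OF e(7)] e(1) by auto
  define l where "l = length ys - 1"
  have l: "3 \<le> l" "length ys = Suc l" using assms(6) by (auto simp: l_def)
  interpret p: chain_pair U V W ?p ys False True 4 l
    by unfold_locales (use assms e(3) t l in \<open>auto simp: loose_chain_def\<close>)
  interpret q: chain_pair U V W ?q ys False True 4 l
    by unfold_locales (use assms q t l in \<open>auto simp: loose_chain_def\<close>)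
  let ?F = "cell ?r ys"
  define \<rho> :: "nat \<times> nat \<Rightarrow> nat \<times> nat" where "\<rho> c = (if fst c = 5 then 2 else fst c, snd c)" for c
  have Fp: "?F (x, y) = p.f (x, y)" if "x \<le> 4" for x y
  proof -
    have "x \<in> {0, 1, 2, 3, 4}" using that by auto
    then show ?thesis by (auto simp: cell_def)
  qed
  have Fq: "?F (x, y) = q.f (\<rho> (x, y))" if "x \<le> 5" "x \<noteq> 2" for x y
  proof -
    have "x \<in> {0, 1, 3, 4, 5}" using that by auto
    then show ?thesis by (auto simp: cell_def \<rho>_def)
  qed
  define \<Phi> where "\<Phi> g \<longleftrightarrow> fst ` set g \<subseteq> {..4} \<and> grid_chain 4 l g \<and> avoids False True 4 l (set g) \<or>
    fst ` set g \<subseteq> {..5} - {2} \<and> grid_chain 4 l (map \<rho> g) \<and> avoids False True 4 l (\<rho> ` set g)" for g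
  have key: "tame_chain (V \<union> W) (map ?F g)" if "\<Phi> g" for g
  proof -
    have "map ?F g = map p.f g" if "fst ` set g \<subseteq> {..4}" using that Fp by force
    moreover have "map ?F g = map q.f (map \<rho> g)" if "fst ` set g \<subseteq> {..5} - {2}"
      using that Fq by force
    ultimately show ?thesis
      using \<open>\<Phi> g\<close> p.f_tame_chain[of g] q.f_tame_chain[of "map \<rho> g"] unfolding \<Phi>_def set_map by metis
  qed
  have inj: "inj_on ?F ({..5} \<times> {..l})"
  proof (rule inj_onI)
    fix c d assume cd: "c \<in> {..5} \<times> {..l}" "d \<in> {..5} \<times> {..l}" "?F c = ?F d"
    have sub: "?r ! i \<subseteq> V" if "i < 6" for i
      using star_sub[OF assms(4)] e(1) nth_mem[of i ?r] that by auto
    have "?F c \<inter> V = ?r ! fst c" "?F d \<inter> V = ?r ! fst d" "?F c \<inter> W = ys ! snd c" "?F d \<inter> W = ys ! snd d"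
      unfolding cell_def
      using Un_restrict[OF sub[of "fst c"] p.ys_sub[of "snd c"] assms(3)]
        Un_restrict[OF sub[of "fst d"] p.ys_sub[of "snd d"] assms(3)] cd(1,2) by auto
    then have "?r ! fst c = ?r ! fst d" "ys ! snd c = ys ! snd d" using cd(3) by auto
    then have "fst c = fst d" "snd c = snd d"
      using cd(1,2) nth_eq_iff_index_eq[OF e(2), of "fst c" "fst d"]
        sym_chain_nth_eq_iff[OF p.ys(1), of "snd c" "snd d"] l by auto
    then show "c = d" by (rule prod_eqI)
  qed
  \<comment> \<open>In every row the cells over the two ends of \<open>ys\<close> must lie on
    different paths. Row 5 alone would be a single path with both of them. So \<open>B1\<close>
    takes it up to column \<open>l - 1\<close>, entering from \<open>e2\<close> and leaving to
    \<open>e4\<close>, and \<open>B2\<close> takes its last cell in the same manner. The other four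
    paths fill the rest of the five-row grid symmetrically.\<close>
  define B1 where "B1 = [(0, 0), (1, 0)] @ vseg 5 0 l @ [(3, l - 1), (4, l - 1), (4, l)]"
  define B2 where "B2 = vseg 0 1 (Suc l) @ [(1, l), (5, l), (3, l)]"
  define B3 where "B3 = vseg 1 1 l @ [(2, l - 1), (2, l)]"
  define B4 where "B4 = [(2, 0), (3, 0)] @ vseg 4 0 (l - 1)"
  define B5 where "B5 = vseg 2 1 (l - 1) @ [(3, l - 2)]"
  define B6 where "B6 = vseg 3 1 (l - 2)"
  note Bs = B1_def B2_def B3_def B4_def B5_def B6_def
  have \<rho>v: "map \<rho> (vseg x i j) = vseg (if x = 5 then 2 else x) i j" for x i j
    by (simp add: vseg_def \<rho>_def)
  have \<rho>s: "\<rho> (x, y) = (if x = 5 then 2 else x, y)" for x y by (simp add: \<rho>_def)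
  have \<rho>S: "\<rho> ` set (vseg x i j) = set (vseg (if x = 5 then 2 else x) i j)" for x i j
    using arg_cong[OF \<rho>v, of set] by simp
  have low: "\<Phi> g" if "fst ` set g \<subseteq> {..4}" "grid_chain 4 l g" "avoids False True 4 l (set g)" for g
    using that by (simp add: \<Phi>_def)
  have high: "\<Phi> g" if "fst ` set g \<subseteq> {..5} - {2}" "grid_chain 4 l (map \<rho> g)"
    "avoids False True 4 l (\<rho> ` set g)" for g
    using that by (simp add: \<Phi>_def)
  note grid = grid_chain_def successively_append_iff successively_Cons hd_append avoids_def ends_def
  have B: "\<Phi> B1" "\<Phi> B2"
    by (rule high; use l(1) in \<open>auto simp: B1_def B2_def grid \<rho>v \<rho>s image_Un \<rho>S\<close>)+
  have B': "\<Phi> B3" "\<Phi> B4" "\<Phi> B5" "l \<noteq> 3 \<Longrightarrow> \<Phi> B6"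
    by (rule low; use l(1) in \<open>auto simp: B3_def B4_def B5_def B6_def grid\<close>)+
  \<comment> \<open>For \<open>l = 3\<close> the path \<open>B6\<close> has no cells, and an empty
    list is not a chain.\<close>
  have B6: "splits \<Phi> (set B6)"
  proof (cases "l = 3")
    case True
    then have "set B6 = {}" by (simp add: B6_def vseg_def)
    then show ?thesis by (simp add: splits_empty)
  qed (use B' splits_single in blast)
  have eq: "{..5} \<times> {..l} = set B1 \<union> (set B2 \<union> (set B3 \<union> (set B4 \<union> (set B5 \<union> set B6))))"
  proof (rule rectangle_eqI)
    show "set B1 \<union> (set B2 \<union> (set B3 \<union> (set B4 \<union> (set B5 \<union> set B6)))) \<subseteq> {..5} \<times> {..l}"
      using l(1) by (auto simp: Bs)
    fix x y :: nat assume "x \<le> 5" and y: "y \<le> l"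
    then consider "x = 0" | "x = 1" | "x = 2" | "x = 3" | "x = 4" | "x = 5" by linarith
    then show "(x, y) \<in> set B1 \<union> (set B2 \<union> (set B3 \<union> (set B4 \<union> (set B5 \<union> set B6))))"
      by cases (use y l(1) in \<open>auto simp: Bs\<close>)
  qed
  have "splits \<Phi> ({..5} \<times> {..l})" unfolding eq
    by (intro splits_Un splits_single B B' B6) (use l(1) in \<open>auto simp: Bs\<close>)
  then have "splits (tame_chain (V \<union> W)) (?F ` ({..5} \<times> {..l}))"
    using inj key by (rule splits_image)
  moreover have "?F ` ({..5} \<times> {..l}) = E \<otimes> set ys"
    using cell_image[of ?r 5 ys l] l(2) e(1) by simp
  ultimately show ?thesis by simp
qed

end

section \<open>Products of four chains\<close>

lemma sym_chain_sub: "sym_chain V xs \<Longrightarrow> set xs \<subseteq> Pow V"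
  by (simp add: sym_chain_def)

lemma sym_chain_distinct: "sym_chain V xs \<Longrightarrow> distinct xs"
  using sym_chain_nth_eq_iff by (auto simp: distinct_conv_nth)

lemma sym_chain_card_hd_tl:
  assumes "sym_chain V xs" "2 \<le> length xs"
  shows "card (hd (tl xs)) = Suc (card (hd xs))" "card (last xs) = Suc (card (last (butlast xs)))"
proof -
  have "xs \<noteq> []" using assms(2) by auto
  have "hd (tl xs) = xs ! 1" "hd xs = xs ! 0"
    using assms(2) by (cases xs; cases "tl xs"; auto)+
  then show "card (hd (tl xs)) = Suc (card (hd xs))"
    using sym_chain_mono[OF assms(1), of 0 1] assms(2) by simp
  have "butlast xs \<noteq> []" using assms(2) by (cases xs; cases "tl xs"; auto)
  then have "last (butlast xs) = xs ! (length xs - 2)" "last xs = xs ! (length xs - 1)"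
    using \<open>xs \<noteq> []\<close> assms(2) by (auto simp: last_conv_nth nth_butlast numeral_2_eq_2)
  then show "card (last xs) = Suc (card (last (butlast xs)))"
    using sym_chain_mono[OF assms(1), of "length xs - 2" "length xs - 1"] assms(2) by simp
qed

text \<open>\<open>xs\<close> need not be symmetric in \<open>V\<close>. A symmetric chain without
  its bottom or top has its rank sum shifted by one, and a suitable layer \<open>e\<close> makes up
  for the shift.\<close>

lemma sym_chain_layer:
  assumes "xs \<noteq> []" "successively covers xs" "set xs \<subseteq> Pow V" "e \<subseteq> W" "V \<inter> W = {}" "finite V" "finite W"
    and "card (hd xs) + card (last xs) + 2 * card e = card V + card W"
  shows "sym_chain (V \<union> W) (map (\<lambda>x. x \<union> e) xs)"
proof -
  have c: "card (x \<union> e) = card x + card e" if "x \<in> set xs" for x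
    using that assms(3-7) by (intro card_Un_disjoint) (auto intro: finite_subset)
  have "successively (\<lambda>x y. covers (x \<union> e) (y \<union> e)) xs"
    using assms(2)
  proof (rule successively_mono)
    fix x y assume "x \<in> set xs" "y \<in> set xs" "covers x y"
    then show "covers (x \<union> e) (y \<union> e)" using covers_Un_left[of x y V e W] assms(3-5) by blast
  qed
  moreover have "card (V \<union> W) = card V + card W" using assms by (simp add: card_Un_disjoint)
  moreover have "hd xs \<in> set xs" "last xs \<in> set xs" using assms(1) by auto
  ultimately show ?thesis
    using assms c unfolding sym_chain_def successively_map by (auto simp: hd_map last_map)
qed

lemma splits_prd2:
  assumes "splits \<Phi> P" "splits \<Psi> Q" "P \<subseteq> Pow V" "Q \<subseteq> Pow W" "V \<inter> W = {}"
    and "\<And>c d. \<Phi> c \<Longrightarrow> \<Psi> d \<Longrightarrow> set c \<subseteq> P \<Longrightarrow> set d \<subseteq> Q \<Longrightarrow> splits \<Theta> (set c \<otimes> set d)"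
  shows "splits \<Theta> (P \<otimes> Q)"
proof (rule splits_prd[OF assms(1,3-5)])
  fix c assume c: "\<Phi> c" "set c \<subseteq> P"
  have "splits \<Theta> (Q \<otimes> set c)"
  proof (rule splits_prd[OF assms(2,4)])
    show "set c \<subseteq> Pow V" "W \<inter> V = {}" using c assms(3,5) by auto
    fix d assume "\<Psi> d" "set d \<subseteq> Q"
    then show "splits \<Theta> (set d \<otimes> set c)" using assms(6)[of c d] c by (simp add: prd_comm)
  qed
  then show "splits \<Theta> (set c \<otimes> Q)" by (simp add: prd_comm)
qed

lemma splits_sub:
  assumes "splits \<Phi> P" "\<And>c. \<Phi> c \<Longrightarrow> set c \<subseteq> X"
  shows "P \<subseteq> X"
  using assms unfolding splits_def by blast

context bad_differences
begin

lemma tame_chain_sub: "tame_chain V c \<Longrightarrow> set c \<subseteq> Pow V" and loose_chain_sub: "loose_chain V c \<Longrightarrow> set c \<subseteq> Pow V"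
  using sym_chain_sub tame_chain_def loose_chain_def by auto

lemma splits_tame_chain_sub: "splits (tame_chain V) P \<Longrightarrow> P \<subseteq> Pow V"
  by (erule splits_sub) (rule tame_chain_sub)

lemma splits_prd_tame_chain:
  assumes "V \<in> U" "W \<in> U" "V \<inter> W = {}" "splits (tame_chain V) P" "splits (tame_chain W) Q"
  shows "splits (tame_chain (V \<union> W)) (P \<otimes> Q)"
  by (rule splits_prd2[OF assms(4,5) splits_tame_chain_sub[OF assms(4)] splits_tame_chain_sub[OF assms(5)] assms(3)])
     (rule splits_tame_chain_tame_chain[OF assms(1-3)])

lemma splits_prd_Un:
  assumes "splits \<Phi> (P \<otimes> Q)" "splits \<Phi> (P' \<otimes> Q)" "P \<subseteq> Pow V" "P' \<subseteq> Pow V" "Q \<subseteq> Pow W"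
    "V \<inter> W = {}" "P \<inter> P' = {}"
  shows "splits \<Phi> ((P \<union> P') \<otimes> Q)"
  unfolding prd_Un by (intro splits_Un assms prd_disjoint[of P V P' Q W])

text \<open>A bad difference projects to a bad difference in \<open>W\<close>, which the tame set
  \<open>E\<close> permits only between equal elements. Hence both sets lie over the same
  \<open>e\<close>, and each layer can be checked separately.\<close>

lemma tame_layers:
  assumes "V \<inter> W = {}" "V \<in> U" "W \<in> U" "tame E" "D \<subseteq> Pow V \<times> E" "E \<subseteq> Pow W"
    and "\<And>e. e \<in> E \<Longrightarrow> tame {x. (x, e) \<in> D}"
  shows "tame ((\<lambda>(x, e). x \<union> e) ` D)"
  unfolding tame_def
proof (intro ballI impI notI)
  fix u v assume "u \<in> (\<lambda>(x, e). x \<union> e) ` D" "v \<in> (\<lambda>(x, e). x \<union> e) ` D" and uv: "u \<subset> v" "v - u \<in> U"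
  then obtain x e y d where c: "(x, e) \<in> D" "(y, d) \<in> D" "u = x \<union> e" "v = y \<union> d" by auto
  then have s: "x \<subseteq> V" "y \<subseteq> V" "e \<subseteq> W" "d \<subseteq> W" "e \<in> E" "d \<in> E" using assms(5,6) by auto
  have xy: "x \<subseteq> y" "e \<subseteq> d" using uv(1) c s assms(1) by blast+
  have "y - x = (v - u) \<inter> V" "d - e = (v - u) \<inter> W" using c s assms(1) by blast+
  then have b: "y - x \<in> U" "d - e \<in> U" using inter uv(2) assms(2,3) by auto
  then have "d = e" using assms(4) s xy unfolding tame_def by blast
  then have "x \<subset> y" using uv(1) c xy by blast
  then show False using assms(7)[of e] c s b \<open>d = e\<close> unfolding tame_def by blast
qed

text \<open>The only possible bad pair consists of the two ends, so removing one end destroys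
  it.\<close>

lemma loose_chain_tame_tl_butlast:
  assumes "loose_chain V xs" "2 \<le> length xs"
  shows "tame (set (tl xs))" "tame (set (butlast xs))"
proof -
  have s: "sym_chain V xs" and o: "tame_but_ends True xs" using assms by (auto simp: loose_chain_def)
  have key: "tame (set ys)" if "set ys \<subseteq> set xs" "\<not> (xs ! 0 \<in> set ys \<and> xs ! (length xs - 1) \<in> set ys)" for ys
    unfolding tame_def
  proof (intro ballI impI notI)
    fix u v assume h: "u \<in> set ys" "v \<in> set ys" "u \<subset> v" "v - u \<in> U"
    then have "u \<in> set xs" "v \<in> set xs" using that(1) by auto
    then obtain i j where ij: "i < length xs" "j < length xs" "u = xs ! i" "v = xs ! j"
      unfolding in_set_conv_nth by blast
    then have "i \<le> j" "i \<noteq> j" using h(3) sym_chain_subset_iff[OF s, of i j] by auto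
    then have "i = 0 \<and> j = length xs - 1" using o ij h(4) unfolding tame_but_ends_def ends_def by blast
    then show False using that(2) h ij by blast
  qed
  have d: "distinct xs" "xs \<noteq> []" using sym_chain_distinct[OF s] assms(2) by auto
  have e: "xs = xs ! 0 # tl xs" "xs = butlast xs @ [xs ! (length xs - 1)]"
    using append_butlast_last_id[OF d(2)] last_conv_nth[OF d(2)] hd_conv_nth[OF d(2)]
      list.collapse[OF d(2)] by auto
  have "xs ! 0 \<notin> set (tl xs)" using d(1) e(1) by (metis distinct.simps(2))
  then show "tame (set (tl xs))" by (intro key) (auto dest: list.set_sel(2)[OF d(2)])
  have "xs ! (length xs - 1) \<notin> set (butlast xs)"
    using d(1) e(2) by (metis (no_types, lifting) disjoint_insert(1) distinct_append list.simps(15))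
  then show "tame (set (butlast xs))" by (intro key) (auto dest: in_set_butlastD)
qed

text \<open>The product of the maximal chain \<open>Z\<close> with a two-element chain has no suitable decomposition of its own; the
  first of the four chains takes a detour through \<open>Y\<close> instead of climbing along \<open>Z\<close>.\<close>

lemma splits_two_layers:
  assumes "V \<in> U" "W \<in> U" "V \<inter> W = {}" "loose_chain V Z" "tame_chain V Y" "4 \<le> length Z" "4 \<le> length Y"
    and covers: "covers (hd Z) (hd Y)" "covers (last Y) (last Z)"
    and tm: "tame {hd Z, hd Y}" "tame (insert (last Z) (set Y))"
    and dj: "set Z \<inter> set Y = {}" and E: "tame_chain W [e0, e1]"
  shows "splits (tame_chain (V \<union> W)) ((set Z \<union> set Y) \<otimes> {e0, e1})"
proof -
  let ?f = "\<lambda>(x, e). x \<union> e"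
  have sZ: "sym_chain V Z" and sY: "sym_chain V Y" and sE: "sym_chain W [e0, e1]" and tY: "tame (set Y)"
    and tE: "tame {e0, e1}"
    using assms by (auto simp: loose_chain_def tame_chain_def)
  have ne: "Z \<noteq> []" "Y \<noteq> []" using assms(6,7) by auto
  have fin: "finite V" "finite W" using sZ sE by (auto simp: sym_chain_def)
  have e: "e0 \<subseteq> W" "e1 \<subseteq> W" "covers e0 e1" "card e0 + card e1 = card W" using sE by (auto simp: sym_chain_def)
  have ce: "card e1 = Suc (card e0)" "e0 \<noteq> e1"
    using covers_card[OF e(3)] finite_subset[OF e(1) fin(2)] by auto
  have in_V: "x \<subseteq> V" if "x \<in> set Z \<union> set Y" for x using that sym_chain_sub[OF sZ] sym_chain_sub[OF sY] by auto
  have ends: "hd Z \<in> set Z" "last Z \<in> set Z" "hd Y \<in> set Y" "last Y \<in> set Y" using ne by auto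
  have Zt: "set Z = insert (hd Z) (set (tl Z))" "hd Z \<notin> set (tl Z)"
    using sym_chain_distinct[OF sZ] ne by (cases Z; auto)+
  have Yt: "set Y = insert (hd Y) (set (tl Y))" "hd Y \<notin> set (tl Y)"
    using sym_chain_distinct[OF sY] ne by (cases Y; auto)+
  have Zb: "set Z = insert (last Z) (set (butlast Z))" "last Z \<notin> set (butlast Z)"
    using sym_chain_distinct[OF sZ] ne by (cases Z rule: rev_cases; auto)+
  \<comment> \<open>\<open>g0\<close> leaves \<open>Z\<close> after its bottom, changes from
    \<open>e0\<close> to \<open>e1\<close> over \<open>hd Y\<close>, follows \<open>Y\<close>, and
    returns for the top of \<open>Z\<close>; it has the two ends of \<open>Z\<close> in different
    layers. The other three are symmetric because a missing top is balanced by the larger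
    \<open>e1\<close> and a missing bottom by the smaller \<open>e0\<close>.\<close>
  define g0 where "g0 = [(hd Z, e0), (hd Y, e0)] @ map (\<lambda>y. (y, e1)) Y @ [(last Z, e1)]"
  define g1 where "g1 = map (\<lambda>z. (z, e1)) (butlast Z)"
  define g2 where "g2 = map (\<lambda>z. (z, e0)) (tl Z)"
  define g3 where "g3 = map (\<lambda>y. (y, e0)) (tl Y)"
  define \<Phi> where "\<Phi> g \<longleftrightarrow> tame_chain (V \<union> W) (map ?f g)" for g
  have lay: "\<Phi> (map (\<lambda>z. (z, e)) xs)"
    if "xs \<noteq> []" "successively covers xs" "set xs \<subseteq> Pow V" "e \<subseteq> W" "tame (set xs)"
      "card (hd xs) + card (last xs) + 2 * card e = card V + card W" for xs e
  proof -
    have m: "map ?f (map (\<lambda>z. (z, e)) xs) = map (\<lambda>x. x \<union> e) xs" by simp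
    have "sym_chain (V \<union> W) (map (\<lambda>x. x \<union> e) xs)"
      using that fin assms(3) by (intro sym_chain_layer)
    moreover have "tame (?f ` (set xs \<times> {e}))"
      by (rule tame_layers[OF assms(3,1,2), of "{e}"]) (use that in \<open>auto simp: tame_def\<close>)
    moreover have "?f ` (set xs \<times> {e}) = set (map (\<lambda>x. x \<union> e) xs)" by force
    ultimately show ?thesis unfolding \<Phi>_def tame_chain_def m by simp
  qed
  have tlb: "tl Z \<noteq> []" "butlast Z \<noteq> []" "tl Y \<noteq> []" "successively covers (tl Z)" "successively covers (butlast Z)"
    "successively covers (tl Y)"
  proof -
    show "tl Z \<noteq> []" "butlast Z \<noteq> []" "tl Y \<noteq> []"
      using assms(6,7) by (auto simp: tl_Nil butlast_conv_take)
    show "successively covers (tl Z)" "successively covers (tl Y)"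
      using sZ sY by (cases Z; cases Y; auto simp: sym_chain_def successively_Cons)+
    show "successively covers (butlast Z)"
      using sZ by (cases Z rule: rev_cases; auto simp: sym_chain_def successively_append_iff)
  qed
  have hb: "hd (butlast Z) = hd Z" "last (tl Z) = last Z" "last (tl Y) = last Y"
    using tlb(1-3) by (cases Z; cases Y; auto simp: last_tl)+
  have pw: "set (tl Z) \<subseteq> Pow V" "set (butlast Z) \<subseteq> Pow V" "set (tl Y) \<subseteq> Pow V"
    using in_V Zt(1) Zb(1) Yt(1) by blast+
  have sums: "card (hd Z) + card (last Z) = card V" "card (hd Y) + card (last Y) = card V"
    using sZ sY by (auto simp: sym_chain_def)
  have G1: "\<Phi> g1" unfolding g1_def
    by (rule lay) (use tlb e ce sums sym_chain_card_hd_tl[OF sZ] loose_chain_tame_tl_butlast[OF assms(4)] assms(6)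
        pw in \<open>simp_all add: hb\<close>)
  have G2: "\<Phi> g2" unfolding g2_def
    by (rule lay) (use tlb e ce sums sym_chain_card_hd_tl[OF sZ] loose_chain_tame_tl_butlast[OF assms(4)] assms(6)
        pw in \<open>simp_all add: hb\<close>)
  have G3: "\<Phi> g3" unfolding g3_def
    by (rule lay) (use tlb e ce sums sym_chain_card_hd_tl[OF sY] tame_mono[OF tY, of "set (tl Y)"] Yt(1)
        assms(7) pw in \<open>simp_all add: hb subset_insertI\<close>)
  have G0: "\<Phi> g0"
  proof -
    have m: "map ?f g0 = [hd Z \<union> e0, hd Y \<union> e0] @ map (\<lambda>y. y \<union> e1) Y @ [last Z \<union> e1]"
      by (simp add: g0_def)
    have cov3: "covers (hd Z \<union> e0) (hd Y \<union> e0)" "covers (hd Y \<union> e0) (hd Y \<union> e1)" "covers (last Y \<union> e1) (last Z \<union> e1)"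
      using covers_Un_left[OF covers(1) _ e(1) assms(3)] covers_Un_right[OF e(3) _ e(2) assms(3)]
        covers_Un_left[OF covers(2) _ e(2) assms(3)] in_V ends by auto
    have "successively (\<lambda>x y. covers (x \<union> e1) (y \<union> e1)) Y"
    proof (rule successively_mono)
      show "successively covers Y" using sY by (simp add: sym_chain_def)
      fix x y assume "x \<in> set Y" "y \<in> set Y" "covers x y"
      then show "covers (x \<union> e1) (y \<union> e1)" using covers_Un_left[of x y V e1 W] in_V e assms(3) by blast
    qed
    then have succ: "successively covers (map ?f g0)"
      unfolding m using cov3 ne
      by (simp add: successively_append_iff successively_Cons successively_map hd_append hd_map last_map)
    have cu: "card (x \<union> d) = card x + card d" if "x \<subseteq> V" "d \<subseteq> W" for x d
      using that assms(3) fin by (intro card_Un_disjoint) (auto intro: finite_subset)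
    have "hd (map ?f g0) = hd Z \<union> e0" "last (map ?f g0) = last Z \<union> e1" by (simp_all add: m)
    then have "card (hd (map ?f g0)) + card (last (map ?f g0)) = card (V \<union> W)"
      using cu[OF in_V e(1), of "hd Z"] cu[OF in_V e(2), of "last Z"] cu[of V W] ends sums e(4) by simp
    moreover have "set (map ?f g0) \<subseteq> Pow (V \<union> W)"
      unfolding m using in_V ends e by auto
    ultimately have "sym_chain (V \<union> W) (map ?f g0)" using succ fin by (simp add: sym_chain_def m)
    moreover have "tame (?f ` set g0)"
    proof (rule tame_layers[OF assms(3,1,2) tE])
      show "set g0 \<subseteq> Pow V \<times> {e0, e1}" unfolding g0_def using in_V ends by auto
      show "{e0, e1} \<subseteq> Pow W" using e by auto
      fix d assume "d \<in> {e0, e1}"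
      moreover have "{x. (x, e0) \<in> set g0} = {hd Z, hd Y}" "{x. (x, e1) \<in> set g0} = insert (last Z) (set Y)"
        using ce(2) by (auto simp: g0_def)
      ultimately show "tame {x. (x, d) \<in> set g0}" using tm by auto
    qed
    ultimately show ?thesis by (simp add: \<Phi>_def tame_chain_def)
  qed
  have eq: "(set Z \<union> set Y) \<times> {e0, e1} = set g0 \<union> (set g1 \<union> (set g2 \<union> set g3))"
  proof -
    have "set g0 = {(hd Z, e0), (hd Y, e0), (last Z, e1)} \<union> set Y \<times> {e1}" by (auto simp: g0_def)
    moreover have "set g1 = set (butlast Z) \<times> {e1}" "set g2 = set (tl Z) \<times> {e0}" "set g3 = set (tl Y) \<times> {e0}"
      by (auto simp: g1_def g2_def g3_def)
    moreover have "set Z \<times> {e1} = insert (last Z, e1) (set (butlast Z) \<times> {e1})"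
      "set Z \<times> {e0} = insert (hd Z, e0) (set (tl Z) \<times> {e0})"
      "set Y \<times> {e0} = insert (hd Y, e0) (set (tl Y) \<times> {e0})"
      using Zt(1) Zb(1) Yt(1) by auto
    moreover have "(set Z \<union> set Y) \<times> {e0, e1} = (set Z \<times> {e1} \<union> set Z \<times> {e0}) \<union> (set Y \<times> {e0} \<union> set Y \<times> {e1})"
      by auto
    ultimately show ?thesis by auto
  qed
  have "splits \<Phi> (set g0 \<union> (set g1 \<union> (set g2 \<union> set g3)))"
  proof (intro splits_Un splits_single G0 G1 G2 G3)
    show "set g2 \<inter> set g3 = {}" using dj Zt(1) Yt(1) by (auto simp: g2_def g3_def)
    show "set g1 \<inter> (set g2 \<union> set g3) = {}" using ce(2) by (auto simp: g1_def g2_def g3_def)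
    show "set g0 \<inter> (set g1 \<union> (set g2 \<union> set g3)) = {}"
    proof -
      have "hd Z \<notin> set (tl Y)" "hd Y \<notin> set (tl Z)" "set Y \<inter> set (butlast Z) = {}"
        using dj ends Zt(1) Yt(1) Zb(1) by blast+
      then show ?thesis using ce(2) Zt(2) Yt(2) Zb(2) by (auto simp: g0_def g1_def g2_def g3_def)
    qed
  qed
  then have "splits (tame_chain (V \<union> W)) (?f ` ((set Z \<union> set Y) \<times> {e0, e1}))"
    unfolding eq
  proof (rule splits_image)
    show "inj_on ?f (set g0 \<union> (set g1 \<union> (set g2 \<union> set g3)))"
      unfolding eq[symmetric]
    proof (rule inj_onI)
      fix c d assume h: "c \<in> (set Z \<union> set Y) \<times> {e0, e1}" "d \<in> (set Z \<union> set Y) \<times> {e0, e1}" "?f c = ?f d"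
      have "snd c \<subseteq> W" "snd d \<subseteq> W" using h(1,2) e(1,2) by (auto simp: mem_Times_iff)
      moreover have "fst c \<subseteq> V" "fst d \<subseteq> V"
        using h(1,2) by (auto simp only: mem_Times_iff intro!: in_V)
      ultimately have s: "fst c \<subseteq> V" "fst d \<subseteq> V" "snd c \<subseteq> W" "snd d \<subseteq> W" by auto
      have "fst c \<union> snd c = fst d \<union> snd d" using h(3) by (simp add: case_prod_beta)
      then have "fst c = fst d" "snd c = snd d"
        using Un_restrict[OF s(1,3) assms(3)] Un_restrict[OF s(2,4) assms(3)] by auto
      then show "c = d" by (rule prod_eqI)
    qed
  qed (simp add: \<Phi>_def)
  then show ?thesis by (simp add: prd_def)
qed

lemma splits_tame_chain_single: "tame_chain V c \<Longrightarrow> splits (tame_chain V) (set c)"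
  by (rule splits_single)

text \<open>Only the corner chain \<open>Z\<close> is delicate. If \<open>es\<close> has three
  elements, \<open>Z \<otimes> set es\<close> splits by itself; if it has two, \<open>Z\<close> is
  treated jointly with its neighbour \<open>Y\<close>.\<close>

lemma splits_loose_chain_loose_chain_tame_chain:
  assumes "V \<in> U" "W \<in> U" "T \<in> U" "V \<inter> W = {}" "(V \<union> W) \<inter> T = {}"
    and "loose_chain V xs" "loose_chain W ys" "tame_chain T es" "4 \<le> length xs" "4 \<le> length ys" "2 \<le> length es"
  shows "splits (tame_chain (V \<union> W \<union> T)) ((set xs \<otimes> set ys) \<otimes> set es)"
proof -
  obtain Z Y R where d: "set xs \<otimes> set ys = set Z \<union> (set Y \<union> R)" "set Z \<inter> (set Y \<union> R) = {}" "set Y \<inter> R = {}"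
    "loose_chain (V \<union> W) Z" "4 \<le> length Z" "tame_chain (V \<union> W) Y" "4 \<le> length Y" "splits (tame_chain (V \<union> W)) R"
    "covers (hd Z) (hd Y)" "covers (last Y) (last Z)" "tame {hd Z, hd Y}" "tame (insert (last Z) (set Y))"
    using loose_chain_loose_chain[OF assms(1,2,4,6,7,9,10)] by blast
  have VW: "V \<union> W \<in> U" using union assms(1,2) .
  have sub: "set Z \<subseteq> Pow (V \<union> W)" "set Y \<subseteq> Pow (V \<union> W)" "R \<subseteq> Pow (V \<union> W)" "set es \<subseteq> Pow T"
    using loose_chain_sub[OF d(4)] tame_chain_sub[OF d(6)] splits_tame_chain_sub[OF d(8)] tame_chain_sub[OF assms(8)] .
  have tt: "splits (tame_chain (V \<union> W \<union> T)) (P \<otimes> set es)" if "splits (tame_chain (V \<union> W)) P" for P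
    by (rule splits_prd_tame_chain[OF VW assms(3,5) that splits_tame_chain_single[OF assms(8)]])
  have R: "splits (tame_chain (V \<union> W \<union> T)) (R \<otimes> set es)" using tt d(8) .
  show ?thesis
  proof (cases "3 \<le> length es")
    case True
    have Z: "splits (tame_chain (V \<union> W \<union> T)) (set Z \<otimes> set es)"
      using splits_loose_chain_tame_chain[OF VW assms(3,5) d(4) assms(8)] d(5) True by simp
    have Y: "splits (tame_chain (V \<union> W \<union> T)) (set Y \<otimes> set es)" using tt splits_single[of "tame_chain (V \<union> W)"] d(6) by blast
    show ?thesis unfolding d(1)
      by (intro splits_prd_Un[where V = "V \<union> W" and W = T] Z Y R) (use sub assms(5) d(2,3) in auto)
  next
    case False
    then have "length es = 2" using assms(11) by linarith
    then obtain e0 e1 where es: "es = [e0, e1]" by (auto simp: numeral_2_eq_2 length_Suc_conv)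
    have ZY: "splits (tame_chain (V \<union> W \<union> T)) ((set Z \<union> set Y) \<otimes> set es)"
      using splits_two_layers[OF VW assms(3,5) d(4,6,5,7,9-12)] d(2) assms(8) unfolding es by auto
    show ?thesis unfolding d(1) Un_assoc[symmetric]
      by (rule splits_prd_Un[where V = "V \<union> W" and W = T, OF ZY R])
         (use sub assms(5) d(2,3) in auto)
  qed
qed

text \<open>The first two chains give \<open>Z\<close>, a possible star \<open>E\<close> and long
  tame chains \<open>R\<close>. The third chain makes \<open>E\<close> and \<open>R\<close> tame
  products, to which the fourth is harmless. With \<open>Z\<close> in place of the first two, the
  case of two maximal chains and one tame chain applies.\<close>

lemma splits_lch3_tame_chain:
  assumes "V1 \<in> U" "V2 \<in> U" "V3 \<in> U" "V4 \<in> U"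
    and "V1 \<inter> V2 = {}" "(V1 \<union> V2) \<inter> V3 = {}" "(V1 \<union> V2 \<union> V3) \<inter> V4 = {}"
    and "loose_chain V1 c1" "loose_chain V2 c2" "loose_chain V3 c3" "tame_chain V4 c4"
    and "4 \<le> length c1" "4 \<le> length c2" "4 \<le> length c3" "2 \<le> length c4"
    and "even (length c1)" "even (length c2)"
  shows "splits (tame_chain (V1 \<union> V2 \<union> V3 \<union> V4)) ((set c1 \<otimes> set c2) \<otimes> set c3 \<otimes> set c4)"
proof -
  obtain Z E R where d: "set c1 \<otimes> set c2 = set Z \<union> (E \<union> R)" "set Z \<inter> (E \<union> R) = {}" "E \<inter> R = {}"
    "loose_chain (V1 \<union> V2) Z" "4 \<le> length Z" "E = {} \<or> star (V1 \<union> V2) E"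
    "splits (\<lambda>c. tame_chain (V1 \<union> V2) c \<and> 3 \<le> length c) R"
    using loose_chain_loose_chain_star[OF assms(1,2,5,8,9,12,13,16,17)] by blast
  have V: "V1 \<union> V2 \<in> U" "V1 \<union> V2 \<union> V3 \<in> U" using union assms(1-3) by auto
  have E: "splits (tame_chain (V1 \<union> V2 \<union> V3)) (E \<otimes> set c3)"
  proof (cases "E = {}")
    case True
    then show ?thesis by (simp add: prd_def splits_empty)
  next
    case False
    then show ?thesis using splits_star_loose_chain[OF V(1) assms(3,6) _ assms(10,14)] d(6) by blast
  qed
  have sub: "R \<subseteq> Pow (V1 \<union> V2)" using d(7) by (rule splits_sub) (use tame_chain_sub in blast)
  have R: "splits (tame_chain (V1 \<union> V2 \<union> V3)) (R \<otimes> set c3)"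
  proof (rule splits_prd[OF d(7) sub loose_chain_sub[OF assms(10)] assms(6)])
    fix c assume "tame_chain (V1 \<union> V2) c \<and> 3 \<le> length c"
    then show "splits (tame_chain (V1 \<union> V2 \<union> V3)) (set c \<otimes> set c3)"
      using splits_loose_chain_tame_chain[OF assms(3) V(1) _ assms(10), of c] assms(6,14)
      by (simp add: prd_comm Un_commute Int_commute)
  qed
  have subE: "E \<subseteq> Pow (V1 \<union> V2)" using d(6) star_sub by auto
  have ER: "splits (tame_chain (V1 \<union> V2 \<union> V3)) ((E \<union> R) \<otimes> set c3)"
    by (intro splits_prd_Un[where V = "V1 \<union> V2" and W = V3] E R subE sub loose_chain_sub assms(10,6) d(3))
  have subER: "E \<union> R \<subseteq> Pow (V1 \<union> V2)" using subE sub by blast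
  have disj: "(V1 \<union> V2 \<union> V3) \<inter> V4 = {}" using assms(7) .
  show ?thesis unfolding d(1) prd_Un
  proof (rule splits_Un)
    show "splits (tame_chain (V1 \<union> V2 \<union> V3 \<union> V4)) (set Z \<otimes> set c3 \<otimes> set c4)"
      by (rule splits_loose_chain_loose_chain_tame_chain[OF V(1) assms(3,4,6) disj d(4) assms(10,11) d(5) assms(14,15)])
    have "splits (tame_chain (V1 \<union> V2 \<union> V3 \<union> V4)) (((E \<union> R) \<otimes> set c3) \<otimes> set c4)"
      by (rule splits_prd_tame_chain[OF V(2) assms(4) disj ER splits_tame_chain_single[OF assms(11)]])
    then show "splits (tame_chain (V1 \<union> V2 \<union> V3 \<union> V4)) (E \<otimes> set c3 \<otimes> set c4 \<union> R \<otimes> set c3 \<otimes> set c4)"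
      unfolding prd_Un .
    have "(set Z \<otimes> (set c3 \<otimes> set c4)) \<inter> ((E \<union> R) \<otimes> (set c3 \<otimes> set c4)) = {}"
    proof (rule prd_disjoint[OF loose_chain_sub[OF d(4)] subER])
      show "set c3 \<otimes> set c4 \<subseteq> Pow (V3 \<union> V4)"
        using prd_sub[OF loose_chain_sub[OF assms(10)] tame_chain_sub[OF assms(11)]] .
      show "(V1 \<union> V2) \<inter> (V3 \<union> V4) = {}" using assms(6,7) by blast
    qed (use d(2) in auto)
    then show "(set Z \<otimes> set c3 \<otimes> set c4) \<inter> (E \<otimes> set c3 \<otimes> set c4 \<union> R \<otimes> set c3 \<otimes> set c4) = {}"
      by (simp only: prd_assoc prd_Un)
  qed
qed

text \<open>Of the blocks of the product of two halves, only \<open>Z\<close> times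
  \<open>Z'\<close> yields a loose chain, and its one bad pair is the permitted one,
  \<open>{}\<close> and the full set. Where just one of \<open>Z\<close>, \<open>Z'\<close> occurs,
  its partners are stars or chains of at least three elements; the last block is tame times
  tame.\<close>

lemma splits_lch4:
  assumes "V1 \<in> U" "V2 \<in> U" "V3 \<in> U" "V4 \<in> U"
    and "V1 \<inter> V2 = {}" "V3 \<inter> V4 = {}" "(V1 \<union> V2) \<inter> (V3 \<union> V4) = {}"
    and "loose_chain V1 c1" "loose_chain V2 c2" "loose_chain V3 c3" "loose_chain V4 c4"
    and "4 \<le> length c1" "4 \<le> length c2" "4 \<le> length c3" "4 \<le> length c4"
    and "even (length c1)" "even (length c2)" "even (length c3)" "even (length c4)"
  shows "splits (\<lambda>c. tame_chain (V1 \<union> V2 \<union> (V3 \<union> V4)) c \<or> loose_chain (V1 \<union> V2 \<union> (V3 \<union> V4)) c)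
    ((set c1 \<otimes> set c2) \<otimes> (set c3 \<otimes> set c4))"
proof -
  obtain Z E R where d: "set c1 \<otimes> set c2 = set Z \<union> (E \<union> R)" "set Z \<inter> (E \<union> R) = {}" "E \<inter> R = {}"
    "loose_chain (V1 \<union> V2) Z" "4 \<le> length Z" "E = {} \<or> star (V1 \<union> V2) E"
    "splits (\<lambda>c. tame_chain (V1 \<union> V2) c \<and> 3 \<le> length c) R"
    using loose_chain_loose_chain_star[OF assms(1,2,5,8,9,12,13,16,17)] by blast
  obtain Z' E' R' where d': "set c3 \<otimes> set c4 = set Z' \<union> (E' \<union> R')" "set Z' \<inter> (E' \<union> R') = {}" "E' \<inter> R' = {}"
    "loose_chain (V3 \<union> V4) Z'" "4 \<le> length Z'" "E' = {} \<or> star (V3 \<union> V4) E'"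
    "splits (\<lambda>c. tame_chain (V3 \<union> V4) c \<and> 3 \<le> length c) R'"
    using loose_chain_loose_chain_star[OF assms(3,4,6,10,11,14,15,18,19)] by blast
  define V W where "V = V1 \<union> V2" and "W = V3 \<union> V4"
  note d = d[folded V_def] and d' = d'[folded W_def]
  have VW: "V \<in> U" "W \<in> U" "V \<inter> W = {}" "W \<inter> V = {}" using union assms by (auto simp: V_def W_def)
  have sub: "E \<subseteq> Pow V" "R \<subseteq> Pow V" "E' \<subseteq> Pow W" "R' \<subseteq> Pow W" "set Z \<subseteq> Pow V" "set Z' \<subseteq> Pow W"
    using d(6) d'(6) star_sub splits_sub[OF d(7), of "Pow V"] splits_sub[OF d'(7), of "Pow W"]
      tame_chain_sub loose_chain_sub[OF d(4)] loose_chain_sub[OF d'(4)] by blast+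
  have tR: "splits (tame_chain V) R" "splits (tame_chain W) R'"
    using splits_mono[OF d(7), of "tame_chain V"] splits_mono[OF d'(7), of "tame_chain W"] by auto
  have tE: "splits (tame_chain V) E" "splits (tame_chain W) E'"
    using d(6) d'(6) splits_star splits_empty by auto
  have tER: "splits (tame_chain V) (E \<union> R)" "splits (tame_chain W) (E' \<union> R')"
    using splits_Un tE tR d(3) d'(3) by blast+
  have starl: "splits (tame_chain (A \<union> B)) (S \<otimes> set Y)"
    if "A \<in> U" "B \<in> U" "A \<inter> B = {}" "S = {} \<or> star A S" "loose_chain B Y" "4 \<le> length Y" for A B S Y
    using splits_star_loose_chain[OF that(1-3) _ that(5,6), of S] that(4)
    by (cases "S = {}") (auto simp: prd_def splits_empty)
  have longl: "splits (tame_chain (A \<union> B)) (S \<otimes> set Y)"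
    if "A \<in> U" "B \<in> U" "A \<inter> B = {}" "splits (\<lambda>c. tame_chain A c \<and> 3 \<le> length c) S" "loose_chain B Y" "4 \<le> length Y" "S \<subseteq> Pow A"
    for A B S Y
  proof (rule splits_prd[OF that(4,7) loose_chain_sub[OF that(5)] that(3)])
    fix c assume "tame_chain A c \<and> 3 \<le> length c"
    then show "splits (tame_chain (A \<union> B)) (set c \<otimes> set Y)"
      using splits_loose_chain_tame_chain[OF that(2,1) _ that(5), of c] that(3,6)
      by (simp add: prd_comm Un_commute Int_commute)
  qed
  have ERZ: "splits (tame_chain (V \<union> W)) ((E \<union> R) \<otimes> set Z')"
    by (intro splits_prd_Un[where V = V and W = W] starl longl VW d d' sub)
  have "splits (tame_chain (W \<union> V)) ((E' \<union> R') \<otimes> set Z)"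
    by (intro splits_prd_Un[where V = W and W = V] starl longl VW d d' sub)
  then have ZER: "splits (tame_chain (V \<union> W)) (set Z \<otimes> (E' \<union> R'))"
    by (simp add: prd_comm Un_commute)
  have ERER: "splits (tame_chain (V \<union> W)) ((E \<union> R) \<otimes> (E' \<union> R'))"
    by (rule splits_prd_tame_chain[OF VW(1-3) tER])
  obtain X Y Q where x: "set Z \<otimes> set Z' = set X \<union> (set Y \<union> Q)" "set X \<inter> (set Y \<union> Q) = {}" "set Y \<inter> Q = {}"
    "loose_chain (V \<union> W) X" "tame_chain (V \<union> W) Y" "splits (tame_chain (V \<union> W)) Q"
    using loose_chain_loose_chain[OF VW(1-3) d(4) d'(4) d(5) d'(5)] by blast
  let ?\<Theta> = "\<lambda>c. tame_chain (V \<union> W) c \<or> loose_chain (V \<union> W) c"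
  have weak: "splits ?\<Theta> P" if "splits (tame_chain (V \<union> W)) P" for P
    using that by (rule splits_mono) simp
  have "splits ?\<Theta> (set X \<union> (set Y \<union> Q))"
    by (intro splits_Un x weak[OF x(6)] splits_single) (use x in auto)
  then have ZZ: "splits ?\<Theta> (set Z' \<otimes> set Z)" unfolding x(1)[symmetric] prd_comm[of "set Z"] .
  have "splits ?\<Theta> ((set Z' \<union> (E' \<union> R')) \<otimes> set Z)"
    by (rule splits_prd_Un[where V = W and W = V, OF ZZ weak])
       (use ZER sub VW d'(2) in \<open>auto simp: prd_comm\<close>)
  then have A: "splits ?\<Theta> (set Z \<otimes> (set Z' \<union> (E' \<union> R')))" by (simp add: prd_comm)
  have "splits ?\<Theta> ((set Z' \<union> (E' \<union> R')) \<otimes> (E \<union> R))"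
    by (rule splits_prd_Un[where V = W and W = V, OF weak weak])
       (use ERZ ERER sub VW d'(2) in \<open>auto simp: prd_comm\<close>)
  then have B: "splits ?\<Theta> ((E \<union> R) \<otimes> (set Z' \<union> (E' \<union> R')))" by (simp add: prd_comm)
  have "splits ?\<Theta> ((set Z \<union> (E \<union> R)) \<otimes> (set Z' \<union> (E' \<union> R')))"
    by (rule splits_prd_Un[where V = V and W = W, OF A B]) (use sub VW d(2) in auto)
  then show ?thesis unfolding d(1) d'(1) V_def W_def .
qed

end

section \<open>One maximal chain and three two-element chains\<close>

context bad_differences
begin

text \<open>Tameness with a list of exceptions: \<open>B\<close> describes the bad pairs that are
  tolerated and handled when different indices are compared.\<close>

definition only_bad :: "('a set \<Rightarrow> 'a set \<Rightarrow> bool) \<Rightarrow> 'a set list \<Rightarrow> bool" where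
  "only_bad B c \<longleftrightarrow> (\<forall>u\<in>set c. \<forall>v\<in>set c. u \<subset> v \<longrightarrow> v - u \<in> U \<longrightarrow> B u v)"

lemma tame_chain_only_bad: "tame_chain V c \<Longrightarrow> sym_chain V c \<and> only_bad B c"
  by (auto simp: tame_chain_def tame_def only_bad_def)

lemma loose_chain_top:
  assumes "loose_chain V xs"
  shows "xs ! 0 = {}" "xs ! (length xs - 1) = V"
proof -
  have s: "sym_chain V xs" and h: "hd xs = {}" using assms by (auto simp: loose_chain_def)
  then have ne: "xs \<noteq> []" "finite V" "last xs \<subseteq> V" "card (last xs) = card V"
    using last_in_set[of xs] by (auto simp: sym_chain_def simp del: last_in_set)
  then show "xs ! 0 = {}" "xs ! (length xs - 1) = V"
    using h card_subset_eq[OF ne(2,3,4)] by (simp_all add: hd_conv_nth last_conv_nth)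
qed

text \<open>Here a bad pair is unavoidable, but it can be put over either of the two elements of \<open>es\<close>.\<close>

lemma splits_loose_chain_pair:
  assumes "V \<in> U" "W \<in> U" "V \<inter> W = {}" "loose_chain V xs" "2 \<le> length xs" "tame_chain W es" "length es = 2" "e \<in> set es"
  shows "splits (\<lambda>c. sym_chain (V \<union> W) c \<and> only_bad (\<lambda>u v. v - u = V \<and> u \<inter> W = e) c) (set xs \<otimes> set es)"
proof -
  define a where "a = length xs - 1"
  interpret chain_pair U V W xs es True False a 1
    unfolding a_def using chain_pairI[OF assms(1-3), of xs True es False] assms(4,6,7) tame_chain_tame_but_ends[OF assms(6)]
    by (simp add: loose_chain_def tame_chain_def)
  have a: "1 \<le> a" using assms(5) by (simp add: a_def)
  obtain r where r: "r \<le> 1" "es ! r = e"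
    using assms(7,8) by (metis One_nat_def Suc_1 in_set_conv_nth less_Suc_eq_le)
  define \<Phi> where "\<Phi> g \<longleftrightarrow> grid_chain a 1 g \<and>
    (\<forall>(x, y)\<in>set g. \<forall>(x', y')\<in>set g. ends True a x x' \<longrightarrow> y = y' \<longrightarrow> x \<noteq> x' \<longrightarrow> y = r)" for g
  have "splits \<Phi> ({..a} \<times> {..1})"
  proof (cases "r = 0")
    case True
    \<comment> \<open>The long path takes the whole row \<open>r\<close> and one end cell of the
      other row, so only row \<open>r\<close> keeps both its ends on one path.\<close>
    let ?g = "hseg 0 0 (Suc a) @ [(a, 1)]" and ?h = "hseg 1 0 a"
    have "\<Phi> ?g" "\<Phi> ?h"
      using a True by (auto simp: \<Phi>_def grid_chain_def successively_append_iff successively_Cons hd_append ends_def)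
    then have "splits \<Phi> (set ?g \<union> set ?h)" by (intro splits_Un splits_single) auto
    moreover have "{..a} \<times> {..1} = set ?g \<union> set ?h"
    proof (rule rectangle_eqI)
      fix x y :: nat assume "x \<le> a" "y \<le> 1"
      then show "(x, y) \<in> set ?g \<union> set ?h" by (cases "y = 0") auto
    qed auto
    ultimately show ?thesis by simp
  next
    case False
    let ?g = "(0, 0) # hseg 1 0 (Suc a)" and ?h = "hseg 0 1 (Suc a)"
    have "\<Phi> ?g" "\<Phi> ?h"
      using a False r(1) by (auto simp: \<Phi>_def grid_chain_def successively_append_iff successively_Cons hd_append ends_def)
    then have "splits \<Phi> (set ?g \<union> set ?h)" by (intro splits_Un splits_single) auto
    moreover have "{..a} \<times> {..1} = set ?g \<union> set ?h"
    proof (rule rectangle_eqI)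
      fix x y :: nat assume "x \<le> a" "y \<le> 1"
      then show "(x, y) \<in> set ?g \<union> set ?h" by (cases "y = 0") auto
    qed (use a in auto)
    ultimately show ?thesis by simp
  qed
  then have "splits (\<lambda>c. sym_chain (V \<union> W) c \<and> only_bad (\<lambda>u v. v - u = V \<and> u \<inter> W = e) c) (f ` ({..a} \<times> {..1}))"
  proof (rule splits_image[OF _ inj_f], intro conjI)
    fix g assume g: "\<Phi> g" "set g \<subseteq> {..a} \<times> {..1}"
    then show "sym_chain (V \<union> W) (map f g)" using f_sym_chain by (simp add: \<Phi>_def)
    show "only_bad (\<lambda>u v. v - u = V \<and> u \<inter> W = e) (map f g)"
      unfolding only_bad_def
    proof (intro ballI impI)
      fix u v assume "u \<in> set (map f g)" "v \<in> set (map f g)" and uv: "u \<subset> v" "v - u \<in> U"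
      then obtain x y x' y' where c: "(x, y) \<in> set g" "(x', y') \<in> set g" "u = f (x, y)" "v = f (x', y')"
        by auto
      then have b: "x \<le> a" "y \<le> 1" "x' \<le> a" "y' \<le> 1" using g(2) by auto
      have e: "ends True a x x'" "y = y'" using f_bad[OF b] uv c(3,4) by (auto simp: ends_def)
      then have "x \<noteq> x'" using uv(1) c by auto
      then have "y = r" "x = 0" "x' = a" using g(1) c(1,2) e unfolding \<Phi>_def ends_def by auto
      then show "v - u = V \<and> u \<inter> W = e"
        using c(3,4) e(2) r(2) f_restrict(2)[OF b(1,2)] ys_sub[OF b(2)] disj loose_chain_top[OF assms(4)]
        by (auto simp: cell_def a_def)
    qed
  qed
  then show ?thesis unfolding f_image .
qed

lemma splits_pair_pair:
  assumes "V \<in> U" "W \<in> U" "V \<inter> W = {}" "tame_chain V bs" "length bs = 2" "tame_chain W cs" "length cs = 2"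
  shows "splits (\<lambda>c. tame_chain (V \<union> W) c \<and> (length c = 3 \<or> length c = 1)) (set bs \<otimes> set cs)"
proof -
  interpret chain_pair U V W bs cs False False 1 1
    using chain_pairI[OF assms(1-3), of bs False cs False] assms(4-7) tame_chain_tame_but_ends[OF assms(4)] tame_chain_tame_but_ends[OF assms(6)]
    by (simp add: tame_chain_def)
  let ?g = "[(0, 0), (0, 1), (1, 1)] :: (nat \<times> nat) list" and ?h = "[(1, 0)] :: (nat \<times> nat) list"
  have "splits (\<lambda>g. grid_chain 1 1 g \<and> (length g = 3 \<or> length g = 1)) (set ?g \<union> set ?h)"
    by (intro splits_Un splits_single) (auto simp: grid_chain_def)
  moreover have "{..1} \<times> {..1} = set ?g \<union> set ?h" by (auto simp: le_Suc_eq)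
  ultimately have "splits (\<lambda>g. grid_chain 1 1 g \<and> (length g = 3 \<or> length g = 1)) ({..1} \<times> {..1})" by simp
  then have "splits (\<lambda>c. tame_chain (V \<union> W) c \<and> (length c = 3 \<or> length c = 1)) (f ` ({..1} \<times> {..1}))"
    by (rule splits_image[OF _ inj_f]) (use f_tame_chain in \<open>auto simp: avoids_def ends_def\<close>)
  then show ?thesis unfolding f_image .
qed

text \<open>Two by three cells split into paths of four and two cells, and the short one can be
  placed in either row; with a block of one element the only path meets both rows. So each chain
  that will force a bad pair has an element over the prescribed \<open>s\<close>.\<close>

lemma splits_pair_block:
  assumes "V \<in> U" "W \<in> U" "V \<inter> W = {}" "tame_chain V bs" "length bs = 2" "s \<in> set bs"
    and "tame_chain W cs" "length cs = 3 \<or> length cs = 1"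
  shows "splits (\<lambda>c. tame_chain (V \<union> W) c \<and> (3 \<le> length c \<or> length c = 2 \<and> (\<exists>e\<in>set c. e \<inter> V = s)))
    (set bs \<otimes> set cs)"
proof -
  define b where "b = length cs - 1"
  interpret chain_pair U V W bs cs False False 1 b
    unfolding b_def
    using chain_pairI[OF assms(1-3), of bs False cs False] assms(4-8) tame_chain_tame_but_ends[OF assms(4)] tame_chain_tame_but_ends[OF assms(7)]
    by (simp add: tame_chain_def)
  obtain r where r: "r \<le> 1" "bs ! r = s"
    using assms(5,6) by (metis One_nat_def Suc_1 in_set_conv_nth less_Suc_eq_le)
  define \<Phi> where "\<Phi> g \<longleftrightarrow> grid_chain 1 b g \<and> (3 \<le> length g \<or> length g = 2 \<and> (\<exists>c\<in>set g. fst c = r))" for g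
  have "r = 0 \<or> r = 1" using r(1) by linarith
  then consider "b = 0" | "b = 2" "r = 0" | "b = 2" "r = 1" using assms(8) by (auto simp: b_def)
  then have "splits \<Phi> ({..1} \<times> {..b})"
  proof cases
    case 1
    let ?g = "[(0, 0), (1, 0)] :: (nat \<times> nat) list"
    have "\<Phi> ?g" using 1 r(1) by (auto simp: \<Phi>_def grid_chain_def)
    moreover have "{..1} \<times> {..b} = set ?g" using 1 by (auto simp: le_Suc_eq)
    ultimately show ?thesis using splits_single[of \<Phi> ?g] by simp
  next
    case 2
    let ?g = "[(0, 0), (1, 0), (1, 1), (1, 2)] :: (nat \<times> nat) list" and ?h = "[(0, 1), (0, 2)] :: (nat \<times> nat) list"
    have "\<Phi> ?g" "\<Phi> ?h" using 2 by (auto simp: \<Phi>_def grid_chain_def)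
    then have "splits \<Phi> (set ?g \<union> set ?h)" by (intro splits_Un splits_single) auto
    moreover have "{..1} \<times> {..b} = set ?g \<union> set ?h" using 2 by (auto simp: le_Suc_eq numeral_2_eq_2)
    ultimately show ?thesis by simp
  next
    case 3
    let ?g = "[(0, 0), (0, 1), (0, 2), (1, 2)] :: (nat \<times> nat) list" and ?h = "[(1, 0), (1, 1)] :: (nat \<times> nat) list"
    have "\<Phi> ?g" "\<Phi> ?h" using 3 by (auto simp: \<Phi>_def grid_chain_def)
    then have "splits \<Phi> (set ?g \<union> set ?h)" by (intro splits_Un splits_single) auto
    moreover have "{..1} \<times> {..b} = set ?g \<union> set ?h" using 3 by (auto simp: le_Suc_eq numeral_2_eq_2)
    ultimately show ?thesis by simp
  qed
  then have "splits (\<lambda>c. tame_chain (V \<union> W) c \<and> (3 \<le> length c \<or> length c = 2 \<and> (\<exists>e\<in>set c. e \<inter> V = s)))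
    (f ` ({..1} \<times> {..b}))"
  proof (rule splits_image[OF _ inj_f], intro conjI)
    fix g assume g: "\<Phi> g" "set g \<subseteq> {..1} \<times> {..b}"
    then show "tame_chain (V \<union> W) (map f g)" using f_tame_chain[of g] by (simp add: \<Phi>_def avoids_def ends_def)
    have "f c \<inter> V = s" if "c \<in> set g" "fst c = r" for c
    proof -
      have "c \<in> {..1} \<times> {..b}" using that(1) g(2) by blast
      then show ?thesis using f_restrict(1)[of "fst c" "snd c"] that(2) r by (cases c) simp
    qed
    then show "3 \<le> length (map f g) \<or> length (map f g) = 2 \<and> (\<exists>e\<in>set (map f g). e \<inter> V = s)"
      using g(1) by (auto simp: \<Phi>_def)
  qed
  then show ?thesis unfolding f_image .
qed

text \<open>The last two pairs give chains of three and one elements; the first pair turns these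
  into chains of four and two, and of two. The chain of four is long enough to meet
  \<open>c1\<close> without damage. Each of the others carries a bad pair, placed over its element
  with \<open>V2\<close>-part \<open>s\<close>.\<close>

lemma splits_loose_chain_pairs:
  assumes "V1 \<in> U" "V2 \<in> U" "V3 \<in> U" "V4 \<in> U"
    and "V1 \<inter> (V2 \<union> (V3 \<union> V4)) = {}" "V2 \<inter> (V3 \<union> V4) = {}" "V3 \<inter> V4 = {}"
    and "loose_chain V1 c1" "4 \<le> length c1" "tame_chain V2 c2" "tame_chain V3 c3" "tame_chain V4 c4"
    and "length c2 = 2" "length c3 = 2" "length c4 = 2" "s \<in> set c2"
  shows "splits (\<lambda>c. sym_chain (V1 \<union> (V2 \<union> (V3 \<union> V4))) c \<and> only_bad (\<lambda>u v. v - u = V1 \<and> u \<inter> V2 = s) c)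
    (set c1 \<otimes> (set c2 \<otimes> (set c3 \<otimes> set c4)))"
proof -
  have V: "V3 \<union> V4 \<in> U" "V2 \<union> (V3 \<union> V4) \<in> U" using union assms(1-4) by auto
  let ?\<Psi> = "\<lambda>c. tame_chain (V2 \<union> (V3 \<union> V4)) c \<and> (3 \<le> length c \<or> length c = 2 \<and> (\<exists>e\<in>set c. e \<inter> V2 = s))"
  note sub = tame_chain_sub[OF assms(10)] tame_chain_sub[OF assms(11)] tame_chain_sub[OF assms(12)] loose_chain_sub[OF assms(8)]
  have "splits ?\<Psi> ((set c3 \<otimes> set c4) \<otimes> set c2)"
  proof (rule splits_prd[OF splits_pair_pair[OF assms(3,4,7,11,14,12,15)] prd_sub[OF sub(2,3)] sub(1)])
    show "(V3 \<union> V4) \<inter> V2 = {}" using assms(6) by auto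
    fix c assume "tame_chain (V3 \<union> V4) c \<and> (length c = 3 \<or> length c = 1)"
    then have "splits ?\<Psi> (set c2 \<otimes> set c)"
      using splits_pair_block[OF assms(2) V(1) assms(6,10,13,16)] by blast
    then show "splits ?\<Psi> (set c \<otimes> set c2)" unfolding prd_comm[of "set c2"] .
  qed
  then have A: "splits ?\<Psi> (set c2 \<otimes> (set c3 \<otimes> set c4))" unfolding prd_comm[of "set c2"] .
  let ?\<Theta> = "\<lambda>c. sym_chain (V1 \<union> (V2 \<union> (V3 \<union> V4))) c \<and> only_bad (\<lambda>u v. v - u = V1 \<and> u \<inter> V2 = s) c"
  have "splits ?\<Theta> ((set c2 \<otimes> (set c3 \<otimes> set c4)) \<otimes> set c1)"
  proof (rule splits_prd[OF A prd_sub[OF sub(1) prd_sub[OF sub(2,3)]] sub(4)])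
    show "(V2 \<union> (V3 \<union> V4)) \<inter> V1 = {}" using assms(5) by auto
    fix c assume c: "?\<Psi> c"
    show "splits ?\<Theta> (set c \<otimes> set c1)"
    proof (cases "3 \<le> length c")
      case True
      then have "splits (tame_chain (V1 \<union> (V2 \<union> (V3 \<union> V4)))) (set c1 \<otimes> set c)"
        using splits_loose_chain_tame_chain[OF assms(1) V(2) assms(5,8), of c] c assms(9) by simp
      then show ?thesis unfolding prd_comm[of "set c"]
        by (rule splits_mono) (rule tame_chain_only_bad)
    next
      case False
      then obtain e where e: "e \<in> set c" "e \<inter> V2 = s" and l: "length c = 2" using c by auto
      have "splits (\<lambda>d. sym_chain (V1 \<union> (V2 \<union> (V3 \<union> V4))) d \<and>
          only_bad (\<lambda>u v. v - u = V1 \<and> u \<inter> (V2 \<union> (V3 \<union> V4)) = e) d) (set c1 \<otimes> set c)"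
        using splits_loose_chain_pair[OF assms(1) V(2) assms(5,8) _ _ l e(1)] c assms(9) by simp
      then show ?thesis unfolding prd_comm[of "set c"]
      proof (rule splits_mono)
        fix d assume d: "sym_chain (V1 \<union> (V2 \<union> (V3 \<union> V4))) d \<and>
          only_bad (\<lambda>u v. v - u = V1 \<and> u \<inter> (V2 \<union> (V3 \<union> V4)) = e) d"
        have "u \<inter> V2 = s" if "u \<inter> (V2 \<union> (V3 \<union> V4)) = e" for u using that e(2) by blast
        then show "?\<Theta> d" using d unfolding only_bad_def by blast
      qed
    qed
  qed
  then show ?thesis unfolding prd_comm[of "set c1"] .
qed

end

section \<open>Case distinction for four factors\<close>

lemma prd_perm:
  assumes "{t, j, k, l} = {..<4::nat}" "distinct [t, j, k, l]"
  shows "P t \<otimes> (P j \<otimes> (P k \<otimes> P l)) = P 0 \<otimes> (P 1 \<otimes> (P 2 \<otimes> P 3))"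
proof -
  have "t < 4" "j < 4" "k < 4" "l < 4" using assms(1) by blast+
  then have "t = 0 \<or> t = 1 \<or> t = 2 \<or> t = 3" "j = 0 \<or> j = 1 \<or> j = 2 \<or> j = 3"
    "k = 0 \<or> k = 1 \<or> k = 2 \<or> k = 3" "l = 0 \<or> l = 1 \<or> l = 2 \<or> l = 3"
    by linarith+
  moreover have "t \<noteq> j" "t \<noteq> k" "t \<noteq> l" "j \<noteq> k" "j \<noteq> l" "k \<noteq> l" using assms(2) by simp_all
  ultimately show ?thesis by (elim disjE) (simp_all add: prd_ac)
qed

text \<open>The indices satisfying \<open>L\<close> come first, so their number alone determines
  which of the product lemmas applies.\<close>

lemma perm_sorted:
  fixes L :: "nat \<Rightarrow> bool"
  obtains t j k l where "{t, j, k, l} = {..<4}" "distinct [t, j, k, l]" "L l \<longrightarrow> L k" "L k \<longrightarrow> L j" "L j \<longrightarrow> L t"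
proof -
  define xs where "xs = filter L [0, 1, 2, 3] @ filter (\<lambda>i. \<not> L i) [0, 1, 2, 3]"
  have "{..<4} = {0, 1, 2, 3::nat}" by auto
  then have xs: "set xs = {..<4}" "distinct xs" "sorted_wrt (\<lambda>x y. L y \<longrightarrow> L x) xs"
    by (auto simp: xs_def sorted_wrt_append)
  then have "length xs = 4" using distinct_card[of xs] by simp
  then obtain t j k l where e: "xs = [t, j, k, l]"
    by (auto simp: numeral_eq_Suc length_Suc_conv)
  show thesis by (rule that[of t j k l]) (use xs in \<open>auto simp: e\<close>)
qed

lemma perm_first_two:
  assumes "t < 4" "j < 4" "t \<noteq> (j::nat)"
  obtains k l where "{t, j, k, l} = {..<4}" "distinct [t, j, k, l]"
proof -
  have "card ({..<4} - {t, j}) = 2" using assms by (simp add: card_Diff_subset)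
  then obtain k l where "{..<4} - {t, j} = {k, l}" "k \<noteq> l" by (auto simp: card_2_iff)
  then show thesis using assms by (intro that[of k l]) auto
qed

context bad_differences
begin

lemma loose_chain_only_bad:
  assumes "loose_chain V c"
  shows "sym_chain V c \<and> only_bad (\<lambda>u v. u = {} \<and> v = V) c"
proof -
  have s: "sym_chain V c" and o: "tame_but_ends True c" using assms by (auto simp: loose_chain_def)
  have "u = {} \<and> v = V" if h: "u \<in> set c" "v \<in> set c" "u \<subset> v" "v - u \<in> U" for u v
  proof -
    obtain i j where ij: "i < length c" "j < length c" "u = c ! i" "v = c ! j"
      using h(1,2) unfolding in_set_conv_nth by blast
    then have "i \<le> j" "i \<noteq> j" using h(3) sym_chain_subset_iff[OF s, of i j] by auto
    then have "i = 0 \<and> j = length c - 1" using o ij h(4) unfolding tame_but_ends_def ends_def by blast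
    then show ?thesis using ij loose_chain_top[OF assms] by simp
  qed
  then show ?thesis using s unfolding only_bad_def by blast
qed

lemma only_bad_mono: "only_bad B c \<Longrightarrow> (\<And>u v. B u v \<Longrightarrow> B' u v) \<Longrightarrow> only_bad B' c"
  unfolding only_bad_def by blast

text \<open>\<open>g t\<close> is the factor that steers the bad pairs when factor \<open>t\<close>
  is the only maximal one, and \<open>S (g t)\<close> holds the positions allowed there. The
  condition \<open>g t \<noteq> t\<close> ensures that the steering factor is one of the two-element
  chains in that case. The pair \<open>{}\<close>, \<open>X\<close> arises from four maximal
  chains.\<close>

lemma splits_quad:
  fixes V :: "nat \<Rightarrow> 'a set" and C :: "nat \<Rightarrow> 'a set list" and S :: "nat \<Rightarrow> 'a set set"
  assumes VU: "\<And>t. t < 4 \<Longrightarrow> V t \<in> U"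
    and disj: "\<And>s t. s < 4 \<Longrightarrow> t < 4 \<Longrightarrow> s \<noteq> t \<Longrightarrow> V s \<inter> V t = {}"
    and even: "\<And>t. t < 4 \<Longrightarrow> even (length (C t))"
    and kind: "\<And>t. t < 4 \<Longrightarrow> loose_chain (V t) (C t) \<and> 4 \<le> length (C t) \<or> tame_chain (V t) (C t) \<and> 2 \<le> length (C t)"
    and g: "\<And>t. t < 4 \<Longrightarrow> g t < 4 \<and> g t \<noteq> t"
    and S: "\<And>t. t < 4 \<Longrightarrow> length (C (g t)) = 2 \<Longrightarrow> \<exists>s\<in>set (C (g t)). s \<in> S (g t)"
    and X: "X = (\<Union>t<4. V t)"
  shows "splits (\<lambda>c. sym_chain X c \<and>
      only_bad (\<lambda>u v. u = {} \<and> v = X \<or> (\<exists>t<4. v - u = V t \<and> u \<inter> V (g t) \<in> S (g t))) c)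
    (set (C 0) \<otimes> (set (C 1) \<otimes> (set (C 2) \<otimes> set (C 3))))"
proof -
  define L where "L t \<longleftrightarrow> loose_chain (V t) (C t) \<and> 4 \<le> length (C t)" for t
  let ?B = "\<lambda>u v. u = {} \<and> v = X \<or> (\<exists>t<4. v - u = V t \<and> u \<inter> V (g t) \<in> S (g t))"
  let ?P = "\<lambda>i. set (C i)"
  let ?Q = "?P 0 \<otimes> (?P 1 \<otimes> (?P 2 \<otimes> ?P 3))"
  have T: "tame_chain (V t) (C t)" "2 \<le> length (C t)" if "\<not> L t" "t < 4" for t
    using kind[OF that(2)] that(1) by (auto simp: L_def)
  have union4: "V t \<union> V j \<union> V k \<union> V l = X" if "{t, j, k, l} = {..<4}" for t j k l
    unfolding X that[symmetric] by (simp add: Un_assoc)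
  have tame_chain_case: ?thesis if "splits (tame_chain X) ?Q"
    using that by (rule splits_mono) (rule tame_chain_only_bad)
  obtain t j k l where p: "{t, j, k, l} = {..<4}" "distinct [t, j, k, l]" "L l \<longrightarrow> L k" "L k \<longrightarrow> L j" "L j \<longrightarrow> L t"
    using perm_sorted[of L] .
  have less: "t < 4" "j < 4" "k < 4" "l < 4" using p(1) by auto
  note VU4 = VU[OF less(1)] VU[OF less(2)] VU[OF less(3)] VU[OF less(4)]
  have d: "V t \<inter> V j = {}" "V t \<inter> V k = {}" "V t \<inter> V l = {}" "V j \<inter> V k = {}" "V j \<inter> V l = {}" "V k \<inter> V l = {}"
    using disj less p(2) by simp_all
  have d': "(V t \<union> V j) \<inter> V k = {}" "(V t \<union> V j \<union> V k) \<inter> V l = {}" "(V t \<union> V j) \<inter> (V k \<union> V l) = {}"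
    using d by blast+
  have Q: "?P t \<otimes> ?P j \<otimes> ?P k \<otimes> ?P l = ?Q" "(?P t \<otimes> ?P j) \<otimes> (?P k \<otimes> ?P l) = ?Q"
    using prd_perm[OF p(1,2), of ?P] by (simp_all add: prd_assoc)
  have X': "V t \<union> V j \<union> V k \<union> V l = X" "V t \<union> V j \<union> (V k \<union> V l) = X"
    using union4[OF p(1)] by (simp_all add: Un_assoc)
  \<comment> \<open>By the sorting these are four, three, two, one and no maximal chains.\<close>
  consider "L l" | "L k" "\<not> L l" | "L j" "\<not> L k" "\<not> L l" | "L t" "\<not> L j" "\<not> L k" "\<not> L l"
    | "\<not> L t" "\<not> L j" "\<not> L k" "\<not> L l"
    using p by blast
  then show ?thesis
  proof cases
    case 1
    then have "L t" "L j" "L k" "L l" using p by auto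
    then have "splits (\<lambda>c. tame_chain X c \<or> loose_chain X c) ?Q"
      using splits_lch4[OF VU4 d(1,6) d'(3), of "C t" "C j" "C k" "C l"] even[OF less(1)] even[OF less(2)]
        even[OF less(3)] even[OF less(4)]
      unfolding Q X' L_def by simp
    then show ?thesis
    proof (rule splits_mono)
      fix c assume "tame_chain X c \<or> loose_chain X c"
      then show "sym_chain X c \<and> only_bad ?B c"
      proof
        assume "loose_chain X c"
        from loose_chain_only_bad[OF this] have c: "sym_chain X c" "only_bad (\<lambda>u v. u = {} \<and> v = X) c" by auto
        from c(2) have "only_bad ?B c" by (rule only_bad_mono) simp
        with c(1) show ?thesis ..
      qed (rule tame_chain_only_bad)
    qed
  next
    case 2
    then have "L t" "L j" "L k" using p by auto
    then have "splits (tame_chain X) ?Q"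
      using splits_lch3_tame_chain[OF VU4 d(1) d'(1,2), of "C t" "C j" "C k" "C l"] even[OF less(1)]
        even[OF less(2)] T[OF 2(2) less(4)]
      unfolding Q X' L_def by simp
    then show ?thesis by (rule tame_chain_case)
  next
    case 3
    then have L2: "loose_chain (V t) (C t)" "loose_chain (V j) (C j)" "4 \<le> length (C t)" "4 \<le> length (C j)"
      using p by (auto simp: L_def)
    have A: "splits (tame_chain (V t \<union> V j \<union> V k)) (?P t \<otimes> ?P j \<otimes> ?P k)"
      using splits_loose_chain_loose_chain_tame_chain[OF VU4(1-3) d(1) d'(1) L2(1,2) T(1)[OF 3(2) less(3)] L2(3,4) T(2)[OF 3(2) less(3)]] .
    have "V t \<union> V j \<union> V k \<in> U" using union VU4 by auto
    from splits_prd_tame_chain[OF this VU4(4) d'(2) A splits_tame_chain_single[OF T(1)[OF 3(3) less(4)]]]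
    show ?thesis unfolding Q X' by (rule tame_chain_case)
  next
    case 4
    have lt: "loose_chain (V t) (C t)" "4 \<le> length (C t)" using 4 by (auto simp: L_def)
    have nL: "\<not> L i" if "i < 4" "i \<noteq> t" for i
      using that 4 p(1) by (metis insertE lessThan_iff singletonD)
    show ?thesis
    \<comment> \<open>A partner of at least three elements absorbs the maximal chain, and then only
      tame products remain. Otherwise all three partners have two elements and the steering is
      required.\<close>
    proof (cases "\<exists>i<4. i \<noteq> t \<and> 3 \<le> length (C i)")
      case True
      then obtain i where i: "i < 4" "i \<noteq> t" "3 \<le> length (C i)" by blast
      obtain m n where q: "{t, i, m, n} = {..<4}" "distinct [t, i, m, n]"
        using perm_first_two[OF less(1) i(1)] i(2) by metis
      have mn: "m < 4" "n < 4" "m \<noteq> t" "n \<noteq> t" "i \<noteq> m" "i \<noteq> n" "m \<noteq> n" using q by auto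
      have e: "V t \<inter> V i = {}" "V m \<inter> V n = {}" "(V t \<union> V i) \<inter> (V m \<union> V n) = {}"
        using disj[OF less(1) i(1)] disj[OF mn(1,2)] disj[OF less(1) mn(1)] disj[OF less(1) mn(2)]
          disj[OF i(1) mn(1)] disj[OF i(1) mn(2)] i(2) mn by auto
      have A: "splits (tame_chain (V t \<union> V i)) (?P t \<otimes> ?P i)"
        using splits_loose_chain_tame_chain[OF VU4(1) VU[OF i(1)] e(1) lt(1) T(1)[OF nL[OF i(1,2)] i(1)]] lt(2) i(3) by simp
      have B: "splits (tame_chain (V m \<union> V n)) (?P m \<otimes> ?P n)"
        using splits_tame_chain_tame_chain[OF VU[OF mn(1)] VU[OF mn(2)] e(2) T(1)[OF nL[OF mn(1,3)] mn(1)] T(1)[OF nL[OF mn(2,4)] mn(2)]] .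
      have "V t \<union> V i \<in> U" "V m \<union> V n \<in> U" using union VU less(1) i(1) mn(1,2) by auto
      from splits_prd_tame_chain[OF this e(3) A B] have "splits (tame_chain X) ?Q"
        using union4[OF q(1)] prd_perm[OF q, of ?P] by (simp add: prd_assoc Un_assoc)
      then show ?thesis by (rule tame_chain_case)
    next
      case False
      have two: "length (C i) = 2" if "i < 4" "i \<noteq> t" for i
        using False T(2)[OF nL[OF that] that(1)] that by (metis Suc_leI le_neq_implies_less numeral_2_eq_2 numeral_3_eq_3)
      define i where "i = g t"
      have i: "i < 4" "i \<noteq> t" using g[OF less(1)] by (auto simp: i_def)
      obtain m n where q: "{t, i, m, n} = {..<4}" "distinct [t, i, m, n]"
        using perm_first_two[OF less(1) i(1)] i(2) by metis
      have mn: "m < 4" "n < 4" "m \<noteq> t" "n \<noteq> t" "i \<noteq> m" "i \<noteq> n" "m \<noteq> n" using q by auto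
      obtain s where s: "s \<in> ?P i" "s \<in> S i" using S[OF less(1)] two[OF i] by (auto simp: i_def)
      have e: "V t \<inter> (V i \<union> (V m \<union> V n)) = {}" "V i \<inter> (V m \<union> V n) = {}" "V m \<inter> V n = {}"
        using disj[OF less(1) i(1)] disj[OF mn(1,2)] disj[OF less(1) mn(1)] disj[OF less(1) mn(2)]
          disj[OF i(1) mn(1)] disj[OF i(1) mn(2)] i(2) mn by auto
      have "splits (\<lambda>c. sym_chain (V t \<union> (V i \<union> (V m \<union> V n))) c \<and> only_bad (\<lambda>u v. v - u = V t \<and> u \<inter> V i = s) c)
        (?P t \<otimes> (?P i \<otimes> (?P m \<otimes> ?P n)))"
        by (rule splits_loose_chain_pairs[OF VU4(1) VU[OF i(1)] VU[OF mn(1)] VU[OF mn(2)] e lt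
              T(1)[OF nL[OF i] i(1)] T(1)[OF nL[OF mn(1,3)] mn(1)] T(1)[OF nL[OF mn(2,4)] mn(2)]
              two[OF i] two[OF mn(1,3)] two[OF mn(2,4)] s(1)])
      then have "splits (\<lambda>c. sym_chain X c \<and> only_bad (\<lambda>u v. v - u = V t \<and> u \<inter> V i = s) c) ?Q"
        using union4[OF q(1)] prd_perm[OF q, of ?P] by (simp add: Un_assoc)
      then show ?thesis
      proof (rule splits_mono)
        fix c assume c: "sym_chain X c \<and> only_bad (\<lambda>u v. v - u = V t \<and> u \<inter> V i = s) c"
        have "only_bad ?B c"
        proof (rule only_bad_mono)
          show "only_bad (\<lambda>u v. v - u = V t \<and> u \<inter> V i = s) c" using c by blast
          fix u v assume "v - u = V t \<and> u \<inter> V i = s"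
          then show "?B u v" using less(1) s(2) by (auto simp: i_def)
        qed
        then show "sym_chain X c \<and> only_bad ?B c" using c by blast
      qed
    qed
  next
    case 5
    have A: "splits (tame_chain (V t \<union> V j)) (?P t \<otimes> ?P j)" "splits (tame_chain (V k \<union> V l)) (?P k \<otimes> ?P l)"
      using splits_tame_chain_tame_chain VU4 d T(1)[OF 5(1) less(1)] T(1)[OF 5(2) less(2)] T(1)[OF 5(3) less(3)]
        T(1)[OF 5(4) less(4)] by blast+
    have "V t \<union> V j \<in> U" "V k \<union> V l \<in> U" using union VU4 by auto
    from splits_prd_tame_chain[OF this d'(3) A] show ?thesis unfolding Q X' by (rule tame_chain_case)
  qed
qed

end

section \<open>Almost orthogonal families\<close>

text \<open>Listing the members by cardinality works: consecutive ones are comparable and their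
  sizes differ by one, so the larger arises by adding one point.\<close>

lemma symmetric_chain_sym_chain:
  assumes "symmetric_chain n C"
  shows "\<exists>xs. set xs = C \<and> sym_chain {1..n} xs"
proof -
  obtain j where j: "2 * j \<le> n" "bij_betw card C {j..n - j}" and ch: "subset.chain (Pow {1..n}) C"
    using assms by (auto simp: symmetric_chain_def)
  define x where "x = inv_into C card"
  have x: "x i \<in> C" "card (x i) = i" if "i \<in> {j..n - j}" for i
    using that j(2) unfolding x_def bij_betw_def by (metis inv_into_into, metis f_inv_into_f)
  have sub: "C \<subseteq> Pow {1..n}" and comp: "\<And>a b. a \<in> C \<Longrightarrow> b \<in> C \<Longrightarrow> a \<subseteq> b \<or> b \<subseteq> a"
    using ch by (auto simp: subset_chain_def)
  define xs where "xs = map x [j..<Suc (n - j)]"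
  have "set xs = C"
  proof -
    have "inv_into C card ` card ` C = C" using j(2) inv_into_image_cancel[of card C C] by (auto simp: bij_betw_def image_image)
    moreover have "card ` C = set [j..<Suc (n - j)]" using j(2) by (auto simp: bij_betw_def)
    ultimately show ?thesis unfolding xs_def x_def set_map by simp
  qed
  moreover have "sym_chain {1..n} xs" unfolding sym_chain_def
  proof (intro conjI)
    show "xs \<noteq> []" using j(1) by (simp add: xs_def)
    show "set xs \<subseteq> Pow {1..n}" using sub \<open>set xs = C\<close> by simp
    show "card (hd xs) + card (last xs) = card {1..n}"
      using x(2)[of j] x(2)[of "n - j"] j(1) by (simp add: xs_def hd_map last_map del: upt_Suc)
    show "successively covers xs" unfolding xs_def successively_map
    proof (rule successively_mono[OF successively_upt])
      fix i i' assume h: "i \<in> set [j..<Suc (n - j)]" "i' \<in> set [j..<Suc (n - j)]" "i' = Suc i"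
      then have m: "i \<in> {j..n - j}" "i' \<in> {j..n - j}" by auto
      have fin: "finite (x i)" "finite (x i')"
        using sub x(1)[OF m(1)] x(1)[OF m(2)] by (auto intro: finite_subset)
      have "\<not> x i' \<subseteq> x i" using card_mono[OF fin(1), of "x i'"] x(2)[OF m(1)] x(2)[OF m(2)] h(3) by auto
      then have s: "x i \<subseteq> x i'" using comp x(1) m by blast
      then have "card (x i' - x i) = 1" using card_Diff_subset[OF fin(1) s] x(2)[OF m(1)] x(2)[OF m(2)] h(3) by simp
      then obtain e where "x i' - x i = {e}" by (auto simp: card_1_singleton_iff)
      then show "covers (x i) (x i')" unfolding covers_def using s by blast
    qed
  qed simp
  ultimately show ?thesis by blast
qed

lemma sym_chain_comparable:
  assumes "sym_chain W xs" "u \<in> set xs" "v \<in> set xs"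
  shows "u \<subseteq> v \<or> v \<subseteq> u"
  using assms sym_chain_mono by (metis in_set_conv_nth nat_le_linear)

text \<open>The origin of both length facts: an odd ground set forces even length, and a chain that
  starts at \<open>{}\<close> has \<open>card W + 1\<close> elements.\<close>

lemma sym_chain_length_card:
  assumes "sym_chain W xs"
  shows "Suc (card W) = length xs + 2 * card (hd xs)"
proof -
  have "xs \<noteq> []" using assms by (simp add: sym_chain_def)
  then show ?thesis using sym_chain_card_first[OF assms, of "length xs - 1"]
    by (cases xs) auto
qed

lemma sym_chain_first_empty:
  assumes "sym_chain W xs" "{} \<in> set xs"
  shows "hd xs = {}"
proof -
  obtain i where i: "i < length xs" "xs ! i = {}" using assms(2) by (auto simp: in_set_conv_nth)
  then have "xs ! 0 = {}" using sym_chain_mono[OF assms(1), of 0 i] by simp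
  then show ?thesis using i(1) by (cases xs) auto
qed

lemma sym_chain_symmetric_chain:
  assumes "sym_chain {1..n} xs"
  shows "symmetric_chain n (set xs)"
proof -
  define j where "j = card (hd xs)"
  have len: "Suc n = length xs + 2 * j" and ne: "xs \<noteq> []"
    using sym_chain_length_card[OF assms] assms by (simp_all add: j_def sym_chain_def)
  have c: "card (xs ! i) = j + i" if "i < length xs" for i
    using sym_chain_mono[OF assms, of 0 i] that ne by (simp add: j_def hd_conv_nth)
  have "0 < length xs" using ne by simp
  then have j: "2 * j \<le> n" using len by linarith
  have "subset.chain (Pow {1..n}) (set xs)"
    unfolding subset_chain_def using sym_chain_sub[OF assms] sym_chain_comparable[OF assms] by blast
  moreover have "bij_betw card (set xs) {j..n - j}" unfolding bij_betw_def
  proof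
    show "inj_on card (set xs)"
    proof (rule inj_onI)
      fix u v assume "u \<in> set xs" "v \<in> set xs" and e: "card u = card v"
      then obtain a b where "a < length xs" "b < length xs" "u = xs ! a" "v = xs ! b"
        by (metis in_set_conv_nth)
      then show "u = v" using c e by simp
    qed
    have "card ` set xs = (\<lambda>i. j + i) ` {..<length xs}"
    proof -
      have "set xs = (!) xs ` {..<length xs}" by (auto simp: set_conv_nth image_iff)
      then have "card ` set xs = (\<lambda>i. card (xs ! i)) ` {..<length xs}" by (simp add: image_image)
      then show ?thesis using c by (simp add: image_def)
    qed
    also have "\<dots> = {j..n - j}"
    proof (intro set_eqI iffI)
      fix y assume "y \<in> {j..n - j}"
      then have "y = j + (y - j)" "y - j < length xs" using len j by auto
      then show "y \<in> (\<lambda>i. j + i) ` {..<length xs}" by blast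
    qed (use len j in auto)
    finally show "card ` set xs = {j..n - j}" .
  qed
  ultimately show ?thesis using j by (auto simp: symmetric_chain_def)
qed

text \<open>Almost orthogonality in terms of the order instead of cardinalities, and over any ground
  set, so that it can be moved to the four blocks of the large cube.\<close>

definition ortho_family :: "'a set \<Rightarrow> nat \<Rightarrow> (nat \<Rightarrow> 'a set set set) \<Rightarrow> bool" where
  "ortho_family W k \<A> \<longleftrightarrow>
     (\<forall>i\<in>{1..k}. \<Union>(\<A> i) = Pow W \<and> disjoint (\<A> i) \<and> (\<forall>A\<in>\<A> i. \<exists>xs. set xs = A \<and> sym_chain W xs)) \<and>
     (\<forall>i\<in>{1..k}. \<forall>j\<in>{1..k}. i \<noteq> j \<longrightarrow>
        (\<forall>A\<in>\<A> i. \<forall>B\<in>\<A> j. \<forall>u\<in>A \<inter> B. \<forall>v\<in>A \<inter> B. u \<subset> v \<longrightarrow> u = {} \<and> v = W))"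

lemma ortho_family_cross:
  assumes "ortho_family W k \<A>" and i: "i \<in> {1..k}" and j: "j \<in> {1..k}" and ne: "i \<noteq> j"
    and A: "A \<in> \<A> i" and B: "B \<in> \<A> j" and u: "u \<in> A \<inter> B" and v: "v \<in> A \<inter> B" and uv: "u \<subset> v"
  shows "u = {} \<and> v = W"
proof -
  have "\<forall>i\<in>{1..k}. \<forall>j\<in>{1..k}. i \<noteq> j \<longrightarrow>
        (\<forall>A\<in>\<A> i. \<forall>B\<in>\<A> j. \<forall>u\<in>A \<inter> B. \<forall>v\<in>A \<inter> B. u \<subset> v \<longrightarrow> u = {} \<and> v = W)"
    using assms(1) unfolding ortho_family_def by (rule conjunct2)
  from bspec[OF bspec[OF bspec[OF bspec[OF mp[OF bspec[OF bspec[OF this i] j] ne] A] B] u] v] uv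
  show ?thesis by (rule mp)
qed

lemma ortho_familyD:
  assumes "ortho_family W k \<A>" "i \<in> {1..k}"
  shows "\<Union>(\<A> i) = Pow W" "disjoint (\<A> i)" "A \<in> \<A> i \<Longrightarrow> \<exists>xs. set xs = A \<and> sym_chain W xs"
  using conjunct1[OF assms(1)[unfolded ortho_family_def]] assms(2) by auto

text \<open>The intersection of two chains is a chain, so it has two elements exactly if it contains
  some \<open>u \<subset> v\<close>. The bound \<open>1 \<le> n\<close> keeps \<open>{}\<close> and
  \<open>{1..n}\<close> distinct, as the exceptional value 2 demands.\<close>

lemma ao_scds_iff_ortho_family:
  assumes "1 \<le> n"
  shows "ao_scds n k \<A> \<longleftrightarrow> ortho_family {1..n} k \<A>"
proof
  assume a: "ao_scds n k \<A>"
  show "ortho_family {1..n} k \<A>" unfolding ortho_family_def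
  proof (intro conjI ballI impI)
    fix i assume "i \<in> {1..k}"
    then have s: "scd n (\<A> i)" using a by (simp add: ao_scds_def)
    show "\<Union>(\<A> i) = Pow {1..n}" "disjoint (\<A> i)"
      using s by (auto simp: scd_def partition_on_def)
    fix A assume "A \<in> \<A> i"
    then show "\<exists>xs. set xs = A \<and> sym_chain {1..n} xs"
      using s symmetric_chain_sym_chain by (simp add: scd_def)
  next
    fix i j A B u v
    assume h: "i \<in> {1..k}" "j \<in> {1..k}" "i \<noteq> j" "A \<in> \<A> i" "B \<in> \<A> j" "u \<in> A \<inter> B" "v \<in> A \<inter> B" "u \<subset> v"
    have "almost_orthogonal n (\<A> i) (\<A> j)" "scd n (\<A> i)"
      using a h(1-3) by (auto simp: ao_scds_def pairwise_def)
    then have "symmetric_chain n A" and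
      o: "if {{}, {1..n}} \<subseteq> A \<and> {{}, {1..n}} \<subseteq> B then card (A \<inter> B) = 2 else card (A \<inter> B) \<le> 1"
      using h(4,5) unfolding almost_orthogonal_def scd_def by blast+
    then obtain xs where "set xs = A" "sym_chain {1..n} xs" using symmetric_chain_sym_chain by blast
    then have fin: "finite (A \<inter> B)" by auto
    have "u = {} \<and> v = {1..n}"
    proof (cases "{{}, {1..n}} \<subseteq> A \<and> {{}, {1..n}} \<subseteq> B")
      case True
      have "card {{}, {1..n}} = 2" using assms by simp
      then have "A \<inter> B = {{}, {1..n}}" using o True card_seteq[OF fin, of "{{}, {1..n}}"] by auto
      then show ?thesis using h(6-8) by auto
    next
      case False
      then have "card (A \<inter> B) \<le> 1" using o by presburger
      then have "u = v" using h(6,7) card_le_Suc0_iff_eq[OF fin] by simp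
      then show ?thesis using h(8) by blast
    qed
    then show "u = {}" "v = {1..n}" by auto
  qed
next
  assume a: "ortho_family {1..n} k \<A>"
  show "ao_scds n k \<A>" unfolding ao_scds_def pairwise_def
  proof (intro conjI ballI impI)
    fix i assume "i \<in> {1..k}"
    then have h: "\<Union>(\<A> i) = Pow {1..n}" "disjoint (\<A> i)" "\<forall>A\<in>\<A> i. \<exists>xs. set xs = A \<and> sym_chain {1..n} xs"
      using ortho_familyD[OF a] by blast+
    moreover have "A \<noteq> {} \<and> symmetric_chain n A" if A: "A \<in> \<A> i" for A
    proof -
      obtain xs where xs: "set xs = A" "sym_chain {1..n} xs" using h(3) A by blast
      then have "symmetric_chain n A" using sym_chain_symmetric_chain by blast
      moreover have "xs \<noteq> []" using xs(2) by (simp add: sym_chain_def)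
      ultimately show ?thesis using xs(1) by auto
    qed
    ultimately show "scd n (\<A> i)" unfolding scd_def partition_on_def by blast
  next
    fix i j assume ij: "i \<in> {1..k}" "j \<in> {1..k}" "i \<noteq> j"
    show "almost_orthogonal n (\<A> i) (\<A> j)" unfolding almost_orthogonal_def
    proof (intro ballI)
      fix A B assume AB: "A \<in> \<A> i" "B \<in> \<A> j"
      have key: "u = {} \<and> v = {1..n}" if "u \<in> A \<inter> B" "v \<in> A \<inter> B" "u \<subset> v" for u v
        using ortho_family_cross[OF a ij AB that] .
      obtain xs where xs: "set xs = A" "sym_chain {1..n} xs" using ortho_familyD(3)[OF a ij(1) AB(1)] by blast
      show "if {{}, {1..n}} \<subseteq> A \<and> {{}, {1..n}} \<subseteq> B then card (A \<inter> B) = 2 else card (A \<inter> B) \<le> 1"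
      proof (cases "{{}, {1..n}} \<subseteq> A \<and> {{}, {1..n}} \<subseteq> B")
        case True
        have "A \<inter> B = {{}, {1..n}}" using key[of "{}"] True by blast
        then show ?thesis using assms True by simp
      next
        case False
        have "u = v" if uv: "u \<in> A \<inter> B" "v \<in> A \<inter> B" for u v
        proof (rule ccontr)
          assume "u \<noteq> v"
          then have "u \<subset> v \<or> v \<subset> u" using sym_chain_comparable[OF xs(2), of u v] uv xs(1) by blast
          then have "u = {} \<and> v = {1..n} \<or> v = {} \<and> u = {1..n}"
            using key[OF uv] key[OF uv(2,1)] by blast
          then show False using False uv by blast
        qed
        moreover have "finite (A \<inter> B)" using xs(1) by auto
        ultimately have "card (A \<inter> B) \<le> 1" by (simp add: card_le_Suc0_iff_eq)
        then show ?thesis using False by presburger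
      qed
    qed
  qed
qed

lemma sym_chain_image:
  assumes "sym_chain W xs" "inj (f :: 'a \<Rightarrow> 'b)"
  shows "sym_chain (f ` W) (map ((`) f) xs)"
proof -
  have "successively (\<lambda>x y. covers (f ` x) (f ` y)) xs"
  proof (rule successively_mono)
    show "successively covers xs" using assms by (simp add: sym_chain_def)
    fix x y :: "'a set" assume "covers x y"
    then obtain e where "e \<notin> x" "y = insert e x" by (auto simp: covers_def)
    then have "f e \<notin> f ` x" "f ` y = insert (f e) (f ` x)" using assms(2) by (auto simp: inj_image_mem_iff)
    then show "covers (f ` x) (f ` y)" unfolding covers_def by blast
  qed
  moreover have "card (f ` x) = card x" for x
    by (intro card_image inj_on_subset[OF assms(2)]) simp
  ultimately show ?thesis
    using assms by (auto simp: sym_chain_def successively_map hd_map last_map)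
qed

lemma ortho_family_image:
  assumes "ortho_family W k \<A>" "inj f"
  shows "ortho_family (f ` W) k (\<lambda>i. (`) ((`) f) ` \<A> i)"
  unfolding ortho_family_def
proof (intro conjI ballI impI)
  have inj2: "inj ((`) f)" using assms(2) by (simp add: inj_def inj_image_eq_iff)
  {
    fix i assume i: "i \<in> {1..k}"
    then have h: "\<Union>(\<A> i) = Pow W" "disjoint (\<A> i)" "\<forall>A\<in>\<A> i. \<exists>xs. set xs = A \<and> sym_chain W xs"
      using ortho_familyD[OF assms(1) i] by blast+
    have "\<Union>((`) ((`) f) ` \<A> i) = (`) f ` \<Union>(\<A> i)" by blast
    then show "\<Union>((`) ((`) f) ` \<A> i) = Pow (f ` W)" unfolding h(1) by (simp add: image_Pow_surj)
    show "disjoint ((`) ((`) f) ` \<A> i)"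
    proof (rule disjointI, clarify)
      fix A B assume AB: "A \<in> \<A> i" "B \<in> \<A> i" "(`) f ` A \<noteq> (`) f ` B"
      then have "A \<inter> B = {}" using disjointD[OF h(2)] by blast
      then show "(`) f ` A \<inter> (`) f ` B = {}" using image_Int[OF inj2, of A B] by simp
    qed
    fix A' assume "A' \<in> (`) ((`) f) ` \<A> i"
    then obtain A where A: "A \<in> \<A> i" "A' = (`) f ` A" by blast
    then obtain xs where "set xs = A" "sym_chain W xs" using h(3) by blast
    then show "\<exists>xs. set xs = A' \<and> sym_chain (f ` W) xs"
      using sym_chain_image[OF _ assms(2)] A(2) by (intro exI[of _ "map ((`) f) xs"]) simp
  }
  fix i j A' B' u v
  assume ij: "i \<in> {1..k}" "j \<in> {1..k}" "i \<noteq> j" and "A' \<in> (`) ((`) f) ` \<A> i" "B' \<in> (`) ((`) f) ` \<A> j"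
    and uv: "u \<in> A' \<inter> B'" "v \<in> A' \<inter> B'" "u \<subset> v"
  then obtain A B where AB: "A \<in> \<A> i" "A' = (`) f ` A" "B \<in> \<A> j" "B' = (`) f ` B" by blast
  have "A' \<inter> B' = (`) f ` (A \<inter> B)" using AB image_Int[OF inj2, of A B] by simp
  then have "u \<in> (`) f ` (A \<inter> B)" "v \<in> (`) f ` (A \<inter> B)" using uv(1,2) by simp_all
  then obtain x y where xy: "x \<in> A \<inter> B" "y \<in> A \<inter> B" "u = f ` x" "v = f ` y" by (elim imageE)
  then have "x \<subset> y" using uv(3) assms(2) by (simp add: psubset_eq inj_image_subset_iff inj_image_eq_iff)
  then have "x = {} \<and> y = W" using ortho_family_cross[OF assms(1) ij AB(1,3) xy(1,2)] by blast
  then show "u = {}" "v = f ` W" using xy by auto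
qed

text \<open>Sources of the two-element chains in an orientation of out-degree at most one.\<close>

definition sources :: "nat \<Rightarrow> (nat \<Rightarrow> 'a set set set) \<Rightarrow> (nat \<Rightarrow> 'a set set) \<Rightarrow> bool" where
  "sources k \<A> S \<longleftrightarrow> (\<forall>i\<in>{1..k}. \<forall>A\<in>\<A> i. card A = 2 \<longrightarrow> A \<inter> S i \<noteq> {}) \<and>
     (\<forall>i\<in>{1..k}. \<forall>j\<in>{1..k}. i \<noteq> j \<longrightarrow> S i \<inter> S j = {})"

lemma sources_image:
  assumes "sources k \<A> S" "inj f"
  shows "sources k (\<lambda>i. (`) ((`) f) ` \<A> i) (\<lambda>i. (`) f ` S i)"
proof -
  have inj2: "inj ((`) f)" using assms(2) by (simp add: inj_def inj_image_eq_iff)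
  have c: "card ((`) f ` A) = card A" for A
    by (intro card_image inj_on_subset[OF inj2]) simp
  show ?thesis
    using assms(1) unfolding sources_def
    by (simp add: c image_Int[OF inj2, symmetric])
qed

text \<open>The sources of index \<open>i\<close> are the tails of the arcs along its two-element
  chains. A tail common to two indices would have a single arc, hence the two indices would share a
  two-element chain.\<close>

lemma good_sources:
  assumes "good n k \<A>" "3 \<le> n"
  shows "\<exists>S. sources k \<A> S"
proof -
  obtain R where R: "orientation (two_chains k \<A>) R"
    "\<forall>u\<in>\<Union>(two_chains k \<A>). card {v. (u, v) \<in> R} \<le> 1"
    and ao: "ao_scds n k \<A>"
    using assms(1) by (auto simp: good_def)
  have of: "ortho_family {1..n} k \<A>" using ao ao_scds_iff_ortho_family[of n k \<A>] assms(2) by simp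
  define S where "S i = {u. \<exists>v. (u, v) \<in> R \<and> {u, v} \<in> \<A> i \<and> card {u, v} = 2}" for i
  \<comment> \<open>An infinite set has \<open>card\<close> equal to 0, so the bound on out-degrees
    yields uniqueness only together with finiteness.\<close>
  have fin: "finite {v. (u, v) \<in> R}" for u
  proof (rule finite_subset)
    show "{v. (u, v) \<in> R} \<subseteq> Pow {1..n}"
    proof
      fix v assume "v \<in> {v. (u, v) \<in> R}"
      then have "{u, v} \<in> two_chains k \<A>" using R(1) by (auto simp: orientation_def)
      then obtain i where "i \<in> {1..k}" "{u, v} \<in> \<A> i" by (auto simp: two_chains_def)
      then show "v \<in> Pow {1..n}" using ortho_familyD(1)[OF of, of i] by blast
    qed
  qed simp
  have "A \<inter> S i \<noteq> {}" if i: "i \<in> {1..k}" "A \<in> \<A> i" "card A = 2" for i A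
  proof -
    obtain x y where A: "A = {x, y}" using i(3) by (auto simp: card_2_iff)
    then have "{x, y} \<in> two_chains k \<A>" using i by (auto simp: two_chains_def)
    then have "(x, y) \<in> R \<or> (y, x) \<in> R" using R(1) unfolding orientation_def by blast
    then show ?thesis using i(2,3) unfolding A S_def by (auto simp: insert_commute)
  qed
  moreover have "S i \<inter> S j = {}" if ij: "i \<in> {1..k}" "j \<in> {1..k}" "i \<noteq> j" for i j
  proof (rule ccontr)
    assume "S i \<inter> S j \<noteq> {}"
    then obtain u v w where h: "(u, v) \<in> R" "{u, v} \<in> \<A> i" "card {u, v} = 2"
      "(u, w) \<in> R" "{u, w} \<in> \<A> j" "card {u, w} = 2"
      by (auto simp: S_def)
    have "{u, v} \<in> two_chains k \<A>" using h(2,3) ij(1) unfolding two_chains_def by blast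
    then have "u \<in> \<Union>(two_chains k \<A>)" by blast
    then have "card {v. (u, v) \<in> R} \<le> Suc 0" using bspec[OF R(2)] by simp
    \<comment> \<open>Now \<open>{u, v}\<close> belongs to both decompositions, and almost
      orthogonality makes it consist of \<open>{}\<close> and the full set. A symmetric chain
      through \<open>{}\<close> has \<open>n + 1\<close> elements, which is more than two.\<close>
    then have "v = w" using h(1,4) card_le_Suc0_iff_eq[OF fin] by blast
    obtain xs where xs: "set xs = {u, v}" "sym_chain {1..n} xs" using ortho_familyD(3)[OF of ij(1) h(2)] by blast
    have "u \<noteq> v" using h(3) by auto
    then have "u \<subset> v \<or> v \<subset> u" using sym_chain_comparable[OF xs(2), of u v] xs(1) by auto
    then have "{} \<in> set xs"
      using ortho_family_cross[OF of ij h(2,5)] \<open>v = w\<close> xs(1) by blast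
    then have "hd xs = {}" using sym_chain_first_empty[OF xs(2)] by blast
    then have "length xs = Suc n" using sym_chain_length_card[OF xs(2)] by simp
    moreover have "length xs = 2"
      using distinct_card[OF sym_chain_distinct[OF xs(2)]] xs(1) h(3) by simp
    ultimately show False using assms(2) by simp
  qed
  ultimately have "sources k \<A> S" by (simp add: sources_def)
  then show ?thesis by blast
qed

section \<open>Assembling the four families\<close>

lemma quad_iff:
  fixes V :: "nat \<Rightarrow> 'a set" and A :: "nat \<Rightarrow> 'a set set"
  assumes "\<And>t. t < 4 \<Longrightarrow> A t \<subseteq> Pow (V t)" "\<And>s t. s < 4 \<Longrightarrow> t < 4 \<Longrightarrow> s \<noteq> t \<Longrightarrow> V s \<inter> V t = {}"
  shows "z \<in> A 0 \<otimes> (A 1 \<otimes> (A 2 \<otimes> A 3)) \<longleftrightarrow> z \<subseteq> (\<Union>t<4. V t) \<and> (\<forall>t<4. z \<inter> V t \<in> A t)"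
proof
  have l4: "{..<4} = {0, 1, 2, 3::nat}" by auto
  have all4: "(\<forall>t<4. Q t) \<longleftrightarrow> Q 0 \<and> Q 1 \<and> Q 2 \<and> Q 3" for Q :: "nat \<Rightarrow> bool"
  proof -
    have "(\<forall>t<4. Q t) \<longleftrightarrow> (\<forall>t\<in>{..<4}. Q t)" by auto
    then show ?thesis unfolding l4 by simp
  qed
  {
    assume "z \<in> A 0 \<otimes> (A 1 \<otimes> (A 2 \<otimes> A 3))"
    then obtain a b c d where h: "a \<in> A 0" "b \<in> A 1" "c \<in> A 2" "d \<in> A 3" "z = a \<union> (b \<union> (c \<union> d))"
      by (elim prdE) blast
    have s: "a \<subseteq> V 0" "b \<subseteq> V 1" "c \<subseteq> V 2" "d \<subseteq> V 3" 
      using subsetD[OF assms(1) h(1)] subsetD[OF assms(1) h(2)] subsetD[OF assms(1) h(3)]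
        subsetD[OF assms(1) h(4)] by simp_all
    have d: "V 0 \<inter> V 1 = {}" "V 0 \<inter> V 2 = {}" "V 0 \<inter> V 3 = {}" "V 1 \<inter> V 2 = {}" "V 1 \<inter> V 3 = {}" "V 2 \<inter> V 3 = {}"
      using assms(2) by simp_all
    have "z \<inter> V 0 = a" "z \<inter> V 1 = b" "z \<inter> V 2 = c" "z \<inter> V 3 = d"
      unfolding h(5) using s d by blast+
    moreover have "z \<subseteq> (\<Union>t<4. V t)" unfolding h(5) l4 using s by auto
    ultimately show "z \<subseteq> (\<Union>t<4. V t) \<and> (\<forall>t<4. z \<inter> V t \<in> A t)" unfolding all4 using h(1-4) by simp
  }
  assume h: "z \<subseteq> (\<Union>t<4. V t) \<and> (\<forall>t<4. z \<inter> V t \<in> A t)"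
  then have "z = z \<inter> V 0 \<union> (z \<inter> V 1 \<union> (z \<inter> V 2 \<union> z \<inter> V 3))" unfolding l4 by auto
  moreover have "z \<inter> V 0 \<union> (z \<inter> V 1 \<union> (z \<inter> V 2 \<union> z \<inter> V 3)) \<in> A 0 \<otimes> (A 1 \<otimes> (A 2 \<otimes> A 3))"
    using h unfolding all4 by (intro prdI) auto
  ultimately show "z \<in> A 0 \<otimes> (A 1 \<otimes> (A 2 \<otimes> A 3))" by simp
qed

lemma product_ortho_family:
  fixes V :: "nat \<Rightarrow> 'a set" and \<A> :: "nat \<Rightarrow> nat \<Rightarrow> 'a set set set"
  assumes disj: "\<And>s t. s < 4 \<Longrightarrow> t < 4 \<Longrightarrow> s \<noteq> t \<Longrightarrow> V s \<inter> V t = {}"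
    and odd: "\<And>t. t < 4 \<Longrightarrow> odd (card (V t))" and three: "\<And>t. t < 4 \<Longrightarrow> 3 \<le> card (V t)"
    and fam: "\<And>t. t < 4 \<Longrightarrow> ortho_family (V t) k (\<A> t)"
    and pq: "p < 4" "q < 4" "p \<noteq> q"
    and src: "sources k (\<A> p) (S p)" "sources k (\<A> q) (S q)"
  shows "\<exists>\<D>. ortho_family (\<Union>t<4. V t) k \<D> \<and>
    (\<forall>i\<in>{1..k}. \<forall>D\<in>\<D> i. \<exists>A. (\<forall>t<4. A t \<in> \<A> t i) \<and> D \<subseteq> A 0 \<otimes> (A 1 \<otimes> (A 2 \<otimes> A 3)))"
proof -
  define X where "X = (\<Union>t<4. V t)"
  \<comment> \<open>Each ground set is either missed or contained. In this form closure under
    intersection and union, and the badness of a difference, can be checked in one factor at a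
    time.\<close>
  define U where "U = {d. \<forall>t<4. d \<inter> V t = {} \<or> V t \<subseteq> d}"
  interpret bad_differences U
  proof
    fix d d' assume "d \<in> U" "d' \<in> U"
    then show "d \<inter> d' \<in> U" "d \<union> d' \<in> U" unfolding U_def by blast+
  qed
  have VU: "V t \<in> U" if t: "t < 4" for t
  proof -
    have "V t \<inter> V s = {} \<or> V s \<subseteq> V t" if "s < 4" for s using disj[OF t that] by (cases "s = t") auto
    then show ?thesis by (simp add: U_def)
  qed
  have diff: "u = {} \<and> v = V t" if h: "t < 4" "i \<in> {1..k}" "A \<in> \<A> t i" "u \<in> A" "v \<in> A" "u \<subset> v" "v - u \<in> U" for t i A u v
  proof -
    have "u \<subseteq> V t" "v \<subseteq> V t" using ortho_familyD(1)[OF fam[OF h(1)] h(2)] h(3-5) by blast+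
    moreover have "(v - u) \<inter> V t = {} \<or> V t \<subseteq> v - u" using h(1,7) unfolding U_def by blast
    ultimately show ?thesis using h(6) by blast
  qed
  have piece: "\<exists>xs. set xs = A \<and> even (length xs) \<and>
      (loose_chain (V t) xs \<and> 4 \<le> length xs \<or> tame_chain (V t) xs \<and> 2 \<le> length xs) \<and> sym_chain (V t) xs"
    if h: "t < 4" "i \<in> {1..k}" "A \<in> \<A> t i" for t i A
  proof -
    obtain xs where xs: "set xs = A" "sym_chain (V t) xs" using ortho_familyD(3)[OF fam[OF h(1)] h(2,3)] by blast
    have len: "Suc (card (V t)) = length xs + 2 * card (hd xs)" using sym_chain_length_card[OF xs(2)] .
    then have ev: "even (length xs)" using odd[OF h(1)] by presburger
    have ne: "xs \<noteq> []" using xs(2) by (simp add: sym_chain_def)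
    \<comment> \<open>The rule \<open>remdups_adj.cases\<close> serves as the split into empty
      lists, singletons and lists with two leading elements; evenness excludes the
      singletons.\<close>
    then have two: "2 \<le> length xs" using ev by (cases xs rule: remdups_adj.cases) auto
    show ?thesis
    proof (cases "hd xs = {}")
      case True
      have "tame_but_ends True xs" unfolding tame_but_ends_def
      proof (intro allI impI)
        fix a b assume ab: "a \<le> b \<and> b < length xs \<and> xs ! b - xs ! a \<in> U"
        show "ends True (length xs - 1) a b"
        proof (cases "a = b")
          case False
          have "xs ! a \<subset> xs ! b"
            using sym_chain_mono[OF xs(2), of a b] sym_chain_nth_eq_iff[OF xs(2), of a b] ab False by auto
          moreover have "xs ! a \<in> A" "xs ! b \<in> A" using ab xs(1) nth_mem[of a xs] nth_mem[of b xs] by auto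
          ultimately have e: "xs ! a = {}" "xs ! b = V t" using diff[OF h] ab by blast+
          have "xs ! a = xs ! 0" using e(1) True ne by (simp add: hd_conv_nth)
          then have "a = 0" using sym_chain_nth_eq_iff[OF xs(2), of a 0] ab ne by simp
          moreover have "b = length xs - 1"
          proof -
            have "xs ! b \<subseteq> xs ! (length xs - 1)" 
              using sym_chain_subset_iff[OF xs(2), of b "length xs - 1"] ab ne by (cases xs) auto
            moreover have "xs ! (length xs - 1) \<subseteq> V t" using sym_chain_nth[OF xs(2), of "length xs - 1"] ne by simp
            ultimately have "xs ! b = xs ! (length xs - 1)" using e(2) by auto
            then show ?thesis using sym_chain_nth_eq_iff[OF xs(2), of b "length xs - 1"] ab ne by simp
          qed
          ultimately show ?thesis by (simp add: ends_def)
        qed (simp add: ends_def)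
      qed
      then have "loose_chain (V t) xs" using xs(2) True by (simp add: loose_chain_def)
      moreover have "4 \<le> length xs" using len True three[OF h(1)] by simp
      ultimately show ?thesis using xs ev by blast
    next
      case False
      have "tame (set xs)" unfolding tame_def
      proof (intro ballI impI notI)
        fix u v assume "u \<in> set xs" "v \<in> set xs" "u \<subset> v" "v - u \<in> U"
        then have "u = {}" using diff[OF h] xs(1) by blast
        then show False using sym_chain_first_empty[OF xs(2)] \<open>u \<in> set xs\<close> False by blast
      qed
      then show ?thesis using xs ev two by (auto simp: tame_chain_def)
    qed
  qed
  \<comment> \<open>A good factor other than \<open>t\<close>: this is why two good families are
    asked for, as one of them may supply the maximal chain itself.\<close>
  define g where "g t = (if t = p then q else p)" for t
  have g: "g t < 4 \<and> g t \<noteq> t" for t using pq by (auto simp: g_def)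
  have srcg: "sources k (\<A> (g t)) (S (g t))" for t using src by (simp add: g_def)
  \<comment> \<open>The tolerated pairs depend on \<open>i\<close> only through the sources
    \<open>S (g t) i\<close>, which are disjoint for different indices.\<close>
  define B where "B i u v \<longleftrightarrow> u = {} \<and> v = X \<or> (\<exists>t<4. v - u = V t \<and> u \<inter> V (g t) \<in> S (g t) i)" for i u v
  let ?P = "\<lambda>A. A 0 \<otimes> (A 1 \<otimes> (A 2 \<otimes> A (3::nat)))"
  define \<Phi> where "\<Phi> i c \<longleftrightarrow> sym_chain X c \<and> only_bad (B i) c \<and> (\<exists>A. (\<forall>t<4. A t \<in> \<A> t i) \<and> set c \<subseteq> ?P A)" for i c
  have sub: "A t \<subseteq> Pow (V t)" if h: "i \<in> {1..k}" "\<forall>t<4. A t \<in> \<A> t i" "t < 4" for A i t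
    using ortho_familyD(1)[OF fam[OF h(3)] h(1)] h(2,3) by blast
  have box: "z \<in> ?P A \<longleftrightarrow> z \<subseteq> X \<and> (\<forall>t<4. z \<inter> V t \<in> A t)" if h: "i \<in> {1..k}" "\<forall>t<4. A t \<in> \<A> t i" for A i z
    unfolding X_def by (rule quad_iff[OF sub[OF h] disj])
  have split_box: "splits (\<Phi> i) (?P A)" if i: "i \<in> {1..k}" and A: "\<forall>t<4. A t \<in> \<A> t i" for i A
  proof -
    have "\<exists>C. \<forall>t<4. set (C t) = A t \<and> even (length (C t)) \<and>
      (loose_chain (V t) (C t) \<and> 4 \<le> length (C t) \<or> tame_chain (V t) (C t) \<and> 2 \<le> length (C t)) \<and> sym_chain (V t) (C t)"
      using piece[OF _ i] A by (intro choice) blast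
    then obtain C where C: "\<And>t. t < 4 \<Longrightarrow> set (C t) = A t" "\<And>t. t < 4 \<Longrightarrow> even (length (C t))"
      "\<And>t. t < 4 \<Longrightarrow> loose_chain (V t) (C t) \<and> 4 \<le> length (C t) \<or> tame_chain (V t) (C t) \<and> 2 \<le> length (C t)"
      "\<And>t. t < 4 \<Longrightarrow> sym_chain (V t) (C t)"
      by blast
    have s: "\<exists>s\<in>set (C (g t)). s \<in> S (g t) i" if l: "length (C (g t)) = 2" for t
    proof -
      have gt: "g t < 4" using g by blast
      have "card (A (g t)) = 2" using distinct_card[OF sym_chain_distinct[OF C(4)[OF gt]]] C(1)[OF gt] l by simp
      then have "A (g t) \<inter> S (g t) i \<noteq> {}" using srcg[of t] i A gt unfolding sources_def by blast
      then show ?thesis using C(1)[OF gt] by blast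
    qed
    have "splits (\<lambda>c. sym_chain X c \<and> only_bad (\<lambda>u v. u = {} \<and> v = X \<or> (\<exists>t<4. v - u = V t \<and> u \<inter> V (g t) \<in> S (g t) i)) c)
      (set (C 0) \<otimes> (set (C 1) \<otimes> (set (C 2) \<otimes> set (C 3))))"
      by (rule splits_quad[OF VU disj C(2,3) g, where S = "\<lambda>t. S t i"]) (use s X_def in auto)
    then have "splits (\<lambda>c. sym_chain X c \<and> only_bad (B i) c) (?P A)"
      using C(1) by (simp add: B_def[abs_def])
    then show ?thesis
      by (rule splits_mono) (use A in \<open>auto simp: \<Phi>_def\<close>)
  qed
  have all: "splits (\<Phi> i) (Pow X)" if i: "i \<in> {1..k}" for i
  proof -
    define \<Q> where "\<Q> = {?P A |A. \<forall>t<4. A t \<in> \<A> t i}"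
    have "splits (\<Phi> i) (\<Union>\<Q>)"
    proof (rule splits_Union)
      fix Q assume "Q \<in> \<Q>"
      then show "splits (\<Phi> i) Q" using split_box[OF i] unfolding \<Q>_def by blast
    next
      fix Q Q' assume "Q \<in> \<Q>" "Q' \<in> \<Q>" and ne: "Q \<inter> Q' \<noteq> {}"
      then obtain A A' where A: "Q = ?P A" "\<forall>t<4. A t \<in> \<A> t i" "Q' = ?P A'" "\<forall>t<4. A' t \<in> \<A> t i"
        unfolding \<Q>_def by blast
      obtain z where "z \<in> ?P A" "z \<in> ?P A'" using ne A(1,3) by blast
      then have "z \<inter> V t \<in> A t \<inter> A' t" if "t < 4" for t using that box[OF i A(2)] box[OF i A(4)] by blast
      \<comment> \<open>A common element restricts to a common element in each factor, and there the
        chains of one decomposition are disjoint. So two cuboids of one index that meet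
        coincide.\<close>
      then have "A t = A' t" if t: "t < 4" for t
        using disjointD[OF ortho_familyD(2)[OF fam[OF t] i], of "A t" "A' t"] A(2,4) t by blast
      then show "Q = Q'" unfolding A(1,3) by simp
    qed
    moreover have "\<Union>\<Q> = Pow X"
    proof (intro set_eqI iffI)
      fix z assume "z \<in> \<Union>\<Q>"
      then show "z \<in> Pow X" unfolding \<Q>_def using box[OF i] by blast
    next
      fix z assume z: "z \<in> Pow X"
      have "\<exists>A. \<forall>t<4. A t \<in> \<A> t i \<and> z \<inter> V t \<in> A t"
      proof (intro choice allI)
        fix t show "\<exists>A. t < 4 \<longrightarrow> A \<in> \<A> t i \<and> z \<inter> V t \<in> A"
        proof (cases "t < 4")
          case True
          have "z \<inter> V t \<in> \<Union>(\<A> t i)" using ortho_familyD(1)[OF fam[OF True] i] by auto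
          then show ?thesis by blast
        qed simp
      qed
      then obtain A where "\<forall>t<4. A t \<in> \<A> t i" "\<forall>t<4. z \<inter> V t \<in> A t" by blast
      then show "z \<in> \<Union>\<Q>" unfolding \<Q>_def using box[OF i, of A z] z by blast
    qed
    ultimately show ?thesis by simp
  qed
  have "\<exists>\<C>. \<forall>i\<in>{1..k}. Pow X = (\<Union>c\<in>\<C> i. set c) \<and> (\<forall>c\<in>\<C> i. \<Phi> i c) \<and>
     (\<forall>c\<in>\<C> i. \<forall>d\<in>\<C> i. set c \<inter> set d \<noteq> {} \<longrightarrow> c = d)"
    using all unfolding splits_def by (intro bchoice) blast
  then obtain \<C> where C: "\<And>i. i \<in> {1..k} \<Longrightarrow> Pow X = (\<Union>c\<in>\<C> i. set c)"
    "\<And>i c. i \<in> {1..k} \<Longrightarrow> c \<in> \<C> i \<Longrightarrow> \<Phi> i c"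
    "\<And>i c d. i \<in> {1..k} \<Longrightarrow> c \<in> \<C> i \<Longrightarrow> d \<in> \<C> i \<Longrightarrow> set c \<inter> set d \<noteq> {} \<Longrightarrow> c = d"
    by metis
  have "ortho_family X k (\<lambda>i. set ` \<C> i)" unfolding ortho_family_def
  proof (intro conjI ballI impI)
    fix i assume i: "i \<in> {1..k}"
    show "\<Union>(set ` \<C> i) = Pow X" using C(1)[OF i] by simp
    show "disjoint (set ` \<C> i)"
    proof (rule disjointI)
      fix D E assume "D \<in> set ` \<C> i" "E \<in> set ` \<C> i" "D \<noteq> E"
      then show "D \<inter> E = {}" using C(3)[OF i] by blast
    qed
    fix D assume "D \<in> set ` \<C> i"
    then obtain c where "c \<in> \<C> i" "D = set c" by blast
    then show "\<exists>xs. set xs = D \<and> sym_chain X xs" using C(2)[OF i] unfolding \<Phi>_def by blast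
  next
    fix i j D E u v
    assume i: "i \<in> {1..k}" and j: "j \<in> {1..k}" and ij: "i \<noteq> j" and DE: "D \<in> set ` \<C> i" "E \<in> set ` \<C> j"
      and uv: "u \<in> D \<inter> E" "v \<in> D \<inter> E" "u \<subset> v"
    obtain c d where cd: "\<Phi> i c" "\<Phi> j d" "D = set c" "E = set d" using DE C(2) i j by blast
    obtain A where A: "\<forall>t<4. A t \<in> \<A> t i" "D \<subseteq> ?P A" using cd(1,3) unfolding \<Phi>_def by blast
    obtain A' where A': "\<forall>t<4. A' t \<in> \<A> t j" "E \<subseteq> ?P A'" using cd(2,4) unfolding \<Phi>_def by blast
    have "u \<in> ?P A" "v \<in> ?P A" "u \<in> ?P A'" "v \<in> ?P A'" using uv A(2) A'(2) by blast+
    then have mem: "u \<inter> V t \<in> A t \<inter> A' t" "v \<inter> V t \<in> A t \<inter> A' t" if "t < 4" for t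
      using that box[OF i A(1)] box[OF j A'(1)] by blast+
    \<comment> \<open>In each factor the restrictions of \<open>u\<close> and \<open>v\<close> lie
      on chains of two different indices, so they agree or are \<open>{}\<close> and
      \<open>V t\<close>.\<close>
    have "v - u \<in> U" unfolding U_def
    proof (intro CollectI allI impI)
      fix t assume t: "t < (4::nat)"
      show "(v - u) \<inter> V t = {} \<or> V t \<subseteq> v - u"
      proof (cases "u \<inter> V t = v \<inter> V t")
        case False
        then have "u \<inter> V t \<subset> v \<inter> V t" using uv(3) by blast
        then have "u \<inter> V t = {} \<and> v \<inter> V t = V t"
          using ortho_family_cross[OF fam[OF t] i j ij _ _ mem[OF t]] A(1) A'(1) t by blast
        then show ?thesis by blast
      qed blast
    qed
    then have Bs: "B i u v" "B j u v" using cd uv unfolding \<Phi>_def only_bad_def by blast+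
    have "u = {} \<and> v = X"
    proof (rule ccontr)
      assume n: "\<not> (u = {} \<and> v = X)"
      obtain t where t: "t < 4" "v - u = V t" "u \<inter> V (g t) \<in> S (g t) i" using Bs(1) n unfolding B_def by blast
      obtain r where r: "r < 4" "v - u = V r" "u \<inter> V (g r) \<in> S (g r) j" using Bs(2) n unfolding B_def by blast
      \<comment> \<open>Both \<open>V t\<close> and \<open>V r\<close> equal \<open>v - u\<close>,
        and distinct ground sets are disjoint and nonempty. The same steering factor
        \<open>g t\<close> is therefore involved, and the part of \<open>u\<close> in it would be a
        source for both \<open>i\<close> and \<open>j\<close>.\<close>
      have "t = r"
      proof (rule ccontr)
        assume "t \<noteq> r"
        then have "V t = {}" using disj[OF t(1) r(1)] t(2) r(2) by simp
        then show False using three[OF t(1)] by simp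
      qed
      then have "S (g t) i \<inter> S (g t) j \<noteq> {}" using t(3) r(3) by blast
      then show False using srcg[of t] i j ij unfolding sources_def by blast
    qed
    then show "u = {}" "v = X" by auto
  qed
  moreover have "\<exists>A. (\<forall>t<4. A t \<in> \<A> t i) \<and> D \<subseteq> ?P A" if i: "i \<in> {1..k}" and D: "D \<in> set ` \<C> i" for i D
    using C(2)[OF i] D unfolding \<Phi>_def by blast
  ultimately show ?thesis unfolding X_def by blast
qed

lemma less_4_cases: "t < (4::nat) \<Longrightarrow> t = 0 \<or> t = 1 \<or> t = 2 \<or> t = 3"
  by linarith

text \<open>The nested shifts of \<open>cube_pair\<close> add up to offsets \<open>0\<close>,
  \<open>m\<close>, \<open>m + n\<close> and \<open>m + n + p\<close>. The trivial shift by 0 gives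
  all four factors the same shape.\<close>

lemma cuboid_prd:
  "cuboid m n p A B C D = (`) ((+) 0) ` A \<otimes> ((`) ((+) m) ` B \<otimes>
     ((`) ((+) (m + n)) ` C \<otimes> (`) ((+) (m + n + p)) ` D))"
  unfolding cuboid_def cube_pair_def
  by (auto simp: prd_def image_iff image_Un image_image add.assoc)

theorem theorem7p1:
  fixes m n p q k :: nat
    and \<F> \<G> \<H> \<K> :: "nat \<Rightarrow> nat set set set"
  assumes "odd m" "m \<ge> 3" "odd n" "n \<ge> 3" "odd p" "p \<ge> 3" "odd q" "q \<ge> 3"
    and "k \<ge> 3"
    and "ao_scds m k \<F>" "ao_scds n k \<G>" "ao_scds p k \<H>" "ao_scds q k \<K>"
    and two_good:
      "(good m k \<F> \<and> good n k \<G>) \<or> (good m k \<F> \<and> good p k \<H>) \<or> (good m k \<F> \<and> good q k \<K>) \<or>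
       (good n k \<G> \<and> good p k \<H>) \<or> (good n k \<G> \<and> good q k \<K>) \<or> (good p k \<H> \<and> good q k \<K>)"
  shows "\<exists>\<D> :: nat \<Rightarrow> nat set set set.
    ao_scds (m + n + p + q) k \<D> \<and>
    (\<forall>i\<in>{1..k}. \<forall>X\<in>\<D> i.
       \<exists>A\<in>\<F> i. \<exists>B\<in>\<G> i. \<exists>C\<in>\<H> i. \<exists>D\<in>\<K> i. X \<subseteq> cuboid m n p A B C D)"
proof -
  define N where "N = (!) [m, n, p, q]"
  \<comment> \<open>The offsets of the four consecutive blocks of \<open>{1..m + n + p + q}\<close>,
    so that block \<open>t\<close> is the interval of length \<open>N t\<close> after
    \<open>a t\<close>.\<close>
  define a where "a = (!) [0, m, m + n, m + n + p]"
  define F where "F = (!) [\<F>, \<G>, \<H>, \<K>]"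
  define V where "V t = (+) (a t) ` {1..N t}" for t
  define \<A> where "\<A> t i = (`) ((`) ((+) (a t))) ` F t i" for t i
  have N: "odd (N t)" "3 \<le> N t" "ao_scds (N t) k (F t)" if "t < 4" for t
    using less_4_cases[OF that] assms(1-8,10-13) by (auto simp: N_def F_def)
  have V: "V t = {a t<..a t + N t}" for t by (auto simp: V_def image_iff intro: le_Suc_ex)
  have disj: "V s \<inter> V t = {}" if "s < 4" "t < 4" "s \<noteq> t" for s t
    using less_4_cases[OF that(1)] less_4_cases[OF that(2)] that(3)
    by (elim disjE) (auto simp: V a_def N_def)
  have X: "(\<Union>t<4. V t) = {1..m + n + p + q}"
  proof -
    have "{..<4} = {0, 1, 2, 3::nat}" by auto
    then have "(\<Union>t<4. V t) = ((V 0 \<union> V 1) \<union> V 2) \<union> V 3" by (simp add: Un_assoc)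
    moreover have "{0<..y} \<union> {y<..y + z} = {0<..y + z}" for y z :: nat by auto
    moreover have "{0<..y} = {1..y}" for y :: nat by auto
    ultimately show ?thesis by (simp add: V a_def N_def numeral_2_eq_2 numeral_3_eq_3)
  qed
  have card: "card (V t) = N t" for t by (simp add: V)
  have fam: "ortho_family (V t) k (\<A> t)" if "t < 4" for t
    unfolding V_def \<A>_def
    by (rule ortho_family_image) (use N[OF that] ao_scds_iff_ortho_family in auto)
  obtain r s where rs: "r < 4" "s < 4" "r \<noteq> s" "good (N r) k (F r)" "good (N s) k (F s)"
  proof -
    have "\<exists>r<4. \<exists>s<4. r \<noteq> s \<and> good (N r) k (F r) \<and> good (N s) k (F s)"
      using two_good
      by (elim disjE; unfold N_def F_def)
        (rule exI[of _ 0], simp, rule exI[of _ 1], simp,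
         rule exI[of _ 0], simp, rule exI[of _ 2], simp,
         rule exI[of _ 0], simp, rule exI[of _ 3], simp,
         rule exI[of _ 1], simp, rule exI[of _ 2], simp,
         rule exI[of _ 1], simp, rule exI[of _ 3], simp,
         rule exI[of _ 2], simp, rule exI[of _ 3], simp)
    then show ?thesis using that by blast
  qed
  obtain S S' where S: "sources k (F r) S" "sources k (F s) S'"
    using good_sources[OF rs(4) N(2)[OF rs(1)]] good_sources[OF rs(5) N(2)[OF rs(2)]] by blast
  define T where "T t = (if t = r then (\<lambda>i. (`) ((+) (a r)) ` S i) else (\<lambda>i. (`) ((+) (a s)) ` S' i))" for t
  have src: "sources k (\<A> r) (T r)" "sources k (\<A> s) (T s)"
    using sources_image[OF S(1), of "(+) (a r)"] sources_image[OF S(2), of "(+) (a s)"] rs(3)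
    by (simp_all add: T_def \<A>_def[abs_def])
  have "\<exists>\<D>. ortho_family (\<Union>t<4. V t) k \<D> \<and>
    (\<forall>i\<in>{1..k}. \<forall>D\<in>\<D> i. \<exists>A. (\<forall>t<4. A t \<in> \<A> t i) \<and> D \<subseteq> A 0 \<otimes> (A 1 \<otimes> (A 2 \<otimes> A 3)))"
    by (rule product_ortho_family[of V k \<A> r s T, OF disj _ _ fam rs(1-3) src])
       (simp_all only: card N not_False_eq_True)
  then obtain \<D> where D: "ortho_family {1..m + n + p + q} k \<D>"
    "\<And>i X. i \<in> {1..k} \<Longrightarrow> X \<in> \<D> i \<Longrightarrow> \<exists>A. (\<forall>t<4. A t \<in> \<A> t i) \<and> X \<subseteq> A 0 \<otimes> (A 1 \<otimes> (A 2 \<otimes> A 3))"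
    unfolding X by blast
  show ?thesis
  proof (intro exI[of _ \<D>] conjI ballI)
    show "ao_scds (m + n + p + q) k \<D>" using D(1) ao_scds_iff_ortho_family assms(2) by simp
    fix i X assume "i \<in> {1..k}" "X \<in> \<D> i"
    then obtain A where A: "\<forall>t<4. A t \<in> \<A> t i" "X \<subseteq> A 0 \<otimes> (A 1 \<otimes> (A 2 \<otimes> A 3))" using D(2) by blast
    have "A 0 \<in> \<A> 0 i" "A 1 \<in> \<A> 1 i" "A 2 \<in> \<A> 2 i" "A 3 \<in> \<A> 3 i" using A(1) by auto
    then obtain B0 B1 B2 B3 where B: "B0 \<in> \<F> i" "B1 \<in> \<G> i" "B2 \<in> \<H> i" "B3 \<in> \<K> i"
      "A 0 = (`) ((+) 0) ` B0" "A 1 = (`) ((+) m) ` B1" "A 2 = (`) ((+) (m + n)) ` B2"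
      "A 3 = (`) ((+) (m + n + p)) ` B3"
      by (auto simp: \<A>_def a_def F_def)
    then have "X \<subseteq> cuboid m n p B0 B1 B2 B3" using A(2) unfolding cuboid_prd by simp
    then show "\<exists>A\<in>\<F> i. \<exists>B\<in>\<G> i. \<exists>C\<in>\<H> i. \<exists>D\<in>\<K> i. X \<subseteq> cuboid m n p A B C D"
      using B(1-4) by blast
  qed
qed

end
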